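(* Let $\mathbf A\in\mathbb{R}^{n\times d}$, $\epsilon\in(0,1)$, and $k\in[n]$, and assume $d=\operatorname{poly}(k/\epsilon)$. Let $\mathcal X$ be the set of $n\times k$ matrices whose rows are standard basis vectors. There is an algorithm which returns $\tilde{\mathbf X}\in\mathcal X$ and $\tilde{\mathbf D}\in\mathbb{R}^{k\times d}$ satisfying $$\|\tilde{\mathbf X}\tilde{\mathbf D}-\mathbf A\|_F\le(1+\epsilon)\min_{\mathbf D\in\mathbb{R}^{k\times d},\ \mathbf X\in\mathcal X}\|\mathbf X\mathbf D-\mathbf A\|_F$$ with constant probability, and runs in $n\cdot\operatorname{poly}(k/\epsilon)+\exp\!\big(\tfrac k\epsilon\operatorname{polylog}(k/\epsilon)\big)$ time.
   Context: This is the Euclidean $k$-means clustering problem written in matrix form: $\mathbf X$ assigns each row of $\mathbf A$ to one of $k$ centers (rows of $\mathbf D$). *)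

theory Defs
  imports
    "HOL-Probability.Probability_Mass_Function"
    "HOL-Computational_Algebra.Polynomial"
    "Jordan_Normal_Form.Matrix"
begin

section \<open>The clustering problem\<close>

definition frobenius_norm :: "real mat \<Rightarrow> real" where
  "frobenius_norm M = sqrt (\<Sum>i<dim_row M. \<Sum>j<dim_col M. (M $$ (i, j))\<^sup>2)"

definition assignment_matrices :: "nat \<Rightarrow> nat \<Rightarrow> real mat set" where
  "assignment_matrices n k =
     {X \<in> carrier_mat n k. \<forall>i<n. \<exists>j<k. Matrix.row X i = unit_vec k j}"

text \<open>The infimum below is attained when \<open>1 \<le> k\<close>: there are finitely many assignment
  matrices, and for each of them the choice of centers is a least-squares problem.\<close>

definition kmeans_opt :: "real mat \<Rightarrow> nat \<Rightarrow> real" where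
  "kmeans_opt A k =
     Inf {frobenius_norm (X * D - A) | X D.
            X \<in> assignment_matrices (dim_row A) k \<and> D \<in> carrier_mat k (dim_col A)}"


section \<open>Randomized real RAM\<close>

text \<open>
  The model is a unit-cost real RAM in the style of Preparata and Shamos, presented as a
  structured language. The memory consists of named arrays of natural numbers and named arrays
  of reals; a scalar is cell 0 of an array. A program text mentions finitely many names, while
  cells are addressed indirectly through computed indices.

  The operations are restricted so that unit cost is not unreasonably powerful:
  natural numbers have addition and truncated subtraction but no multiplication or division
  (as in the RAM of Cook and Reckhow); reals have exact field operations and comparison, but no
  rounding to integers; and no real literals may occur in a program, since a real literal could
  encode an infinite amount of advice. The only source of randomness is the uniform choice of a
  natural number in a finite range.
\<close>

type_synonym vname = string

record state =
  nats :: "vname \<Rightarrow> nat \<Rightarrow> nat"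
  reals :: "vname \<Rightarrow> nat \<Rightarrow> real"

datatype nexp = NConst nat | NCell vname nexp | NAdd nexp nexp | NSub nexp nexp

datatype rexp =
    ROfNat nexp | RCell vname nexp
  | RAdd rexp rexp | RSub rexp rexp | RMul rexp rexp | RDiv rexp rexp

datatype bexp = NLess nexp nexp | RLess rexp rexp | BNot bexp | BAnd bexp bexp

datatype com =
    SKIP
  | NStore vname nexp nexp  \<comment> \<open>array, index, value\<close>
  | RStore vname nexp rexp  \<comment> \<open>array, index, value\<close>
  | Rand vname nexp nexp    \<comment> \<open>array, index, inclusive upper bound of the random value\<close>
  | Seq com com
  | If bexp com com
  | While bexp com

primrec nval :: "nexp \<Rightarrow> state \<Rightarrow> nat" where
  "nval (NConst m) s = m"
| "nval (NCell x e) s = nats s x (nval e s)"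
| "nval (NAdd e1 e2) s = nval e1 s + nval e2 s"
| "nval (NSub e1 e2) s = nval e1 s - nval e2 s"

text \<open>Division by zero yields zero.\<close>

primrec rval :: "rexp \<Rightarrow> state \<Rightarrow> real" where
  "rval (ROfNat e) s = real (nval e s)"
| "rval (RCell x e) s = reals s x (nval e s)"
| "rval (RAdd e1 e2) s = rval e1 s + rval e2 s"
| "rval (RSub e1 e2) s = rval e1 s - rval e2 s"
| "rval (RMul e1 e2) s = rval e1 s * rval e2 s"
| "rval (RDiv e1 e2) s = rval e1 s / rval e2 s"

primrec bval :: "bexp \<Rightarrow> state \<Rightarrow> bool" where
  "bval (NLess e1 e2) s \<longleftrightarrow> nval e1 s < nval e2 s"
| "bval (RLess e1 e2) s \<longleftrightarrow> rval e1 s < rval e2 s"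
| "bval (BNot b) s \<longleftrightarrow> \<not> bval b s"
| "bval (BAnd b1 b2) s \<longleftrightarrow> bval b1 s \<and> bval b2 s"

definition nats_upd :: "vname \<Rightarrow> nat \<Rightarrow> nat \<Rightarrow> state \<Rightarrow> state" where
  "nats_upd x i v s = s\<lparr>nats := (nats s)(x := (nats s x)(i := v))\<rparr>"

definition reals_upd :: "vname \<Rightarrow> nat \<Rightarrow> real \<Rightarrow> state \<Rightarrow> state" where
  "reals_upd x i v s = s\<lparr>reals := (reals s)(x := (reals s x)(i := v))\<rparr>"

text \<open>One step costs one unit of time. The expressions evaluated in a step have a size bounded
  by the program text, so charging for every operator separately would change running times
  only by a constant factor depending on the program.\<close>

primrec step :: "com \<Rightarrow> state \<Rightarrow> (com \<times> state) pmf" where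
  "step SKIP s = return_pmf (SKIP, s)"
| "step (NStore x i e) s = return_pmf (SKIP, nats_upd x (nval i s) (nval e s) s)"
| "step (RStore x i e) s = return_pmf (SKIP, reals_upd x (nval i s) (rval e s) s)"
| "step (Rand x i e) s =
     map_pmf (\<lambda>v. (SKIP, nats_upd x (nval i s) v s)) (pmf_of_set {0..nval e s})"
| "step (Seq c1 c2) s =
     (if c1 = SKIP then return_pmf (c2, s)
      else map_pmf (\<lambda>(c1', s'). (Seq c1' c2, s')) (step c1 s))"
| "step (If b c1 c2) s = return_pmf (if bval b s then c1 else c2, s)"
| "step (While b c) s =
     return_pmf (if bval b s then Seq c (While b c) else SKIP, s)"

primrec run :: "nat \<Rightarrow> com \<Rightarrow> state \<Rightarrow> (com \<times> state) pmf" where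
  "run 0 c s = return_pmf (c, s)"
| "run (Suc t) c s = bind_pmf (step c s) (\<lambda>(c', s'). run t c' s')"

definition halts_within :: "nat \<Rightarrow> com \<Rightarrow> state \<Rightarrow> bool" where
  "halts_within t c s \<longleftrightarrow> (\<forall>(c', s') \<in> set_pmf (run t c s). c' = SKIP)"

text \<open>Only meaningful if the program halts within \<open>t\<close> steps; as \<open>SKIP\<close> steps to itself, the
  result then no longer depends on \<open>t\<close>.\<close>

definition final_state :: "nat \<Rightarrow> com \<Rightarrow> state \<Rightarrow> state pmf" where
  "final_state t c s = map_pmf snd (run t c s)"


section \<open>Input and output conventions\<close>

text \<open>Matrices are stored in row-major order, and memory outside the input is zero.\<close>

definition input_state :: "real mat \<Rightarrow> nat \<Rightarrow> real \<Rightarrow> state" where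
  "input_state A k \<epsilon> =
     \<lparr>nats = (\<lambda>x i. if i = 0 \<and> x = ''n'' then dim_row A
                    else if i = 0 \<and> x = ''d'' then dim_col A
                    else if i = 0 \<and> x = ''k'' then k else 0),
      reals = (\<lambda>x i. if i = 0 \<and> x = ''eps'' then \<epsilon>
                     else if x = ''A'' \<and> i < dim_row A * dim_col A
                     then A $$ (i div dim_col A, i mod dim_col A) else 0)\<rparr>"

definition read_matrix :: "vname \<Rightarrow> nat \<Rightarrow> nat \<Rightarrow> state \<Rightarrow> real mat" where
  "read_matrix x m l s = Matrix.mat m l (\<lambda>(i, j). reals s x (i * l + j))"

end

theory Submission
  imports Defs "HOL-Probability.Product_PMF" "HOL-Probability.Hoeffding"
begin


text \<open>
  The proof idea. Squared-distance sampling with \<open>O(k\<^sup>2)\<close> rounds yields, with constant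
  probability, that many centers whose cost is at most 36 times the optimum. They provide upper
  bounds on the sensitivity of every point, with total at most \<open>1 + T\<close> for \<open>T\<close> chosen points, and
  hence an importance sample of \<open>m = poly(k/\<epsilon>)\<close> weighted points. Every cluster of the sample has a nearly optimal center
  that is the mean of \<open>l = O(1/\<epsilon>)\<close> of its points, so it suffices to try the \<open>m ^ (k l)\<close> ways to choose
  \<open>k l\<close> sample positions and to keep the candidate that is cheapest on the sample. A candidate is
  determined by \<open>k l\<close> sample positions and therefore independent of all other samples; Hoeffding's
  inequality and a union bound over the choices of positions then show that no candidate is much
  more expensive on the input than on the sample. In particular the sample size does not depend
  on \<open>n\<close>.

  All random choices are uniform in \<open>{0..<3n}\<close> and are drawn in advance, so that everything
  after the draws is a deterministic computation.
\<close>

subsection \<open>Execution of programs\<close>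

text \<open>The obstacle is that the union bound must not see \<open>n\<close>. It runs over the
  \<open>m ^ K\<close> words of sample positions, \<open>K = k * l\<close>, and not over sets of
  input points; sensitivities bound each weighted summand by \<open>B\<close> times its mean with
  \<open>B\<close> polynomial in \<open>k\<close>, so a polynomial \<open>m\<close> beats
  \<open>K * ln m\<close>. Downward deviations must be excluded for all words, upward ones only for
  the fixed optimum. All costs are squared norms, so a factor \<open>(1 + \<epsilon>)^2\<close> is
  aimed at. The restricted machine dictates the rest. It draws only uniform naturals, so a real
  distribution is replaced by a list of \<open>3 n\<close> indices whose exact multiplicities are
  counted and divided out again. It can neither round reals nor multiply or divide naturals:
  ceilings are found by counting, offsets are tabulated, digits come from repeated subtraction. The
  last may take about \<open>m ^ K\<close> steps for each candidate, so the time contains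
  \<open>(m ^ K)^2\<close>, which is still exponential in \<open>K * ln m\<close> only.\<close>

lemma run_SKIP [simp]: "run t SKIP s = return_pmf (SKIP, s)"
  by (induction t) (auto simp: bind_return_pmf)

lemma run_add: "run (t + u) c s = bind_pmf (run t c s) (\<lambda>(c', s'). run u c' s')"
proof (induction t arbitrary: c s)
  case (Suc t)
  then show ?case
    by (simp add: bind_assoc_pmf case_prod_unfold)
qed (simp add: bind_return_pmf)

text \<open>A single equation carries both facts wanted of a program: with certainty it has reached
  \<open>SKIP\<close> after \<open>t\<close> steps, and \<mu> is the law of its final state.\<close>

definition exec :: "nat \<Rightarrow> com \<Rightarrow> state \<Rightarrow> state pmf \<Rightarrow> bool" where
  "exec t c s \<mu> \<longleftrightarrow> run t c s = map_pmf (Pair SKIP) \<mu>"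

lemma exec_halts: "exec t c s \<mu> \<Longrightarrow> halts_within t c s"
  by (auto simp: exec_def halts_within_def)

lemma exec_final_state: "exec t c s \<mu> \<Longrightarrow> final_state t c s = \<mu>"
  by (simp add: exec_def final_state_def pmf.map_comp o_def)

lemma exec_mono:
  assumes "exec t c s \<mu>" "t \<le> t'"
  shows "exec t' c s \<mu>"
proof -
  obtain u where "t' = t + u" using assms(2) le_Suc_ex by blast
  then show ?thesis
    using assms(1) by (simp add: exec_def run_add bind_map_pmf map_pmf_def bind_assoc_pmf bind_return_pmf)
qed

text \<open>The extra unit is the step from \<open>Seq SKIP c2\<close> to \<open>c2\<close>. The law
  \<nu> of the second part may depend on the intermediate state and has to be known on the support
  of \<mu> only, so that facts about drawn values can be used there.\<close>

lemma exec_Seq: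
  assumes "exec t c1 s \<mu>" "\<And>s'. s' \<in> set_pmf \<mu> \<Longrightarrow> exec u c2 s' (\<nu> s')"
  shows "exec (t + u + 1) (Seq c1 c2) s (bind_pmf \<mu> \<nu>)"
  using assms
proof (induction t arbitrary: c1 s \<mu>)
  case 0
  then have "set_pmf (return_pmf (c1, s)) = set_pmf (map_pmf (Pair SKIP) \<mu>)"
    by (simp add: exec_def)
  then have c1: "c1 = SKIP" by auto
  with 0 have "map_pmf snd (return_pmf (SKIP, s)) = map_pmf snd (map_pmf (Pair SKIP) \<mu>)"
    by (simp add: exec_def)
  then have \<mu>: "\<mu> = return_pmf s" by (simp add: pmf.map_comp o_def)
  show ?case using 0(2)[of s] unfolding c1 \<mu> by (simp add: exec_def bind_return_pmf)
next
  case (Suc t)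
  show ?case
  proof (cases "c1 = SKIP")
    case True
    with Suc have "map_pmf snd (return_pmf (SKIP, s)) = map_pmf snd (map_pmf (Pair SKIP) \<mu>)"
      by (simp add: exec_def bind_return_pmf)
    then have \<mu>: "\<mu> = return_pmf s" by (simp add: pmf.map_comp o_def)
    have "exec (Suc (Suc t + u)) (Seq c1 c2) s (bind_pmf \<mu> \<nu>)"
      using exec_mono[OF Suc(3)[of s], of "Suc t + u"] unfolding True \<mu>
      by (simp add: exec_def bind_return_pmf)
    then show ?thesis by simp
  next
    case False
    define \<mu>' where "\<mu>' = (\<lambda>(c', s'). map_pmf snd (run t c' s'))"
    have eq: "bind_pmf (step c1 s) (\<lambda>(c', s'). run t c' s') = map_pmf (Pair SKIP) \<mu>"
      using Suc.prems(1) by (simp add: exec_def)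
    \<comment> \<open>The hypothesis speaks about the mixture over all successors. Each single
      continuation lies in the support of that mixture, hence ends in \<open>SKIP\<close> as well,
      and the induction hypothesis applies to it.\<close>
    have ex: "exec t c' s' (\<mu>' (c', s'))" if "(c', s') \<in> set_pmf (step c1 s)" for c' s'
    proof -
      have "set_pmf (run t c' s') \<subseteq> set_pmf (bind_pmf (step c1 s) (\<lambda>(c', s'). run t c' s'))"
        using that by (auto simp: set_bind_pmf)
      then have "fst z = SKIP" if "z \<in> set_pmf (run t c' s')" for z
        using that unfolding eq by auto
      then have "run t c' s' = map_pmf (\<lambda>z. (SKIP, snd z)) (run t c' s')"
        by (intro map_pmf_idI[symmetric]) (metis prod.collapse)
      then show ?thesis by (simp add: exec_def \<mu>'_def pmf.map_comp o_def)
    qed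
    have \<mu>: "bind_pmf (step c1 s) \<mu>' = \<mu>"
      using arg_cong[OF eq, of "map_pmf snd"]
      by (simp add: map_bind_pmf pmf.map_comp o_def \<mu>'_def case_prod_unfold)
    have "run (t + u + 1) (Seq c' c2) s' = map_pmf (Pair SKIP) (bind_pmf (\<mu>' (c', s')) \<nu>)"
      if st: "(c', s') \<in> set_pmf (step c1 s)" for c' s'
    proof -
      have "exec u c2 s'' (\<nu> s'')" if "s'' \<in> set_pmf (\<mu>' (c', s'))" for s''
        using that st \<mu> by (intro Suc.prems(2)) (auto simp: set_bind_pmf)
      from Suc.IH[OF ex[OF st] this] show ?thesis by (simp add: exec_def)
    qed
    note seq = this
    have "run (Suc t + u + 1) (Seq c1 c2) s =
      bind_pmf (step c1 s) (\<lambda>z. run (t + u + 1) (Seq (fst z) c2) (snd z))"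
      unfolding add_Suc run.simps step.simps using False
      by (simp only: if_False bind_map_pmf case_prod_unfold fst_conv snd_conv)
    also have "\<dots> = bind_pmf (step c1 s) (\<lambda>z. map_pmf (Pair SKIP) (bind_pmf (\<mu>' z) \<nu>))"
      using seq by (intro bind_pmf_cong) (auto simp del: run.simps)
    also have "\<dots> = map_pmf (Pair SKIP) (bind_pmf \<mu> \<nu>)"
      unfolding \<mu>[symmetric] by (simp add: map_bind_pmf bind_assoc_pmf)
    finally show ?thesis by (simp add: exec_def)
  qed
qed

section \<open>Frame conditions: which arrays a program can modify\<close>

primrec nwritten :: "com \<Rightarrow> vname set" where
  "nwritten SKIP = {}"
| "nwritten (NStore x i e) = {x}"
| "nwritten (RStore x i e) = {}"
| "nwritten (Rand x i e) = {x}"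
| "nwritten (Seq c1 c2) = nwritten c1 \<union> nwritten c2"
| "nwritten (If b c1 c2) = nwritten c1 \<union> nwritten c2"
| "nwritten (While b c) = nwritten c"

primrec rwritten :: "com \<Rightarrow> vname set" where
  "rwritten SKIP = {}"
| "rwritten (NStore x i e) = {}"
| "rwritten (RStore x i e) = {x}"
| "rwritten (Rand x i e) = {}"
| "rwritten (Seq c1 c2) = rwritten c1 \<union> rwritten c2"
| "rwritten (If b c1 c2) = rwritten c1 \<union> rwritten c2"
| "rwritten (While b c) = rwritten c"

definition agree :: "vname set \<Rightarrow> vname set \<Rightarrow> state \<Rightarrow> state \<Rightarrow> bool" where
  "agree X Y s s' \<longleftrightarrow> (\<forall>x. x \<notin> X \<longrightarrow> nats s' x = nats s x) \<and> (\<forall>y. y \<notin> Y \<longrightarrow> reals s' y = reals s y)"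

lemma nats_nats_upd [simp]:
  "nats (nats_upd x i v s) y = (if y = x then (nats s x)(i := v) else nats s y)"
  and reals_nats_upd [simp]: "reals (nats_upd x i v s) = reals s"
  by (auto simp: nats_upd_def)

lemma reals_reals_upd [simp]:
  "reals (reals_upd x i v s) y = (if y = x then (reals s x)(i := v) else reals s y)"
  and nats_reals_upd [simp]: "nats (reals_upd x i v s) = nats s"
  by (auto simp: reals_upd_def)

lemma agree_refl: "agree X Y s s"
  by (simp add: agree_def)

lemma agree_trans: "agree X Y s s' \<Longrightarrow> agree X Y s' s'' \<Longrightarrow> agree X Y s s''"
  by (simp add: agree_def)

lemma agree_mono: "agree X Y s s' \<Longrightarrow> X \<subseteq> X' \<Longrightarrow> Y \<subseteq> Y' \<Longrightarrow> agree X' Y' s s'"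
  by (auto simp: agree_def)

lemma agree_nats_upd: "x \<in> X \<Longrightarrow> agree X Y s (nats_upd x i v s)"
  and agree_reals_upd: "y \<in> Y \<Longrightarrow> agree X Y s (reals_upd y i r s)"
  by (auto simp: agree_def)

text \<open>The two inclusions allow iteration over steps, since the successor is a different
  program. Whole arrays are tracked and not cells, so computed indices never need to be
  known.\<close>

lemma step_agree:
  "(c', s') \<in> set_pmf (step c s) \<Longrightarrow>
     nwritten c' \<subseteq> nwritten c \<and> rwritten c' \<subseteq> rwritten c \<and> agree (nwritten c) (rwritten c) s s'"
proof (induction c arbitrary: c' s')
  case (Seq c1 c2)
  then show ?case
    by (fastforce split: if_splits simp: agree_def)
qed (auto simp: agree_def split: if_splits)

lemma run_agree:
  "(c', s') \<in> set_pmf (run t c s) \<Longrightarrow> agree (nwritten c) (rwritten c) s s'"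
proof (induction t arbitrary: c s)
  case (Suc t)
  then obtain c1 s1 where "(c1, s1) \<in> set_pmf (step c s)" "(c', s') \<in> set_pmf (run t c1 s1)"
    by auto
  with Suc.IH[OF this(2)] step_agree[OF this(1)] show ?case
    by (meson agree_mono agree_trans)
qed (simp add: agree_refl)

text \<open>Only for computations without random choices: the final state is unique.\<close>

definition wp :: "nat \<Rightarrow> com \<Rightarrow> (state \<Rightarrow> bool) \<Rightarrow> state \<Rightarrow> bool" where
  "wp t c Q s \<longleftrightarrow> (\<exists>s'. exec t c s (return_pmf s') \<and> Q s')"

lemma wp_frame: "wp t c Q s \<Longrightarrow> wp t c (\<lambda>s'. Q s' \<and> agree (nwritten c) (rwritten c) s s') s"
  unfolding wp_def exec_def using run_agree[of SKIP _ t c s] by fastforce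

lemma wp_time: "wp t c Q s \<Longrightarrow> t \<le> t' \<Longrightarrow> wp t' c Q s"
  unfolding wp_def using exec_mono by blast

text \<open>The frame is available for free when the new postcondition is proved, so specifications
  only have to mention the arrays that a block writes.\<close>

lemma wp_conseq:
  assumes "wp t c Q s" "\<And>s'. agree (nwritten c) (rwritten c) s s' \<Longrightarrow> Q s' \<Longrightarrow> Q' s'" "t \<le> t'"
  shows "wp t' c Q' s"
  using wp_frame[OF assms(1)] assms(2) wp_time[OF _ assms(3)] unfolding wp_def by blast

lemma wp_NStore: "Q (nats_upd x (nval i s) (nval e s) s) \<Longrightarrow> wp 1 (NStore x i e) Q s"
  and wp_RStore: "Q (reals_upd x (nval i s) (rval r s) s) \<Longrightarrow> wp 1 (RStore x i r) Q s"
  by (auto simp: wp_def exec_def bind_return_pmf)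

lemma wp_Seq: "wp t c1 (wp u c2 Q) s \<Longrightarrow> wp (t + u + 1) (Seq c1 c2) Q s"
  unfolding wp_def using exec_Seq[of t c1 s "return_pmf _" u c2 "\<lambda>s'. return_pmf _"]
  by (fastforce simp: bind_return_pmf)

lemma wp_step: "step c s = return_pmf (c', s') \<Longrightarrow> wp t c' Q s' \<Longrightarrow> wp (t + 1) c Q s"
  by (simp add: wp_def exec_def bind_return_pmf)

lemma wp_If: "wp t (if bval b s then c1 else c2) Q s \<Longrightarrow> wp (t + 1) (If b c1 c2) Q s"
  by (auto simp: wp_def exec_def bind_return_pmf)

lemma wp_SKIP: "Q s \<Longrightarrow> wp 0 SKIP Q s"
  by (auto simp: wp_def exec_def)

lemma wp_NStore_Seq:
  "wp t c Q (nats_upd x (nval i s) (nval e s) s) \<Longrightarrow> wp (t + 2) (Seq (NStore x i e) c) Q s"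
  and wp_RStore_Seq:
  "wp t c Q (reals_upd y (nval i s) (rval r s) s) \<Longrightarrow> wp (t + 2) (Seq (RStore y i r) c) Q s"
  using wp_Seq[OF wp_NStore, of t c Q] wp_Seq[OF wp_RStore, of t c Q] by (auto simp: eval_nat_numeral)

text \<open>The measure limits the number of rounds to \<open>M\<close>. A round costs the test, the
  body and the step out of \<open>Seq\<close>, hence \<open>t + 2\<close>; the final unit is the
  failing test.\<close>

lemma wp_While:
  fixes \<mu> :: "state \<Rightarrow> nat"
  assumes "I s0"
    and step: "\<And>s. agree (nwritten c) (rwritten c) s0 s \<Longrightarrow> I s \<Longrightarrow> bval b s \<Longrightarrow>
                 wp t c (\<lambda>s'. I s' \<and> \<mu> s' < \<mu> s) s"
    and fin: "\<And>s. agree (nwritten c) (rwritten c) s0 s \<Longrightarrow> I s \<Longrightarrow> \<not> bval b s \<Longrightarrow> Q s"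
    and "\<mu> s0 \<le> M"
  shows "wp (M * (t + 2) + 1) (While b c) Q s0"
proof -
  have "wp (M * (t + 2) + 1) (While b c) Q s"
    if "agree (nwritten c) (rwritten c) s0 s" "I s" "\<mu> s \<le> M" for s
    using that
  proof (induction M arbitrary: s)
    case 0
    then have "\<not> bval b s" using step[OF 0(1,2)] by (auto simp: wp_def)
    then show ?case using fin[OF 0(1,2)] by (auto simp: wp_def exec_def bind_return_pmf)
  next
    case (Suc M)
    show ?case
    proof (cases "bval b s")
      case False
      then show ?thesis using fin[OF Suc(2,3)] by (auto simp: wp_def exec_def bind_return_pmf)
    next
      case True
      have "wp t c (wp (M * (t + 2) + 1) (While b c) Q) s"
        by (rule wp_conseq[OF step[OF Suc(2,3) True]])
          (use Suc in \<open>auto intro!: Suc.IH[simplified] intro: agree_trans[OF Suc(2)]\<close>)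
      from wp_Seq[OF this] have "wp (t + (M * (t + 2) + 1) + 1) (Seq c (While b c)) Q s" .
      then have "wp (t + (M * (t + 2) + 1) + 1 + 1) (While b c) Q s"
        by (rule wp_step[rotated]) (simp add: True)
      then show ?thesis by (rule wp_time) (simp add: algebra_simps)
    qed
  qed
  then show ?thesis using assms by (simp add: agree_refl)
qed

section \<open>Counting loops and rounding up\<close>

abbreviation NV :: "vname \<Rightarrow> nexp" where "NV x \<equiv> NCell x (NConst 0)"
abbreviation RV :: "vname \<Rightarrow> rexp" where "RV x \<equiv> RCell x (NConst 0)"
abbreviation NSet :: "vname \<Rightarrow> nexp \<Rightarrow> com" where "NSet x e \<equiv> NStore x (NConst 0) e"
abbreviation RSet :: "vname \<Rightarrow> rexp \<Rightarrow> com" where "RSet x e \<equiv> RStore x (NConst 0) e"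
abbreviation NIncr :: "vname \<Rightarrow> com" where "NIncr x \<equiv> NSet x (NAdd (NV x) (NConst 1))"

definition For :: "vname \<Rightarrow> nexp \<Rightarrow> com \<Rightarrow> com" where
  "For x e c = Seq (NSet x (NConst 0)) (While (NLess (NV x) e) (Seq c (NIncr x)))"

lemma written_For [simp]:
  "nwritten (For x e c) = insert x (nwritten c)" "rwritten (For x e c) = rwritten c"
  by (auto simp: For_def)

text \<open>The bound \<open>e\<close> is evaluated anew in every round, hence the assumption that
  its value is \<open>N\<close> in every state the loop can reach. The invariant is indexed by the
  counter and is restored for the state in which the counter has already been advanced.\<close>

lemma wp_For:
  assumes x: "x \<notin> nwritten c"
    and bound: "\<And>s. agree (insert x (nwritten c)) (rwritten c) s0 s \<Longrightarrow> nval e s = N"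
    and init: "I 0 (nats_upd x 0 0 s0)"
    and step: "\<And>i s. i < N \<Longrightarrow> agree (insert x (nwritten c)) (rwritten c) s0 s \<Longrightarrow> nats s x 0 = i \<Longrightarrow>
                 I i s \<Longrightarrow> wp t c (\<lambda>s'. I (Suc i) (nats_upd x 0 (Suc i) s')) s"
    and fin: "\<And>s. agree (insert x (nwritten c)) (rwritten c) s0 s \<Longrightarrow> nats s x 0 = N \<Longrightarrow> I N s \<Longrightarrow> Q s"
  shows "wp (N * (t + 4) + 3) (For x e c) Q s0"
proof -
  let ?ag = "agree (insert x (nwritten c)) (rwritten c)"
  have "wp (N * (t + 2 + 2) + 1) (While (NLess (NV x) e) (Seq c (NIncr x))) Q (nats_upd x 0 0 s0)"
  proof (rule wp_While[where I = "\<lambda>s. ?ag s0 s \<and> nats s x 0 \<le> N \<and> I (nats s x 0) s"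
        and \<mu> = "\<lambda>s. N - nats s x 0"], goal_cases)
    case 1
    then show ?case using init by (simp add: agree_nats_upd)
  next
    case (2 s)
    then have lt: "nats s x 0 < N" using bound by auto
    have "wp t c (wp 1 (NIncr x) (\<lambda>s'. (?ag s0 s' \<and> nats s' x 0 \<le> N \<and> I (nats s' x 0) s')
             \<and> N - nats s' x 0 < N - nats s x 0)) s"
    proof (rule wp_conseq[OF step[OF lt, of s]], goal_cases)
      case (4 s')
      have "nats s' x = nats s x" using 4 x by (simp add: agree_def)
      moreover have "?ag s0 (nats_upd x 0 (Suc (nats s' x 0)) s')"
        using 2 4 by (meson agree_mono agree_nats_upd agree_trans insertI1 order_refl subset_insertI)
      ultimately show ?case using 4 lt
        by (intro wp_NStore) auto
    qed (use 2 in auto)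
    from wp_Seq[OF this] show ?case by (simp add: ac_simps)
  next
    case (3 s)
    then show ?case using bound[of s] fin[of s] by auto
  qed simp
  from this have "wp (N * (t + 2 + 2) + 1 + 2) (For x e c) Q s0"
    unfolding For_def by (intro wp_NStore_Seq) simp
  then show ?thesis by (rule wp_time) (simp add: algebra_simps)
qed

text \<open>Reals cannot be rounded in the model, so a ceiling is found by counting upwards. The
  time is linear in the result, which is affordable for the parameters and for
  \<open>m ^ K\<close>.\<close>

definition count_to :: "vname \<Rightarrow> rexp \<Rightarrow> com" where
  "count_to x r = Seq (NSet x (NConst 0)) (While (RLess (ROfNat (NV x)) r) (NIncr x))"

lemma written_count_to [simp]: "nwritten (count_to x r) = {x}" "rwritten (count_to x r) = {}"
  by (auto simp: count_to_def)

lemma wp_count_to: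
  assumes "\<And>s. agree {x} {} s0 s \<Longrightarrow> rval e s = r" "nat \<lceil>r\<rceil> \<le> M"
    and "Q (nats_upd x 0 (nat \<lceil>r\<rceil>) s0)"
  shows "wp (M * 3 + 3) (count_to x e) Q s0"
proof -
  have upd: "nats_upd x 0 a (nats_upd x 0 b s) = nats_upd x 0 a s" for a b s
    by (simp add: nats_upd_def)
  have "wp (M * (1 + 2) + 1) (While (RLess (ROfNat (NV x)) e) (NIncr x)) Q (nats_upd x 0 0 s0)"
  proof (rule wp_While[where I = "\<lambda>s. \<exists>i \<le> nat \<lceil>r\<rceil>. s = nats_upd x 0 i s0"
        and \<mu> = "\<lambda>s. nat \<lceil>r\<rceil> - nats s x 0"], goal_cases)
    case (2 s)
    then obtain i where i: "s = nats_upd x 0 i s0" by blast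
    then have "real i < r" using 2 assms(1)[of s] by (auto simp: agree_nats_upd)
    then have "i < nat \<lceil>r\<rceil>" by linarith
    then show ?case using i by (intro wp_NStore) (auto simp: upd intro!: exI[of _ "Suc i"])
  next
    case (3 s)
    then obtain i where i: "s = nats_upd x 0 i s0" "i \<le> nat \<lceil>r\<rceil>" by blast
    then have "\<not> real i < r" using 3 assms(1)[of s] by (auto simp: agree_nats_upd)
    then have "i = nat \<lceil>r\<rceil>" using i by linarith
    then show ?case using assms(3) i by simp
  qed (use assms(2) in auto)
  from this have "wp (M * (1 + 2) + 1 + 2) (count_to x e) Q s0"
    unfolding count_to_def by (intro wp_NStore_Seq) simp
  then show ?thesis by (rule wp_time) (simp add: algebra_simps)
qed


subsection \<open>Squared distances\<close>

definition sqd :: "nat \<Rightarrow> (nat \<Rightarrow> real) \<Rightarrow> (nat \<Rightarrow> real) \<Rightarrow> real" where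
  "sqd d u v = (\<Sum>h<d. (u h - v h)\<^sup>2)"

lemma sqd_nonneg [simp]: "0 \<le> sqd d u v"
  by (simp add: sqd_def sum_nonneg)

lemma sqd_commute: "sqd d u v = sqd d v u"
  by (simp add: sqd_def power2_commute)

text \<open>Squared distances satisfy the triangle inequality only up to the factor 2. This factor
  is the source of the constants 18, 36 and 148 below.\<close>

lemma sqd_triangle: "sqd d u w \<le> 2 * sqd d u v + 2 * sqd d v w"
proof -
  have "(a - c)\<^sup>2 \<le> 2 * (a - b)\<^sup>2 + 2 * (b - c)\<^sup>2" for a b c :: real
    using zero_le_power2[of "(a - b) - (b - c)"] by (simp add: power2_eq_square algebra_simps)
  then show ?thesis
    by (simp add: sqd_def sum_distrib_left flip: sum.distrib) (intro sum_mono, simp)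
qed

lemma sqd_cong: "(\<And>h. h < d \<Longrightarrow> u h = u' h) \<Longrightarrow> (\<And>h. h < d \<Longrightarrow> v h = v' h) \<Longrightarrow> sqd d u v = sqd d u' v'"
  by (simp add: sqd_def)

definition near :: "nat \<Rightarrow> nat \<Rightarrow> (nat \<Rightarrow> nat \<Rightarrow> real) \<Rightarrow> (nat \<Rightarrow> real) \<Rightarrow> real" where
  "near d k Z u = Min ((\<lambda>j. sqd d u (Z j)) ` {..<k})"

lemma near_cong: "(\<And>j. j < k \<Longrightarrow> Z j = Z' j) \<Longrightarrow> near d k Z u = near d k Z' u"
  unfolding near_def by (intro arg_cong[where f = Min] image_cong) auto

lemma near_le: "j < k \<Longrightarrow> near d k Z u \<le> sqd d u (Z j)"
  by (simp add: near_def)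

lemma near_attained:
  assumes "k \<ge> 1"
  obtains j where "j < k" "near d k Z u = sqd d u (Z j)"
proof -
  have "near d k Z u \<in> (\<lambda>j. sqd d u (Z j)) ` {..<k}"
    unfolding near_def using assms by (intro Min_in) (auto simp: lessThan_empty_iff)
  then show ?thesis using that by auto
qed

lemma near_nonneg: "k \<ge> 1 \<Longrightarrow> 0 \<le> near d k Z u"
  by (metis near_attained sqd_nonneg)

lemma near_triangle:
  assumes "k \<ge> 1"
  shows "near d k Z u \<le> 2 * sqd d u v + 2 * near d k Z v"
proof -
  obtain j where "j < k" "near d k Z v = sqd d v (Z j)" using near_attained[OF assms] .
  then show ?thesis using near_le[of j k d Z u] sqd_triangle[of d u "Z j" v] by linarith
qed

subsection \<open>Means of few sample points\<close>

definition wmean :: "'a set \<Rightarrow> ('a \<Rightarrow> real) \<Rightarrow> ('a \<Rightarrow> nat \<Rightarrow> real) \<Rightarrow> nat \<Rightarrow> real" where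
  "wmean G w y h = (\<Sum>p\<in>G. w p * y p h) / sum w G"

lemma wmean_sum:
  assumes "sum w G \<noteq> 0"
  shows "(\<Sum>p\<in>G. w p * (y p h - wmean G w y h)) = 0"
  using assms by (simp add: right_diff_distrib sum_subtractf flip: sum_distrib_right)
    (simp add: wmean_def)

text \<open>The parallel axis theorem: in the expansion around the mean the cross term vanishes. It
  makes the mean the best center for nonnegative weights and measures exactly what any other center
  loses.\<close>

lemma sum_sqd_decompose:
  assumes "sum w G \<noteq> 0"
  shows "(\<Sum>p\<in>G. w p * sqd d (y p) z) =
           (\<Sum>p\<in>G. w p * sqd d (y p) (wmean G w y)) + sum w G * sqd d (wmean G w y) z"
proof -
  have "(\<Sum>p\<in>G. w p * (y p h - z h)\<^sup>2) =
      (\<Sum>p\<in>G. w p * (y p h - wmean G w y h)\<^sup>2) + sum w G * (wmean G w y h - z h)\<^sup>2" for h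
  proof -
    let ?m = "wmean G w y h"
    have "(\<Sum>p\<in>G. w p * (y p h - z h)\<^sup>2) =
      (\<Sum>p\<in>G. w p * (y p h - ?m)\<^sup>2 + (w p * (y p h - ?m)) * (2 * (?m - z h)) + w p * (?m - z h)\<^sup>2)"
      by (intro sum.cong refl) (simp add: power2_eq_square algebra_simps)
    also have "\<dots> = (\<Sum>p\<in>G. w p * (y p h - ?m)\<^sup>2) + (\<Sum>p\<in>G. w p * (y p h - ?m)) * (2 * (?m - z h))
        + sum w G * (?m - z h)\<^sup>2"
      by (simp add: sum.distrib sum_distrib_right)
    finally show ?thesis using wmean_sum[OF assms] by simp
  qed
  then show ?thesis
    by (simp add: sqd_def sum_distrib_left sum.swap[of _ _ G] sum.distrib)
qed

text \<open>The points are chosen one after the other. As the average of \<open>y p - \<mu>\<close> is zero, the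
  squared length of the accumulated deviation grows by the variance on average, and some point is
  at least as good as the average.\<close>

lemma few_points_deviation:
  fixes y :: "'a \<Rightarrow> nat \<Rightarrow> real" and d :: nat
  assumes "finite G" "\<And>p. p \<in> G \<Longrightarrow> 0 \<le> w p" "sum w G > 0"
  defines "\<mu> \<equiv> wmean G w y"
  defines "\<sigma> \<equiv> (\<Sum>p\<in>G. w p * sqd d (y p) \<mu>) / sum w G"
  shows "\<exists>c. (\<forall>a<l. c a \<in> G) \<and>
    (\<Sum>h<d. (\<Sum>a<l. y (c a) h - \<mu> h)\<^sup>2) \<le> real l * \<sigma>"
proof (induction l)
  case (Suc l)
  then obtain c where c: "\<And>a. a < l \<Longrightarrow> c a \<in> G"
    "(\<Sum>h<d. (\<Sum>a<l. y (c a) h - \<mu> h)\<^sup>2) \<le> real l * \<sigma>" by blast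
  define v where "v h = (\<Sum>a<l. y (c a) h - \<mu> h)" for h
  define F where "F p = (\<Sum>h<d. (v h + (y p h - \<mu> h))\<^sup>2)" for p
  have "(\<Sum>p\<in>G. w p * F p) = (\<Sum>h<d. \<Sum>p\<in>G. w p * (v h + (y p h - \<mu> h))\<^sup>2)"
    unfolding F_def sum_distrib_left by (rule sum.swap)
  also have "\<dots> = (\<Sum>h<d. (v h)\<^sup>2 * sum w G + (\<Sum>p\<in>G. w p * (y p h - \<mu> h)\<^sup>2))"
  proof (intro sum.cong refl)
    fix h
    have "(\<Sum>p\<in>G. w p * (v h + (y p h - \<mu> h))\<^sup>2) =
      (\<Sum>p\<in>G. (v h)\<^sup>2 * w p + 2 * v h * (w p * (y p h - \<mu> h)) + w p * (y p h - \<mu> h)\<^sup>2)"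
      by (intro sum.cong refl) (simp add: power2_eq_square algebra_simps)
    also have "\<dots> = (v h)\<^sup>2 * sum w G + 2 * v h * (\<Sum>p\<in>G. w p * (y p h - \<mu> h)) + (\<Sum>p\<in>G. w p * (y p h - \<mu> h)\<^sup>2)"
      by (simp only: sum.distrib sum_distrib_left)
    finally show "(\<Sum>p\<in>G. w p * (v h + (y p h - \<mu> h))\<^sup>2) = (v h)\<^sup>2 * sum w G + (\<Sum>p\<in>G. w p * (y p h - \<mu> h)\<^sup>2)"
      using wmean_sum[of w G y h] assms(3) by (simp add: \<mu>_def)
  qed
  also have "\<dots> = (\<Sum>h<d. (v h)\<^sup>2) * sum w G + (\<Sum>p\<in>G. w p * sqd d (y p) \<mu>)"
    by (simp add: sum.distrib sum_distrib_right sqd_def sum_distrib_left sum.swap[of _ _ G])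
  also have "\<dots> = ((\<Sum>h<d. (v h)\<^sup>2) + \<sigma>) * sum w G"
    using assms(3) by (simp add: \<sigma>_def field_simps)
  also have "\<dots> \<le> (real l * \<sigma> + \<sigma>) * sum w G"
    using c(2) assms(3) by (intro mult_right_mono) (auto simp: v_def)
  finally have le: "(\<Sum>p\<in>G. w p * F p) \<le> (real (Suc l) * \<sigma>) * sum w G" by (simp add: algebra_simps)
  have "\<exists>p\<in>G. F p \<le> real (Suc l) * \<sigma>"
  proof (rule ccontr)
    assume "\<not> ?thesis"
    then have lt: "F p > real (Suc l) * \<sigma>" if "p \<in> G" for p using that by force
    \<comment> \<open>Some points may have weight 0, so a strict inequality between the sums needs a
      point of positive weight.\<close>
    obtain q where q: "q \<in> G" "w q > 0"
      using assms(3) by (meson not_le sum_nonpos)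
    have "(\<Sum>p\<in>G. w p * F p) > (\<Sum>p\<in>G. w p * (real (Suc l) * \<sigma>))"
      using lt q assms(2) by (intro sum_strict_mono_ex1 assms ballI mult_left_mono)
        (auto intro!: bexI[of _ q] less_imp_le)
    with le show False by (simp add: sum_distrib_right mult.commute)
  qed
  then obtain p where p: "p \<in> G" "F p \<le> real (Suc l) * \<sigma>" by blast
  have "(\<Sum>a<l. y (if a = l then p else c a) h - \<mu> h) = v h" for h
    unfolding v_def by (intro sum.cong) auto
  then show ?case using p c(1)
    by (intro exI[of _ "\<lambda>a. if a = l then p else c a"]) (auto simp: F_def less_Suc_eq simp del: of_nat_Suc)
qed simp

text \<open>A derandomised form of a sampling lemma of Inaba, Katoh and Imai. Dividing the
  accumulated deviation by \<open>l\<close> leaves a squared distance of at most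
  \<open>V / (l * sum w G)\<close> between the mean of the \<open>l\<close> points and the centroid,
  and the parallel axis theorem turns this into the relative loss \<open>1 / l\<close>. Points may
  be repeated, so \<open>l\<close> does not depend on the size of \<open>G\<close>.\<close>

lemma few_points_mean:
  assumes "finite G" "\<And>p. p \<in> G \<Longrightarrow> 0 < w p" "G \<noteq> {}" "l \<ge> 1"
  shows "\<exists>c. (\<forall>a<l. c a \<in> G) \<and>
    (\<Sum>p\<in>G. w p * sqd d (y p) (\<lambda>h. (\<Sum>a<l. y (c a) h) / real l))
      \<le> (1 + 1 / real l) * (\<Sum>p\<in>G. w p * sqd d (y p) z)"
proof -
  have pos: "sum w G > 0" using assms by (intro sum_pos) auto
  define \<mu> where "\<mu> = wmean G w y"
  define V where "V = (\<Sum>p\<in>G. w p * sqd d (y p) \<mu>)"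
  obtain c where c: "\<forall>a<l. c a \<in> G"
    and le: "(\<Sum>h<d. (\<Sum>a<l. y (c a) h - \<mu> h)\<^sup>2) \<le> real l * (V / sum w G)"
    using few_points_deviation[where G = G and w = w and y = y and d = d and l = l] assms pos unfolding V_def \<mu>_def by (auto intro: less_imp_le)
  let ?m = "\<lambda>h. (\<Sum>a<l. y (c a) h) / real l"
  have "\<mu> h - ?m h = - (\<Sum>a<l. y (c a) h - \<mu> h) / real l" for h
    using assms(4) by (simp add: sum_subtractf field_simps)
  then have "sqd d \<mu> ?m = (\<Sum>h<d. (\<Sum>a<l. y (c a) h - \<mu> h)\<^sup>2) / (real l)\<^sup>2"
    unfolding sqd_def by (simp only: power_divide power2_minus sum_divide_distrib[symmetric])
  also have "\<dots> \<le> real l * (V / sum w G) / (real l)\<^sup>2"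
    using le by (rule divide_right_mono) simp
  also have "\<dots> = V / (real l * sum w G)"
    using assms(4) by (simp add: power2_eq_square)
  finally have "sum w G * sqd d \<mu> ?m \<le> V / real l"
    using pos assms(4) by (simp add: field_simps)
  then have "(\<Sum>p\<in>G. w p * sqd d (y p) ?m) \<le> (1 + 1 / real l) * V"
    using sum_sqd_decompose[of w G d y ?m] pos by (simp add: V_def \<mu>_def algebra_simps)
  also have "\<dots> \<le> (1 + 1 / real l) * (\<Sum>p\<in>G. w p * sqd d (y p) z)"
    using sum_sqd_decompose[of w G d y z] pos
    by (intro mult_left_mono) (auto simp: V_def \<mu>_def)
  finally show ?thesis using c by blast
qed


subsection \<open>The optimum\<close>

definition row_fun :: "real mat \<Rightarrow> nat \<Rightarrow> nat \<Rightarrow> real" where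
  "row_fun A i h = A $$ (i, h)"

lemma assignment_mult_index:
  fixes X D :: "real mat"
  assumes X: "X \<in> carrier_mat n k" "Matrix.row X i = unit_vec k j" and D: "D \<in> carrier_mat k d"
    and "i < n" "j < k" "h < d"
  shows "(X * D) $$ (i, h) = D $$ (j, h)"
proof -
  have "(X * D) $$ (i, h) = unit_vec k j \<bullet> Matrix.col D h"
    using assms by simp
  also have "\<dots> = Matrix.col D h $ j"
    using assms by (intro scalar_prod_left_unit) auto
  finally show ?thesis using assms by simp
qed

lemma frobenius_norm_assignment:
  assumes X: "X \<in> carrier_mat n k" "\<And>i. i < n \<Longrightarrow> f i < k \<and> Matrix.row X i = unit_vec k (f i)"
    and D: "D \<in> carrier_mat k d" and A: "A \<in> carrier_mat n d"
  shows "frobenius_norm (X * D - A) = sqrt (\<Sum>i<n. sqd d (row_fun A i) (row_fun D (f i)))"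
proof -
  have "((X * D - A) $$ (i, h))\<^sup>2 = (row_fun A i h - row_fun D (f i) h)\<^sup>2" if "i < n" "h < d" for i h
    using assms that assignment_mult_index[OF X(1) _ D, of i "f i" h]
    by (simp add: row_fun_def power2_commute)
  then show ?thesis using assms by (simp add: frobenius_norm_def sqd_def)
qed

text \<open>Later stages use optimality only through the last property, which compares the optimum
  with arbitrary centers when every point goes to its nearest one; competing assignments no longer
  appear.\<close>

lemma kmeans_opt_attained:
  assumes A: "A \<in> carrier_mat n d" and "1 \<le> k"
  obtains f Z where "\<And>i. i < n \<Longrightarrow> f i < k"
    "kmeans_opt A k = sqrt (\<Sum>i<n. sqd d (row_fun A i) (Z (f i)))"
    "\<And>Z'. (\<Sum>i<n. sqd d (row_fun A i) (Z (f i))) \<le> (\<Sum>i<n. near d k Z' (row_fun A i))"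
proof -
  define x where "x = row_fun A"
  define F where "F = (\<Pi>\<^sub>E i\<in>{..<n}. {..<k})"
  define ctr where "ctr f j = wmean {i. i < n \<and> f i = j} (\<lambda>_. 1) x" for f :: "nat \<Rightarrow> nat" and j
  define g where "g f = (\<Sum>i<n. sqd d (x i) (ctr f (f i)))" for f
  have split: "(\<Sum>i<n. G i (f i)) = (\<Sum>j<k. \<Sum>i | i < n \<and> f i = j. G i j)"
    if "\<And>i. i < n \<Longrightarrow> f i < k" for f and G :: "nat \<Rightarrow> nat \<Rightarrow> real"
  proof -
    have "(\<Sum>i<n. G i (f i)) = (\<Sum>j<k. \<Sum>i\<in>{i \<in> {..<n}. f i = j}. G i (f i))"
      using that by (intro sum.group[symmetric]) auto
    then show ?thesis by (auto intro!: sum.cong)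
  qed
  have g_le: "g f \<le> (\<Sum>i<n. sqd d (x i) (Z (f i)))" if "\<And>i. i < n \<Longrightarrow> f i < k" for f Z
  proof -
    have "(\<Sum>i | i < n \<and> f i = j. sqd d (x i) (ctr f j)) \<le> (\<Sum>i | i < n \<and> f i = j. sqd d (x i) (Z j))" for j
    proof (cases "{i. i < n \<and> f i = j} = {}")
      case True
      \<comment> \<open>The mean of an empty cluster is a division by 0, but such a cluster costs
        nothing whatever its center.\<close>
      show ?thesis unfolding True by simp
    next
      case False
      then have "card {i. i < n \<and> f i = j} \<noteq> 0" by simp
      then show ?thesis
        using sum_sqd_decompose[of "\<lambda>_. 1" "{i. i < n \<and> f i = j}" d x "Z j"]
        by (simp add: ctr_def)
    qed
    then show ?thesis unfolding g_def
      using split[of f "\<lambda>i j. sqd d (x i) (ctr f j)"] split[of f "\<lambda>i j. sqd d (x i) (Z j)"] that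
      by (simp add: sum_mono)
  qed
  have "finite F" "F \<noteq> {}" using assms by (auto simp: F_def PiE_eq_empty_iff lessThan_empty_iff intro!: finite_PiE)
  then obtain f where f: "f \<in> F" "\<And>f'. f' \<in> F \<Longrightarrow> g f \<le> g f'"
    using arg_min_if_finite[of F g] by (metis not_le_imp_less)
  have fk: "f i < k" if "i < n" for i using f(1) that by (auto simp: F_def)
  have le: "g f \<le> (\<Sum>i<n. sqd d (x i) (Z (f' i)))" if "\<And>i. i < n \<Longrightarrow> f' i < k" for f' Z
  proof -
    have "restrict f' {..<n} \<in> F" using that by (auto simp: F_def)
    then have "g f \<le> g (restrict f' {..<n})" by (rule f)
    also have "\<dots> \<le> (\<Sum>i<n. sqd d (x i) (Z (restrict f' {..<n} i)))"
      using that by (intro g_le) auto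
    finally show ?thesis by simp
  qed
  define S where "S = {frobenius_norm (X * D - A) | X D.
            X \<in> assignment_matrices (dim_row A) k \<and> D \<in> carrier_mat k (dim_col A)}"
  have "sqrt (g f) \<in> S"
  proof -
    define X where "X = Matrix.mat n k (\<lambda>(i, j). if j = f i then 1 else 0 :: real)"
    define D where "D = Matrix.mat k d (\<lambda>(j, h). ctr f j h)"
    have row: "Matrix.row X i = unit_vec k (f i)" if "i < n" for i
      using that fk by (intro eq_vecI) (auto simp: X_def unit_vec_def)
    then have "X \<in> assignment_matrices n k"
      using fk by (auto simp: assignment_matrices_def X_def)
    moreover have "frobenius_norm (X * D - A) = sqrt (g f)"
      using A row fk unfolding g_def
      by (subst frobenius_norm_assignment[of X n k f D d])
        (auto simp: X_def D_def row_fun_def x_def intro!: sum.cong sqd_cong)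
    ultimately show ?thesis using A unfolding S_def mem_Collect_eq
      by (intro exI[of _ X] exI[of _ D]) (auto simp: D_def)
  qed
  moreover have "sqrt (g f) \<le> y" if y: "y \<in> S" for y
  proof -
    obtain X D where XD: "X \<in> assignment_matrices n k" "D \<in> carrier_mat k d"
      "y = frobenius_norm (X * D - A)"
      using y A unfolding S_def by auto
    then obtain f' where f': "\<And>i. i < n \<Longrightarrow> f' i < k \<and> Matrix.row X i = unit_vec k (f' i)"
      unfolding assignment_matrices_def by (auto, metis)
    have "y = sqrt (\<Sum>i<n. sqd d (x i) (row_fun D (f' i)))"
      unfolding XD x_def using XD f' A
      by (intro frobenius_norm_assignment) (auto simp: assignment_matrices_def)
    then show ?thesis using le[of f' "row_fun D"] f' by simp
  qed
  ultimately have "kmeans_opt A k = sqrt (g f)"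
    unfolding kmeans_opt_def S_def[symmetric] by (intro cInf_eq_minimum)
  moreover have "g f \<le> (\<Sum>i<n. near d k Z' (x i))" for Z'
  proof -
    have "\<forall>i. \<exists>j<k. near d k Z' (x i) = sqd d (x i) (Z' j)"
      using near_attained[OF \<open>1 \<le> k\<close>] by metis
    then obtain f' where "\<And>i. f' i < k \<and> near d k Z' (x i) = sqd d (x i) (Z' (f' i))" by metis
    then show ?thesis using le[of f' Z'] by simp
  qed
  ultimately show ?thesis using that[of f "ctr f"] fk unfolding g_def x_def by blast
qed


subsection \<open>Sampling with prescribed weights\<close>

text \<open>A draw proportional to real weights is replaced by a uniform draw from a list of length
  \<open>3 n\<close> that contains \<open>i\<close> at least \<open>n w i / sum w\<close> times and at least once; the list is padded
  with the index 0. If all weights vanish, the quotient is 0 and every index occurs once.\<close>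

definition copies :: "nat \<Rightarrow> (nat \<Rightarrow> real) \<Rightarrow> nat \<Rightarrow> nat" where
  "copies n w i = Suc (nat \<lceil>real n * w i / sum w {..<n}\<rceil>)"

text \<open>The bound \<open>m\<close> on the listed indices is separate from \<open>n\<close>, so
  that initial segments of the final list have the same form. Inductions over the list and the
  invariant of the loop that writes it rely on this.\<close>

definition rep_list :: "nat \<Rightarrow> (nat \<Rightarrow> real) \<Rightarrow> nat \<Rightarrow> nat list" where
  "rep_list n w m = concat (map (\<lambda>i. replicate (copies n w i) i) [0..<m])"

definition rep :: "nat \<Rightarrow> (nat \<Rightarrow> real) \<Rightarrow> nat \<Rightarrow> nat" where
  "rep n w u = (if u < length (rep_list n w n) then rep_list n w n ! u else 0)"

definition rep_count :: "nat \<Rightarrow> (nat \<Rightarrow> real) \<Rightarrow> nat \<Rightarrow> nat" where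
  "rep_count n w i = card {u. u < 3 * n \<and> rep n w u = i}"

lemma rep_list_Suc: "rep_list n w (Suc m) = rep_list n w m @ replicate (copies n w m) m"
  by (simp add: rep_list_def)

lemma length_rep_list: "length (rep_list n w m) = (\<Sum>i<m. copies n w i)"
  by (induction m) (auto simp: rep_list_Suc rep_list_def lessThan_Suc)

text \<open>An index occurs at most 2 times more often than its real share, once for rounding up and
  once for \<open>Suc\<close>. The shares add up to \<open>n\<close>, or to 0 if all weights
  vanish.\<close>

lemma length_rep_list_le:
  assumes "\<And>i. i < n \<Longrightarrow> 0 \<le> w i"
  shows "length (rep_list n w n) \<le> 3 * n"
proof -
  define W where "W = sum w {..<n}"
  have W: "W \<ge> 0" using assms by (auto simp: W_def intro: sum_nonneg)
  have "real (copies n w i) \<le> real n * w i / W + 2" if "i < n" for i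
  proof -
    have "real n * w i / W \<ge> 0" using assms[OF that] W by simp
    then show ?thesis unfolding copies_def W_def[symmetric] by simp linarith
  qed
  then have "real (\<Sum>i<n. copies n w i) \<le> (\<Sum>i<n. real n * w i / W + 2)"
    unfolding of_nat_sum by (intro sum_mono) auto
  also have "\<dots> = real n * W / W + 2 * n"
    by (simp add: sum.distrib sum_divide_distrib[symmetric] sum_distrib_left[symmetric] W_def)
  also have "\<dots> \<le> real (3 * n)" by (cases "W = 0") auto
  finally show ?thesis by (simp only: length_rep_list of_nat_le_iff)
qed

lemma set_rep_list: "set (rep_list n w m) = {..<m}"
  by (auto simp: rep_list_def copies_def)

lemma rep_less: "n \<ge> 1 \<Longrightarrow> rep n w u < n"
  using nth_mem[of u "rep_list n w n"] by (auto simp: rep_def set_rep_list simp del: nth_mem)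

lemma copies_le_rep_count:
  assumes "\<And>i. i < n \<Longrightarrow> 0 \<le> w i" "i < n"
  shows "copies n w i \<le> rep_count n w i"
proof -
  have len: "length (filter (\<lambda>y. y = i) (rep_list n w m)) = (if i < m then copies n w i else 0)" for m
    by (induction m) (auto simp: rep_list_Suc rep_list_def less_Suc_eq)
  have "copies n w i = card {u. u < length (rep_list n w n) \<and> rep_list n w n ! u = i}"
    using len[of n] assms(2) by (simp add: length_filter_conv_card)
  also have "\<dots> \<le> rep_count n w i"
    unfolding rep_count_def using length_rep_list_le[of n w] assms(1)
    by (intro card_mono) (auto simp: rep_def)
  finally show ?thesis .
qed

lemma rep_count_pos:
  assumes "\<And>i. i < n \<Longrightarrow> 0 \<le> w i" "i < n"
  shows "0 < rep_count n w i"
proof -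
  have "copies n w i \<le> rep_count n w i" using assms by (rule copies_le_rep_count)
  then show ?thesis by (simp add: copies_def)
qed

text \<open>In terms of probabilities: a uniform draw from \<open>3 * n\<close> positions yields
  \<open>i\<close> with at least a third of the prescribed probability. The division is cleared to
  include the case of total weight 0.\<close>

lemma rep_count_weight:
  assumes "\<And>i. i < n \<Longrightarrow> 0 \<le> w i" "i < n"
  shows "real n * w i \<le> real (rep_count n w i) * sum w {..<n}"
proof (cases "sum w {..<n} = 0")
  case True
  then have "w i = 0" using assms by (subst (asm) sum_nonneg_eq_0_iff) auto
  then show ?thesis using True by simp
next
  case False
  moreover have "sum w {..<n} \<ge> 0" using assms(1) by (auto intro: sum_nonneg)
  ultimately have pos: "sum w {..<n} > 0" by simp
  have "real n * w i / sum w {..<n} \<le> real (copies n w i)"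
    unfolding copies_def by linarith
  also have "\<dots> \<le> real (rep_count n w i)"
    using copies_le_rep_count[of n w i] assms by simp
  finally show ?thesis using pos by (simp add: field_simps)
qed

lemma sum_over_rep:
  assumes "n \<ge> 1"
  shows "(\<Sum>u<3*n. G (rep n w u)) = (\<Sum>i<n. real (rep_count n w i) * G i :: real)"
proof -
  have "(\<Sum>u<3*n. G (rep n w u)) = (\<Sum>i<n. \<Sum>u\<in>{u\<in>{..<3*n}. rep n w u = i}. G (rep n w u))"
    using rep_less[OF assms] by (intro sum.group[symmetric]) auto
  also have "\<dots> = (\<Sum>i<n. real (rep_count n w i) * G i)"
    by (intro sum.cong refl) (simp add: rep_count_def lessThan_def)
  finally show ?thesis .
qed

subsection \<open>Squared-distance sampling\<close>

text \<open>After \<open>r\<close> rounds: the squared distance of every point to the nearest chosen point, and the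
  round in which that point was chosen. In round 0 all weights are 0, so the first point is
  arbitrary.\<close>

primrec dproc :: "nat \<Rightarrow> nat \<Rightarrow> (nat \<Rightarrow> nat \<Rightarrow> real) \<Rightarrow> (nat \<Rightarrow> nat) \<Rightarrow> nat \<Rightarrow> (nat \<Rightarrow> real) \<times> (nat \<Rightarrow> nat)" where
  "dproc n d x g 0 = (\<lambda>_. 0, \<lambda>_. 0)"
| "dproc n d x g (Suc r) =
     (let D = fst (dproc n d x g r); c = snd (dproc n d x g r); q = rep n D (g r) in
       (\<lambda>i. if r = 0 \<or> sqd d (x i) (x q) < D i then sqd d (x i) (x q) else D i,
        \<lambda>i. if r = 0 \<or> sqd d (x i) (x q) < D i then r else c i))"

abbreviation dsq where "dsq n d x g r \<equiv> fst (dproc n d x g r)"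
abbreviation dcl where "dcl n d x g r \<equiv> snd (dproc n d x g r)"

definition pick where "pick n d x g r = rep n (dsq n d x g r) (g r)"

lemma dproc_cong: "(\<And>s. s < r \<Longrightarrow> g s = g' s) \<Longrightarrow> dproc n d x g r = dproc n d x g' r"
  by (induction r) (auto simp: Let_def)

lemma dsq_nonneg: "0 \<le> dsq n d x g r i"
  by (induction r) (auto simp: Let_def)

lemma dsq_Suc_le: "r \<ge> 1 \<Longrightarrow> dsq n d x g (Suc r) i \<le> dsq n d x g r i"
  by (auto simp: Let_def)

lemma dproc_invariant:
  assumes "r \<ge> 1"
  shows "dcl n d x g r i < r \<and> dsq n d x g r i = sqd d (x i) (x (pick n d x g (dcl n d x g r i)))
    \<and> (\<forall>s<r. dsq n d x g r i \<le> sqd d (x i) (x (pick n d x g s)))"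
  using assms
proof (induction r rule: nat_induct_at_least)
  case base
  then show ?case by (simp add: Let_def pick_def)
next
  case (Suc r)
  then show ?case by (auto simp: Let_def pick_def less_Suc_eq)
qed

text \<open>The reference solution \<open>f\<close>, \<open>Z\<close> is arbitrary here; that it is
  optimal enters only as an assumption of \<open>sampling_success\<close>.\<close>

locale clustering =
  fixes n d k :: nat and x :: "nat \<Rightarrow> nat \<Rightarrow> real" and f :: "nat \<Rightarrow> nat" and Z :: "nat \<Rightarrow> nat \<Rightarrow> real"
  assumes n: "1 \<le> n" and k: "1 \<le> k" and f_less: "\<And>i. i < n \<Longrightarrow> f i < k"
begin

definition members where "members j = {i. i < n \<and> f i = j}"
definition \<phi> where "\<phi> j = (\<Sum>i\<in>members j. sqd d (x i) (Z j))"
definition opt where "opt = (\<Sum>i<n. sqd d (x i) (Z (f i)))"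
text \<open>The mean squared distance in cluster \<open>j\<close> is
  \<open>\<phi> j / card (members j)\<close>, and a covering point lies within 8 times it. With the
  division cleared, an empty cluster is covered as soon as any point is chosen. The gap between the
  factor 8 here and the factor 2 in \<open>core\<close> is what makes the core of an uncovered
  cluster expensive.\<close>

definition covered where
  "covered S j \<longleftrightarrow> (\<exists>c\<in>S. real (card (members j)) * sqd d (x c) (Z j) \<le> 8 * \<phi> j)"
definition core where
  "core j = {i \<in> members j. real (card (members j)) * sqd d (x i) (Z j) \<le> 2 * \<phi> j}"

lemma finite_members [simp]: "finite (members j)"
  by (simp add: members_def)

lemma \<phi>_nonneg [simp]: "0 \<le> \<phi> j"
  by (simp add: \<phi>_def sum_nonneg)

lemma sum_members: "(\<Sum>j<k. \<Sum>i\<in>members j. G i) = (\<Sum>i<n. G i)"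
proof -
  have "(\<Sum>j<k. \<Sum>i\<in>{i\<in>{..<n}. f i = j}. G i) = (\<Sum>i<n. G i)"
    using f_less by (intro sum.group) auto
  then show ?thesis by (simp add: members_def)
qed

lemma sum_\<phi>: "sum \<phi> {..<k} = opt"
proof -
  have "sum \<phi> {..<k} = (\<Sum>j<k. \<Sum>i\<in>members j. sqd d (x i) (Z (f i)))"
    unfolding \<phi>_def by (intro sum.cong refl) (auto simp: members_def)
  then show ?thesis by (simp add: sum_members opt_def)
qed

lemma opt_nonneg [simp]: "0 \<le> opt"
  by (simp add: opt_def sum_nonneg)

lemma covered_mono: "covered S j \<Longrightarrow> S \<subseteq> S' \<Longrightarrow> covered S' j"
  by (auto simp: covered_def)

lemma core_covered: "i \<in> core j \<Longrightarrow> i \<in> S \<Longrightarrow> covered S j"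
  unfolding covered_def core_def using \<phi>_nonneg[of j] by (intro bexI[of _ i]) (auto simp del: \<phi>_nonneg)

text \<open>Sending the whole cluster to the covering point costs at most
  \<open>2 * \<phi> j + 2 * (8 * \<phi> j)\<close>.\<close>

lemma covered_cost:
  assumes "covered S j" and D: "\<And>i c. i < n \<Longrightarrow> c \<in> S \<Longrightarrow> D i \<le> sqd d (x i) (x c)"
  shows "sum D (members j) \<le> 18 * \<phi> j"
proof -
  obtain c where c: "c \<in> S" "real (card (members j)) * sqd d (x c) (Z j) \<le> 8 * \<phi> j"
    using assms(1) by (auto simp: covered_def)
  have "sum D (members j) \<le> (\<Sum>i\<in>members j. 2 * sqd d (x i) (Z j) + 2 * sqd d (x c) (Z j))"
    using D[OF _ c(1)] sqd_triangle[of d _ "x c" "Z j"]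
    by (intro sum_mono) (fastforce simp: members_def sqd_commute[of d "Z j"] intro: order_trans)
  also have "\<dots> = 2 * \<phi> j + 2 * (real (card (members j)) * sqd d (x c) (Z j))"
    by (simp add: sum.distrib \<phi>_def sum_distrib_left)
  finally show ?thesis using c(2) by simp
qed

text \<open>Markov's inequality: at most half of the points can be farther from the center than
  twice the mean.\<close>

lemma card_core: "card (members j) \<le> 2 * card (core j)"
proof (rule ccontr)
  assume "\<not> ?thesis"
  define R where "R = members j - core j"
  have fin: "finite (core j)" "core j \<subseteq> members j" by (auto simp: core_def)
  have card: "card R = card (members j) - card (core j)"
    unfolding R_def using fin by (intro card_Diff_subset) auto
  then have R: "card (members j) < 2 * card R" "finite R"
    using \<open>\<not> _\<close> card_mono[OF finite_members fin(2)] by (auto simp: R_def)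
  then have "R \<noteq> {}" by auto
  have "(\<Sum>i\<in>R. 2 * \<phi> j) < (\<Sum>i\<in>R. real (card (members j)) * sqd d (x i) (Z j))"
    using R \<open>R \<noteq> {}\<close> by (intro sum_strict_mono) (auto simp: R_def core_def)
  also have "\<dots> \<le> real (card (members j)) * \<phi> j"
    unfolding sum_distrib_left[symmetric] \<phi>_def
    by (intro mult_left_mono sum_mono2) (auto simp: R_def)
  also have "\<dots> \<le> real (2 * card R) * \<phi> j"
    using R by (intro mult_right_mono) auto
  finally show False by simp
qed

text \<open>Let \<delta> be the least squared distance of a chosen point to \<open>Z j\<close> and
  \<open>N\<close> the size of the cluster, so that \<open>N * \<delta> > 8 * \<phi> j\<close>. The
  cluster costs at most \<open>2 * \<phi> j + 2 * N * \<delta>\<close>, which is below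
  \<open>9/4 * N * \<delta>\<close>. A core point is so close to \<open>Z j\<close> that it still
  costs \<open>\<delta> / 4\<close>, and at least half of the cluster is core, so the core costs at
  least \<open>N * \<delta> / 8\<close>.\<close>

lemma uncovered_cost:
  assumes "\<not> covered S j" "finite S" "S \<noteq> {}"
    and D: "\<And>i c. i < n \<Longrightarrow> c \<in> S \<Longrightarrow> D i \<le> sqd d (x i) (x c)"
    and D': "\<And>i. i < n \<Longrightarrow> \<exists>c\<in>S. D i = sqd d (x i) (x c)"
  shows "sum D (members j) \<le> 18 * sum D (core j)"
proof -
  define N where "N = real (card (members j))"
  define \<delta> where "\<delta> = Min ((\<lambda>c. sqd d (x c) (Z j)) ` S)"
  have \<delta>_le: "\<delta> \<le> sqd d (x c) (Z j)" if "c \<in> S" for c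
    using that assms by (simp add: \<delta>_def)
  have "\<delta> \<in> (\<lambda>c. sqd d (x c) (Z j)) ` S"
    unfolding \<delta>_def using assms by (intro Min_in) auto
  then obtain c0 where c0: "c0 \<in> S" "\<delta> = sqd d (x c0) (Z j)" by auto
  then have N\<delta>: "N * \<delta> > 8 * \<phi> j" using assms(1) by (auto simp: covered_def N_def)
  have "N \<noteq> 0" using N\<delta> \<phi>_nonneg[of j] by (auto simp del: \<phi>_nonneg)
  then have N: "N > 0" using of_nat_0_le_iff[of "card (members j)"] unfolding N_def by linarith
  have "sum D (members j) \<le> (\<Sum>i\<in>members j. 2 * sqd d (x i) (Z j) + 2 * \<delta>)"
  proof (intro sum_mono)
    fix i assume "i \<in> members j"
    then have "D i \<le> sqd d (x i) (x c0)" using D c0 by (auto simp: members_def)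
    then show "D i \<le> 2 * sqd d (x i) (Z j) + 2 * \<delta>"
      using sqd_triangle[of d "x i" "x c0" "Z j"] c0 by (simp add: sqd_commute[of d "Z j"])
  qed
  also have "\<dots> = 2 * \<phi> j + 2 * (N * \<delta>)"
    by (simp add: sum.distrib \<phi>_def sum_distrib_left N_def)
  also have "\<dots> \<le> 18 * (N * \<delta> / 8)" using N\<delta> by simp
  finally have le1: "sum D (members j) \<le> 18 * (N * \<delta> / 8)" .
  have "D i \<ge> \<delta> / 4" if i: "i \<in> core j" for i
  proof -
    obtain c where c: "c \<in> S" "D i = sqd d (x i) (x c)"
      using D'[of i] i by (auto simp: core_def members_def)
    have "\<delta> \<le> 2 * D i + 2 * sqd d (x i) (Z j)"
      using \<delta>_le[OF c(1)] sqd_triangle[of d "x c" "Z j" "x i"] c(2) by (simp add: sqd_commute)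
    then have "N * \<delta> \<le> N * (2 * D i + 2 * sqd d (x i) (Z j))" using N by simp
    also have "\<dots> \<le> 2 * (N * D i) + 4 * \<phi> j" using i by (simp add: core_def N_def algebra_simps)
    finally have "N * \<delta> \<le> N * (4 * D i)" using N\<delta> by simp
    then show ?thesis using N by simp
  qed
  then have "(\<Sum>i\<in>core j. \<delta> / 4) \<le> sum D (core j)" by (intro sum_mono) auto
  moreover have "N / 2 * (\<delta> / 4) \<le> real (card (core j)) * (\<delta> / 4)"
    using card_core[of j] c0(2) unfolding N_def by (intro mult_right_mono) auto
  ultimately have "N * \<delta> / 8 \<le> sum D (core j)" by simp
  then show ?thesis using le1 by linarith
qed

definition chosen where "chosen g r = pick n d x g ` {..<r}"

text \<open>In expectation the potential decreases by a factor \<open>1 - 1 / (108 k)\<close> in every round: as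
  long as the cost is large, half of it is due to uncovered clusters, and a fixed fraction of the cost of
  an uncovered cluster is due to its core, whose points cover it.\<close>

definition potential where
  "potential g r = (if sum (dsq n d x g r) {..<n} \<le> 36 * opt then 0
                    else card {j. j < k \<and> \<not> covered (chosen g r) j})"

lemma dsq_le_chosen: "r \<ge> 1 \<Longrightarrow> c \<in> chosen g r \<Longrightarrow> dsq n d x g r i \<le> sqd d (x i) (x c)"
  using dproc_invariant[of r n d x g i] by (auto simp: chosen_def)

lemma dsq_attained: "r \<ge> 1 \<Longrightarrow> \<exists>c\<in>chosen g r. dsq n d x g r i = sqd d (x i) (x c)"
  using dproc_invariant[of r n d x g i] by (auto simp: chosen_def)

lemma potential_0_cost:
  assumes "r \<ge> 1" "potential g r = 0"
  shows "sum (dsq n d x g r) {..<n} \<le> 36 * opt"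
proof (rule ccontr)
  assume "\<not> ?thesis"
  then have "covered (chosen g r) j" if "j < k" for j
    using assms(2) that by (auto simp: potential_def split: if_splits)
  then have "(\<Sum>j<k. sum (dsq n d x g r) (members j)) \<le> (\<Sum>j<k. 18 * \<phi> j)"
    using dsq_le_chosen[OF assms(1)] by (intro sum_mono covered_cost) auto
  then have "sum (dsq n d x g r) {..<n} \<le> 18 * opt"
    by (simp add: sum_members sum_\<phi> flip: sum_distrib_left)
  also have "\<dots> \<le> 36 * opt" by simp
  finally show False using \<open>\<not> _\<close> by simp
qed

lemma potential_le: "potential g r \<le> k"
  using card_mono[of "{..<k}" "{j. j < k \<and> \<not> covered (chosen g r) j}"] by (auto simp: potential_def)

lemma chosen_upd:
  assumes "s \<le> r"
  shows "dproc n d x (g(r := u)) s = dproc n d x g s" "chosen (g(r := u)) s = chosen g s"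
proof -
  have *: "dproc n d x (g(r := u)) s = dproc n d x g s" if "s \<le> r" for s
    using that by (intro dproc_cong) auto
  then show "dproc n d x (g(r := u)) s = dproc n d x g s" using assms by blast
  show "chosen (g(r := u)) s = chosen g s"
    unfolding chosen_def using assms * by (intro image_cong) (auto simp: pick_def)
qed

lemma potential_step:
  assumes r: "r \<ge> 1"
  shows "(\<Sum>u<3*n. real (potential (g(r := u)) (Suc r))) \<le> 3 * real n * ((1 - 1 / (108 * k)) * potential g r)"
proof -
  define D where "D = dsq n d x g r"
  define W where "W = sum D {..<n}"
  define S where "S = chosen g r"
  have D: "D i \<le> sqd d (x i) (x c)" if "c \<in> S" for i c
    using dsq_le_chosen[OF r] that by (simp add: D_def S_def)
  have D': "\<exists>c\<in>S. D i = sqd d (x i) (x c)" for i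
    using dsq_attained[OF r] by (simp add: D_def S_def)
  have S: "finite S" "S \<noteq> {}" using r by (auto simp: S_def chosen_def lessThan_empty_iff)
  have chosen: "chosen (g(r := u)) (Suc r) = insert (rep n D u) S" for u
    using chosen_upd[of r r g u] by (auto simp: chosen_def lessThan_Suc pick_def D_def S_def)
  have cost: "sum (dsq n d x (g(r := u)) (Suc r)) {..<n} \<le> W" for u
    unfolding W_def using dsq_Suc_le[OF r, of n d x "g(r := u)"] chosen_upd(1)[of r r g u]
    by (intro sum_mono) (metis D_def order_refl)
  show ?thesis
  proof (cases "W \<le> 36 * opt")
    case True
    \<comment> \<open>The cost never increases, so a cost below the threshold stays there.\<close>
    then have "potential (g(r := u)) (Suc r) = 0" for u
      using cost[of u] by (simp add: potential_def)
    then show ?thesis using True by (simp add: potential_def W_def D_def)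
  next
    case False
    define B where "B = {j. j < k \<and> \<not> covered S j}"
    define C where "C = (\<Union>j\<in>B. core j)"
    define Good where "Good = {u. u < 3 * n \<and> rep n D u \<in> C}"
    have finB: "finite B" by (simp add: B_def)
    have C_sub: "C \<subseteq> {..<n}" by (auto simp: C_def core_def members_def)
    then have finC: "finite C" using finite_subset by blast
    have pot: "potential g r = card B"
      using False by (simp add: potential_def W_def D_def S_def B_def)
    have pot': "potential (g(r := u)) (Suc r) \<le> card B - (if u \<in> Good then 1 else 0)" for u
    proof -
      let ?B' = "{j. j < k \<and> \<not> covered (insert (rep n D u) S) j}"
      have sub: "?B' \<subseteq> B" using covered_mono[of S _ "insert (rep n D u) S"] by (auto simp: B_def)
      have "card ?B' \<le> card B - (if u \<in> Good then 1 else 0)"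
      proof (cases "u \<in> Good")
        case True
        then obtain j where "j \<in> B" "rep n D u \<in> core j" by (auto simp: Good_def C_def)
        then have "?B' \<subseteq> B - {j}" using sub core_covered[of "rep n D u" j] by auto
        then have "card ?B' \<le> card (B - {j})" using finB by (intro card_mono) auto
        then show ?thesis using True \<open>j \<in> B\<close> finB by simp
      qed (use sub finB card_mono in auto)
      then show ?thesis unfolding potential_def chosen by simp
    qed
    have "W = (\<Sum>j\<in>{..<k} - B. sum D (members j)) + (\<Sum>j\<in>B. sum D (members j))"
      unfolding W_def sum_members[symmetric]
      by (subst sum.subset_diff[of B "{..<k}"]) (auto simp: B_def)
    also have "\<dots> \<le> (\<Sum>j\<in>{..<k} - B. 18 * \<phi> j) + (\<Sum>j\<in>B. 18 * sum D (core j))"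
    proof (intro add_mono sum_mono)
      fix j assume "j \<in> {..<k} - B"
      then show "sum D (members j) \<le> 18 * \<phi> j"
        using D by (intro covered_cost[of S]) (auto simp: B_def)
    next
      fix j assume "j \<in> B"
      then show "sum D (members j) \<le> 18 * sum D (core j)"
        using D D' S by (intro uncovered_cost[of S]) (auto simp: B_def)
    qed
    also have "(\<Sum>j\<in>{..<k} - B. 18 * \<phi> j) \<le> 18 * opt"
      unfolding sum_distrib_left[symmetric] sum_\<phi>[symmetric] by (intro mult_left_mono sum_mono2) auto
    also have "(\<Sum>j\<in>B. 18 * sum D (core j)) = 18 * sum D C"
      unfolding sum_distrib_left[symmetric] C_def
      by (subst sum.UNION_disjoint) (auto simp: finB core_def members_def)
    \<comment> \<open>Covered clusters account for at most \<open>18 * opt\<close>, less than half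
      of \<open>W\<close>; the cores of the uncovered ones therefore carry at least 1/36 of
      it.\<close>
    finally have "W \<le> 36 * sum D C" using False by simp
    then have "real n * W \<le> 36 * (\<Sum>i\<in>C. real n * D i)"
      using mult_left_mono[of W "36 * sum D C" "real n"]
      by (simp add: sum_distrib_left[symmetric])
    also have "\<dots> \<le> 36 * (\<Sum>i\<in>C. real (rep_count n D i) * W)"
      unfolding W_def using C_sub dsq_nonneg
      by (intro mult_left_mono sum_mono rep_count_weight) (auto simp: D_def)
    also have "\<dots> = 36 * real (card Good) * W"
    proof -
      have "card Good = (\<Sum>i\<in>C. rep_count n D i)"
      proof -
        have "Good = (\<Union>i\<in>C. {u. u < 3 * n \<and> rep n D u = i})" by (auto simp: Good_def)
        then show ?thesis unfolding rep_count_def using finC by (simp, subst card_UN_disjoint) auto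
      qed
      then show ?thesis by (simp add: sum_distrib_right)
    qed
    finally have "real n * W \<le> (36 * real (card Good)) * W" .
    moreover have "W > 0" using False opt_nonneg by linarith
    \<comment> \<open>Of the \<open>3 * n\<close> equally likely draws at least
      \<open>n / 36\<close> hit such a core, which is a probability of at least 1/108.\<close>
    ultimately have good: "real n \<le> 36 * real (card Good)" by simp
    have B_k: "card B \<le> k" using card_mono[of "{..<k}" B] by (auto simp: B_def)
    have B_pos: "card B \<ge> 1" if "u \<in> Good" for u
      using that finB by (auto simp: Good_def C_def Suc_le_eq card_gt_0_iff)
    have "(\<Sum>u<3*n. real (potential (g(r := u)) (Suc r)))
        \<le> (\<Sum>u<3*n. real (card B) - (if u \<in> Good then 1 else 0))"
    proof (intro sum_mono)
      fix u show "real (potential (g(r := u)) (Suc r)) \<le> real (card B) - (if u \<in> Good then 1 else 0)"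
        using pot'[of u] B_pos[of u] by (auto split: if_splits)
    qed
    also have "\<dots> = 3 * real n * card B - real (card Good)"
    proof -
      have "{..<3*n} \<inter> Good = Good" by (auto simp: Good_def)
      then show ?thesis by (simp add: sum_subtractf sum.If_cases Int_commute)
    qed
    \<comment> \<open>A fixed expected decrease is weakened to one proportional to
      \<open>card B\<close>, so that the rounds multiply.\<close>
    also have "\<dots> \<le> 3 * real n * card B - real n / 36 * (card B / k)"
    proof -
      have "real n / 36 * (card B / k) \<le> real n / 36 * 1"
        using B_k k by (intro mult_left_mono) auto
      then show ?thesis using good by linarith
    qed
    also have "\<dots> = 3 * real n * ((1 - 1 / (108 * k)) * potential g r)"
      using k by (simp add: pot field_simps)
    finally show ?thesis .
  qed
qed

definition uniform_draws :: "nat \<Rightarrow> (nat \<Rightarrow> nat) pmf" where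
  "uniform_draws r = Pi_pmf {..<r} 0 (\<lambda>_. pmf_of_set {..<3*n})"

lemma finite_uniform_draws [simp]: "finite (set_pmf (uniform_draws r))"
  using n by (auto simp: uniform_draws_def set_Pi_pmf lessThan_empty_iff intro!: finite_PiE_dflt)

text \<open>Given the first \<open>r\<close> draws, the next one is uniform and independent of them,
  so \<open>potential_step\<close> bounds a conditional expectation. The exponent is
  \<open>r - 1\<close> because the first draw merely supplies some point.\<close>

lemma expectation_potential:
  assumes "r \<ge> 1"
  shows "measure_pmf.expectation (uniform_draws r) (\<lambda>g. real (potential g r))
    \<le> (1 - 1 / (108 * k)) ^ (r - 1) * k"
  using assms
proof (induction r rule: nat_induct_at_least)
  case base
  have "measure_pmf.expectation (uniform_draws 1) (\<lambda>g. real (potential g 1)) \<le>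
    measure_pmf.expectation (uniform_draws 1) (\<lambda>g. real k)"
    using potential_le by (intro integral_mono integrable_measure_pmf_finite) auto
  then show ?case by simp
next
  case (Suc r)
  have U: "finite {..<3*n}" "{..<3*n} \<noteq> {}" using n by (auto simp: lessThan_empty_iff)
  have "uniform_draws (Suc r) = bind_pmf (uniform_draws r) (\<lambda>g. map_pmf (\<lambda>u. g(r := u)) (pmf_of_set {..<3*n}))"
    unfolding uniform_draws_def lessThan_Suc
    by (subst Pi_pmf_insert', simp, simp, subst bind_commute_pmf) (simp add: map_pmf_def)
  then have "measure_pmf.expectation (uniform_draws (Suc r)) (\<lambda>g. real (potential g (Suc r))) =
    measure_pmf.expectation (uniform_draws r) (\<lambda>g. (\<Sum>u<3*n. real (potential (g(r := u)) (Suc r))) / (3 * n))"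
    using U by (simp add: pmf_expectation_bind[of "set_pmf (uniform_draws r)"]
        integral_measure_pmf[of "set_pmf (uniform_draws r)"] integral_pmf_of_set sum_divide_distrib)
  also have "\<dots> \<le> measure_pmf.expectation (uniform_draws r) (\<lambda>g. (1 - 1 / (108 * k)) * potential g r)"
  proof (intro integral_mono integrable_measure_pmf_finite)
    fix g show "(\<Sum>u<3*n. real (potential (g(r := u)) (Suc r))) / (3 * n) \<le> (1 - 1 / (108 * k)) * potential g r"
      using potential_step[OF \<open>1 \<le> r\<close>, of g] n by (simp add: field_simps)
  qed auto
  also have "\<dots> = (1 - 1 / (108 * k)) * measure_pmf.expectation (uniform_draws r) (\<lambda>g. potential g r)"
    by simp
  also have "\<dots> \<le> (1 - 1 / (108 * k)) * ((1 - 1 / (108 * k)) ^ (r - 1) * k)"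
    using Suc k by (intro mult_left_mono) auto
  also have "\<dots> = (1 - 1 / (108 * k)) ^ (Suc r - 1) * k"
    using Suc by (cases r) auto
  finally show ?case .
qed

text \<open>With \<open>y = 1 / (108 * k)\<close>, Bernoulli's inequality gives \<open>(1 - y) ^ (T
  - 1) * (1 + (T - 1) * y) \<le> (1 - y^2) ^ (T - 1) \<le> 1\<close>. As
  \<open>(T - 1) * y \<ge> 4 * k\<close>, the expected potential is at most 1/4; being a natural
  number, it vanishes with probability at least 3/4.\<close>

theorem bicriteria:
  assumes "real T \<ge> 433 * k ^ 2"
  shows "measure_pmf.prob (uniform_draws T) {g. sum (dsq n d x g T) {..<n} \<le> 36 * opt} \<ge> 3 / 4"
proof -
  define y :: real where "y = 1 / (108 * k)"
  have k2: "real k ^ 2 \<ge> 1" using k by simp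
  then have T: "T \<ge> 1" using assms by (cases T) auto
  have y: "0 < y" "y \<le> 1" using k by (auto simp: y_def)
  have "(1 - y) ^ (T - 1) * (1 + real (T - 1) * y) \<le> (1 - y) ^ (T - 1) * (1 + y) ^ (T - 1)"
    using y Bernoulli_inequality[of y "T - 1"] by (intro mult_left_mono) auto
  also have "\<dots> = (1 - y\<^sup>2) ^ (T - 1)"
    by (simp add: power_mult_distrib[symmetric] power2_eq_square algebra_simps)
  also have "\<dots> \<le> 1" using y by (intro power_le_one) (auto simp: power_le_one)
  finally have *: "(1 - y) ^ (T - 1) * (1 + real (T - 1) * y) \<le> 1" .
  have "432 * real k ^ 2 \<le> real (T - 1)" using assms T k2 by (simp add: of_nat_diff)
  then have "432 * real k ^ 2 * y \<le> real (T - 1) * y" using y by (intro mult_right_mono) auto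
  moreover have "432 * real k ^ 2 * y = 4 * k" using k by (simp add: y_def power2_eq_square)
  ultimately have "(1 - y) ^ (T - 1) * (4 * k) \<le> (1 - y) ^ (T - 1) * (1 + real (T - 1) * y)"
    using y by (intro mult_left_mono) auto
  then have small: "(1 - y) ^ (T - 1) * k \<le> 1 / 4" using * by simp
  have "measure_pmf.prob (uniform_draws T) {g. \<not> sum (dsq n d x g T) {..<n} \<le> 36 * opt} =
    measure_pmf.expectation (uniform_draws T) (indicator {g. \<not> sum (dsq n d x g T) {..<n} \<le> 36 * opt})"
    by simp
  also have "\<dots> \<le> measure_pmf.expectation (uniform_draws T) (\<lambda>g. real (potential g T))"
    using potential_0_cost[OF T]
    by (intro integral_mono integrable_measure_pmf_finite) (auto simp: indicator_def Suc_le_eq intro!: gr0I)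
  also have "\<dots> \<le> 1 / 4"
    using expectation_potential[OF T] small by (simp add: y_def)
  finally show ?thesis
    using measure_pmf.prob_compl[of "{g. \<not> sum (dsq n d x g T) {..<n} \<le> 36 * opt}" "uniform_draws T"]
    by (simp add: Compl_eq_Diff_UNIV[symmetric] Collect_neg_eq[symmetric] not_less)
qed

end


subsection \<open>Importance sampling\<close>

text \<open>Up to a constant, a bound on the share that point \<open>i\<close> can have in the cost
  of any \<open>k\<close> centers: its share of the cost of the chosen points, plus an equal share
  of the cluster of points sent to the same chosen point.\<close>

definition sens :: "nat \<Rightarrow> (nat \<Rightarrow> real) \<Rightarrow> (nat \<Rightarrow> nat) \<Rightarrow> nat \<Rightarrow> real" where
  "sens n D c i = D i / sum D {..<n} + 1 / real (card {i'. i' < n \<and> c i' = c i})"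

lemma sens_nonneg:
  assumes "\<And>i. i < n \<Longrightarrow> 0 \<le> D i" "i < n"
  shows "0 \<le> sens n D c i"
proof -
  have "0 \<le> sum D {..<n}" using assms(1) by (auto intro: sum_nonneg)
  then show ?thesis using assms by (simp add: sens_def)
qed

text \<open>Through the second summand every nonempty cluster contributes exactly 1, and there are
  at most \<open>T\<close> of them; the first summands add up to 1 or to 0.\<close>

lemma sum_sens_le:
  assumes "\<And>i. i < n \<Longrightarrow> c i < T"
  shows "sum (sens n D c) {..<n} \<le> 1 + real T"
proof -
  have "(\<Sum>i<n. 1 / real (card {i'. i' < n \<and> c i' = c i})) =
    (\<Sum>t<T. \<Sum>i\<in>{i\<in>{..<n}. c i = t}. 1 / real (card {i'. i' < n \<and> c i' = c i}))"
    using assms by (intro sum.group[symmetric]) auto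
  also have "\<dots> \<le> (\<Sum>t<T. 1)"
  proof (intro sum_mono)
    fix t
    have "(\<Sum>i\<in>{i\<in>{..<n}. c i = t}. 1 / real (card {i'. i' < n \<and> c i' = c i})) =
      (\<Sum>i\<in>{i\<in>{..<n}. c i = t}. 1 / real (card {i\<in>{..<n}. c i = t}))"
      by (intro sum.cong) auto
    also have "\<dots> \<le> 1" by simp
    finally show "(\<Sum>i\<in>{i\<in>{..<n}. c i = t}. 1 / real (card {i'. i' < n \<and> c i' = c i})) \<le> 1" .
  qed
  finally have "(\<Sum>i<n. 1 / real (card {i'. i' < n \<and> c i' = c i})) \<le> T" by simp
  moreover have "(\<Sum>i<n. D i / sum D {..<n}) \<le> 1"
    by (simp flip: sum_divide_distrib)
  ultimately show ?thesis by (simp add: sens_def sum.distrib)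
qed

text \<open>The quality of the bicriteria solution enters here: the distance of a point to any
  solution is at most its distance to the nearest chosen point plus the distance of that point
  to the solution, and the latter is averaged over the whole cluster of the chosen point.\<close>

lemma near_le_sens:
  assumes k: "1 \<le> k" and i: "i < n"
    and D: "\<And>i. i < n \<Longrightarrow> D i = sqd d (x i) (y (c i))"
    and W: "sum D {..<n} \<le> 36 * C" and C: "C = (\<Sum>i<n. near d k Z (x i))"
  shows "near d k Z (x i) \<le> 148 * C * sens n D c i"
proof -
  define P where "P = {i'. i' < n \<and> c i' = c i}"
  have P: "finite P" "i \<in> P" "P \<subseteq> {..<n}" using i by (auto simp: P_def)
  then have cP: "real (card P) > 0" by (auto simp: card_gt_0_iff)
  have D0: "0 \<le> D i'" if "i' < n" for i' using D[OF that] by simp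
  have C0: "C \<ge> 0" unfolding C using near_nonneg[OF k] by (auto intro: sum_nonneg)
  define v where "v = near d k Z (y (c i))"
  have "real (card P) * v = (\<Sum>i'\<in>P. v)" by simp
  also have "\<dots> \<le> (\<Sum>i'\<in>P. 2 * D i' + 2 * near d k Z (x i'))"
  proof (intro sum_mono)
    fix i' assume "i' \<in> P"
    then have "c i' = c i" "i' < n" by (auto simp: P_def)
    then show "v \<le> 2 * D i' + 2 * near d k Z (x i')"
      using near_triangle[OF k, of d Z "y (c i)" "x i'"] D[of i'] by (simp add: v_def sqd_commute)
  qed
  also have "\<dots> \<le> 2 * sum D {..<n} + 2 * C"
    unfolding sum.distrib C sum_distrib_left[symmetric] using P D0 near_nonneg[OF k]
    by (intro add_mono mult_left_mono sum_mono2) auto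
  also have "\<dots> \<le> 74 * C" using W by simp
  finally have v: "v \<le> 74 * C / card P" using cP by (simp add: field_simps)
  have "D i \<le> 36 * C * (D i / sum D {..<n})"
  proof (cases "sum D {..<n} = 0")
    case True
    then have "D i = 0" using i D0 by (subst (asm) sum_nonneg_eq_0_iff) auto
    then show ?thesis by simp
  next
    case False
    moreover have "0 \<le> sum D {..<n}" using D0 by (auto intro: sum_nonneg)
    ultimately have "sum D {..<n} > 0" by simp
    then show ?thesis using mult_right_mono[OF W D0[OF i]] by (simp add: field_simps)
  qed
  moreover have "near d k Z (x i) \<le> 2 * D i + 2 * v"
    using near_triangle[OF k, of d Z "x i" "y (c i)"] D[OF i] by (simp add: v_def)
  \<comment> \<open>Here \<open>72 = 2 * 36\<close> and \<open>148 = 2 * 74\<close> with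
    \<open>74 = 2 * 36 + 2\<close>; the smaller constant is then raised to the larger.\<close>
  ultimately have "near d k Z (x i) \<le> 72 * C * (D i / sum D {..<n}) + 148 * C * (1 / card P)"
    using v by simp
  also have "\<dots> \<le> 148 * C * (D i / sum D {..<n}) + 148 * C * (1 / card P)"
    using C0 D0 i by (intro add_right_mono mult_right_mono divide_nonneg_nonneg sum_nonneg) auto
  finally show ?thesis by (simp add: sens_def P_def algebra_simps)
qed

abbreviation draws :: "'a set \<Rightarrow> nat \<Rightarrow> ('a \<Rightarrow> nat) pmf" where
  "draws J N \<equiv> Pi_pmf J 0 (\<lambda>_. pmf_of_set {..<N})"

lemma set_draws: "finite J \<Longrightarrow> N \<ge> 1 \<Longrightarrow> h \<in> set_pmf (draws J N) \<Longrightarrow> p \<in> J \<Longrightarrow> h p < N"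
  by (auto simp: set_Pi_pmf PiE_dflt_def lessThan_empty_iff)

text \<open>Bounding the summands relative to their mean \<open>M\<close> makes the exponent
  \<open>2 * (a * card J * M)^2 / (card J * (B * M)^2)\<close> independent of \<open>M\<close>. The
  cases \<open>M = 0\<close> and \<open>J = {}\<close> are separate because Hoeffding's inequality
  needs a positive sum of squared ranges.\<close>

lemma hoeffding_draws:
  fixes v :: "nat \<Rightarrow> real" and a B M :: real
  assumes J: "finite J" and N: "N \<ge> 1" and a: "0 \<le> a" and B: "0 < B"
    and M: "M = (\<Sum>u<N. v u) / N" and v: "\<And>u. u < N \<Longrightarrow> 0 \<le> v u \<and> v u \<le> B * M"
  shows "measure_pmf.prob (draws J N) {h. (\<Sum>p\<in>J. v (h p)) < (1 - a) * card J * M} \<le> exp (- 2 * a\<^sup>2 * card J / B\<^sup>2)"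
    and "measure_pmf.prob (draws J N) {h. (\<Sum>p\<in>J. v (h p)) > (1 + a) * card J * M} \<le> exp (- 2 * a\<^sup>2 * card J / B\<^sup>2)"
proof -
  let ?P = "draws J N"
  let ?lo = "{h. (\<Sum>p\<in>J. v (h p)) < (1 - a) * card J * M}"
  let ?hi = "{h. (\<Sum>p\<in>J. v (h p)) > (1 + a) * card J * M}"
  have ne: "{..<N} \<noteq> {}" using N by (auto simp: lessThan_empty_iff)
  have "measure_pmf.prob ?P ?lo \<le> exp (- 2 * a\<^sup>2 * card J / B\<^sup>2) \<and>
        measure_pmf.prob ?P ?hi \<le> exp (- 2 * a\<^sup>2 * card J / B\<^sup>2)"
  proof (cases "M > 0 \<and> J \<noteq> {}")
    case False
    have "(\<Sum>p\<in>J. v (h p)) = 0 \<and> card J * M = 0" if "h \<in> set_pmf ?P" for h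
    proof (cases "J = {}")
      case False
      then have "M \<le> 0" using \<open>\<not> (M > 0 \<and> J \<noteq> {})\<close> by auto
      moreover have "M \<ge> 0" using v unfolding M by (auto intro!: sum_nonneg divide_nonneg_nonneg)
      ultimately have "M = 0" by simp
      then have "v u = 0" if "u < N" for u using v[OF that] by simp
      then show ?thesis using set_draws[OF J N that] \<open>M = 0\<close> by simp
    qed simp
    then have "set_pmf ?P \<inter> ?lo = {}" "set_pmf ?P \<inter> ?hi = {}" by (force simp: mult.assoc)+
    then have "measure_pmf.prob ?P ?lo = 0" "measure_pmf.prob ?P ?hi = 0"
      by (auto simp: measure_pmf_zero_iff)
    then show ?thesis by simp
  next
    case True
    have "prob_space.indep_vars ?P (\<lambda>_. borel) (\<lambda>p h. v (h p)) J"
      using prob_space.indep_vars_compose2[OF prob_space_measure_pmf indep_vars_Pi_pmf[OF J], of "\<lambda>_. v"] by simp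
    moreover have "AE h in ?P. v (h p) \<in> {0..B * M}" if "p \<in> J" for p
      using v set_draws[OF J N _ that] by (auto simp: AE_measure_pmf_iff)
    ultimately interpret Hoeffding_ineq ?P J "\<lambda>p h. v (h p)" "\<lambda>_. 0" "\<lambda>_. B * M"
      "\<Sum>p\<in>J. measure_pmf.expectation ?P (\<lambda>h. v (h p))"
      using J by unfold_locales auto
    have "measure_pmf.expectation ?P (\<lambda>h. v (h p)) = M" if "p \<in> J" for p
    proof -
      have "measure_pmf.expectation ?P (\<lambda>h. v (h p)) = measure_pmf.expectation (map_pmf (\<lambda>h. h p) ?P) v"
        by simp
      also have "\<dots> = M"
        using that ne by (subst Pi_pmf_component[OF J]) (simp add: integral_pmf_of_set M)
      finally show ?thesis .
    qed
    then have mean: "(\<Sum>p\<in>J. measure_pmf.expectation ?P (\<lambda>h. v (h p))) = card J * M" by simp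
    have cJ: "real (card J) > 0" using True J by (simp add: card_gt_0_iff)
    have sq: "(\<Sum>p\<in>J. (B * M - 0)\<^sup>2) = card J * (B\<^sup>2 * M\<^sup>2)" by (simp add: power_mult_distrib)
    have pos: "(\<Sum>p\<in>J. (B * M - 0)\<^sup>2) > 0" unfolding sq using True B cJ by simp
    have \<epsilon>: "a * card J * M \<ge> 0" using a True by simp
    have ex: "-2 * (a * card J * M)\<^sup>2 / (\<Sum>p\<in>J. (B * M - 0)\<^sup>2) = - 2 * a\<^sup>2 * card J / B\<^sup>2"
      unfolding sq using True B cJ by (simp add: power2_eq_square field_simps)
    have "measure_pmf.prob ?P ?lo \<le> measure_pmf.prob ?P {h \<in> space ?P. (\<Sum>p\<in>J. v (h p)) \<le>
        (\<Sum>p\<in>J. measure_pmf.expectation ?P (\<lambda>h. v (h p))) - a * card J * M}"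
      unfolding mean by (intro measure_pmf.finite_measure_mono) (auto simp: algebra_simps)
    moreover have "measure_pmf.prob ?P ?hi \<le> measure_pmf.prob ?P {h \<in> space ?P. (\<Sum>p\<in>J. v (h p)) \<ge>
        (\<Sum>p\<in>J. measure_pmf.expectation ?P (\<lambda>h. v (h p))) + a * card J * M}"
      unfolding mean by (intro measure_pmf.finite_measure_mono) (auto simp: algebra_simps)
    ultimately show ?thesis
      using Hoeffding_ineq_le[OF \<epsilon> pos] Hoeffding_ineq_ge[OF \<epsilon> pos] unfolding ex by linarith
  qed
  then show "measure_pmf.prob ?P ?lo \<le> exp (- 2 * a\<^sup>2 * card J / B\<^sup>2)"
    "measure_pmf.prob ?P ?hi \<le> exp (- 2 * a\<^sup>2 * card J / B\<^sup>2)" by auto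
qed

lemma prob_bind_le:
  assumes "\<And>g. g \<in> set_pmf P \<Longrightarrow> measure_pmf.prob (Q g) X \<le> q"
  shows "measure_pmf.prob (bind_pmf P Q) X \<le> q"
proof -
  have q: "q \<ge> 0" using assms set_pmf_not_empty[of P] by (meson all_not_in_conv measure_nonneg order_trans)
  have "emeasure (measure_pmf (bind_pmf P Q)) X = (\<integral>\<^sup>+g. emeasure (Q g) X \<partial>P)" by simp
  also have "\<dots> \<le> (\<integral>\<^sup>+g. ennreal q \<partial>P)"
    using assms by (intro nn_integral_mono_AE)
      (auto simp: AE_measure_pmf_iff measure_pmf.emeasure_eq_measure intro: ennreal_leI)
  also have "\<dots> = ennreal q" by simp
  finally show ?thesis using q by (simp add: measure_pmf.emeasure_eq_measure)
qed

text \<open>A solution that is determined by few of the samples is independent of all the others, so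
  that the samples are representative even for solutions computed from them.\<close>

lemma compression_bound:
  fixes v :: "'c \<Rightarrow> nat \<Rightarrow> real" and F :: "(nat \<Rightarrow> nat) \<Rightarrow> 'c" and a B :: real and M :: "'c \<Rightarrow> real"
  assumes N: "N \<ge> 1" and a: "0 < a" "a \<le> 1" and B: "0 < B" and I: "I \<subseteq> {..<m}" "card I \<le> a * m" "2 * card I \<le> m"
    and F: "\<And>h h'. (\<And>p. p \<in> I \<Longrightarrow> h p = h' p) \<Longrightarrow> F h = F h'"
    and M: "\<And>c. M c = (\<Sum>u<N. v c u) / N" and v: "\<And>c u. u < N \<Longrightarrow> 0 \<le> v c u \<and> v c u \<le> B * M c"
  shows "measure_pmf.prob (draws {..<m} N) {h. (\<Sum>p<m. v (F h) (h p)) < (1 - a)\<^sup>2 * m * M (F h)} \<le> exp (- a\<^sup>2 * m / B\<^sup>2)"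
proof -
  define J where "J = {..<m} - I"
  have fin: "finite I" "finite J" using I finite_subset by (auto simp: J_def)
  have Un: "{..<m} = J \<union> I" "J \<inter> I = {}" using I by (auto simp: J_def)
  have cardJ: "real (card J) = real m - card I"
    unfolding J_def using I fin by (simp add: card_Diff_subset of_nat_diff)
  have M0: "0 \<le> M c" for c unfolding M using v by (auto intro!: sum_nonneg divide_nonneg_nonneg)
  let ?H = "\<lambda>h1 h2 p. if p \<in> J then h2 p else h1 p"
  let ?E = "{h. (\<Sum>p<m. v (F h) (h p)) < (1 - a)\<^sup>2 * m * M (F h)}"
  have draws: "draws {..<m} N = bind_pmf (draws I N) (\<lambda>h1. map_pmf (?H h1) (draws J N))"
    unfolding Un(1)
    by (subst Pi_pmf_union[OF fin(2,1) Un(2)], subst pair_commute_pmf)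
      (simp add: pair_pmf_def map_bind_pmf bind_map_pmf map_pmf_def bind_assoc_pmf bind_return_pmf)
  have "measure_pmf.prob (map_pmf (?H h1) (draws J N)) ?E \<le> exp (- a\<^sup>2 * m / B\<^sup>2)"
    if h1: "h1 \<in> set_pmf (draws I N)" for h1
  proof -
    \<comment> \<open>Once the draws in \<open>I\<close> are fixed, so is the candidate, while the
      draws in \<open>J\<close> are still independent.\<close>
    have FH: "F (?H h1 h2) = F h1" for h2 using Un(2) by (intro F) auto
    have "measure_pmf.prob (map_pmf (?H h1) (draws J N)) ?E = measure_pmf.prob (draws J N) (?H h1 -` ?E)"
      by simp
    \<comment> \<open>Dropping the nonnegative terms of \<open>I\<close> lowers the sum, and
      \<open>card J \<ge> (1 - a) * m\<close>: one factor \<open>1 - a\<close> pays for the omitted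
      positions, the other is the deviation given to Hoeffding's inequality.\<close>
    also have "\<dots> \<le> measure_pmf.prob (draws J N) {h. (\<Sum>p\<in>J. v (F h1) (h p)) < (1 - a) * card J * M (F h1)}"
    proof (rule measure_pmf.finite_measure_mono_AE)
      have "(\<Sum>p\<in>J. v (F h1) (h2 p)) < (1 - a) * card J * M (F h1)"
        if h2: "h2 \<in> set_pmf (draws J N)" "?H h1 h2 \<in> ?E" for h2
      proof -
        have "(\<Sum>p\<in>J. v (F h1) (h2 p)) = (\<Sum>p\<in>J. v (F h1) (?H h1 h2 p))" by simp
        also have "\<dots> \<le> (\<Sum>p<m. v (F h1) (?H h1 h2 p))"
        proof (rule sum_mono2)
          fix p assume "p \<in> {..<m} - J"
          then have "p \<in> I" "p \<notin> J" using Un by auto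
          then show "0 \<le> v (F h1) (?H h1 h2 p)"
            using v set_draws[OF fin(1) N h1] by simp
        qed (auto simp: J_def)
        also have "\<dots> < (1 - a)\<^sup>2 * m * M (F h1)" using h2(2) FH by simp
        also have "\<dots> \<le> (1 - a) * card J * M (F h1)"
        proof -
          have "(1 - a) * ((1 - a) * m) \<le> (1 - a) * card J"
            unfolding cardJ using I(2) a by (intro mult_left_mono) (auto simp: algebra_simps)
          then show ?thesis using M0 by (intro mult_right_mono) (auto simp: power2_eq_square)
        qed
        finally show ?thesis .
      qed
      then show "AE h2 in draws J N. h2 \<in> ?H h1 -` ?E \<longrightarrow> h2 \<in> {h. (\<Sum>p\<in>J. v (F h1) (h p)) < (1 - a) * card J * M (F h1)}"
        by (simp add: AE_measure_pmf_iff)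
    qed simp
    also have "\<dots> \<le> exp (- 2 * a\<^sup>2 * card J / B\<^sup>2)"
      using hoeffding_draws(1)[OF fin(2) N _ B M v] a by simp
    also have "\<dots> \<le> exp (- a\<^sup>2 * m / B\<^sup>2)"
    proof -
      \<comment> \<open>The factor 2 in the exponent is spent on passing from \<open>card J\<close>
        back to \<open>m\<close>.\<close>
      have "real m \<le> 2 * real (card J)" using I(3) cardJ by simp
      then have "a\<^sup>2 * m \<le> a\<^sup>2 * (2 * card J)" by (intro mult_left_mono) auto
      then show ?thesis using B by (simp add: divide_right_mono)
    qed
    finally show ?thesis .
  qed
  then show ?thesis unfolding draws by (intro prob_bind_le)
qed

section \<open>Candidates as words of sample positions\<close>

lemma digits_surj:
  assumes "m \<ge> 1" "\<And>i. i < K \<Longrightarrow> \<tau> i < m"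
  shows "\<exists>e < m ^ K. \<forall>i<K. e div m ^ i mod m = (\<tau> i :: nat)"
  using assms(2)
proof (induction K arbitrary: \<tau>)
  case (Suc K)
  obtain e where e: "e < m ^ K" "\<And>i. i < K \<Longrightarrow> e div m ^ i mod m = \<tau> (Suc i)"
    using Suc.IH[of "\<lambda>i. \<tau> (Suc i)"] Suc.prems by auto
  have "m * e + \<tau> 0 < m * (e + 1)" using Suc.prems[of 0] by simp
  also have "\<dots> \<le> m * m ^ K" using e(1) by (intro mult_left_mono) auto
  finally have "m * e + \<tau> 0 < m ^ Suc K" by simp
  moreover have "(m * e + \<tau> 0) div m ^ i mod m = \<tau> i" if "i < Suc K" for i
  proof (cases i)
    case 0
    then show ?thesis using Suc.prems[of 0] by simp
  next
    case (Suc i')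
    have "(m * e + \<tau> 0) div m ^ i = (m * e + \<tau> 0) div m div m ^ i'"
      unfolding Suc by (simp add: div_mult2_eq)
    also have "(m * e + \<tau> 0) div m = e" using Suc.prems[of 0] assms(1) by simp
    finally show ?thesis using e(2) that Suc by simp
  qed
  ultimately show ?case by blast
qed simp

text \<open>Words of length \<open>K\<close> over \<open>{..<m}\<close> are coded by the numbers
  below \<open>m ^ K\<close>, so that a single counter enumerates all candidates.\<close>

definition digit :: "nat \<Rightarrow> nat \<Rightarrow> nat \<Rightarrow> nat" where
  "digit m e i = e div m ^ i mod m"

definition sample_centers ::
  "(nat \<Rightarrow> nat \<Rightarrow> real) \<Rightarrow> (nat \<Rightarrow> nat) \<Rightarrow> nat \<Rightarrow> (nat \<Rightarrow> nat) \<Rightarrow> nat \<Rightarrow> nat \<Rightarrow> real" where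
  "sample_centers x idx l \<tau> j h = (\<Sum>a<l. x (idx (\<tau> (j * l + a))) h) / real l"

lemma near_sample_centers_cong:
  assumes "\<And>b. b < k * l \<Longrightarrow> idx (\<tau> b) = idx' (\<tau>' b)"
  shows "near d k (sample_centers x idx l \<tau>) u = near d k (sample_centers x idx' l \<tau>') u"
proof (rule near_cong)
  fix j assume j: "j < k"
  have "idx (\<tau> (j * l + a)) = idx' (\<tau>' (j * l + a))" if "a < l" for a
  proof (rule assms)
    have "j * l + a < (j + 1) * l" using that by simp
    also have "\<dots> \<le> k * l" using j by (intro mult_right_mono) auto
    finally show "j * l + a < k * l" .
  qed
  then show "sample_centers x idx l \<tau> j = sample_centers x idx' l \<tau>' j"
    by (simp add: sample_centers_def fun_eq_iff)
qed

definition sample_cost where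
  "sample_cost d k m x idx wt Z = (\<Sum>p<m. wt (idx p) * near d k Z (x (idx p)))"

text \<open>\<open>few_points_mean\<close> is applied to every cluster that \<open>Z\<close> induces
  on the sample, taken as a set of positions so that repeated indices count with multiplicity.
  Passing from the induced assignment to the nearest of the new centers can only help.\<close>

lemma exists_good_sample_centers:
  assumes k: "1 \<le> k" and m: "1 \<le> m" and l: "1 \<le> l" and wt: "\<And>p. p < m \<Longrightarrow> 0 < wt (idx p)"
  shows "\<exists>\<tau>. (\<forall>a<k*l. \<tau> a < m) \<and>
    sample_cost d k m x idx wt (sample_centers x idx l \<tau>) \<le> (1 + 1 / real l) * sample_cost d k m x idx wt Z"
proof -
  have "\<forall>p. \<exists>j<k. near d k Z (x (idx p)) = sqd d (x (idx p)) (Z j)"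
    using near_attained[OF k] by metis
  then obtain F where F: "\<And>p. F p < k" "\<And>p. near d k Z (x (idx p)) = sqd d (x (idx p)) (Z (F p))" by metis
  define G where "G j = {p. p < m \<and> F p = j}" for j
  let ?y = "\<lambda>p. x (idx p)" and ?w = "\<lambda>p. wt (idx p)"
  have "\<exists>c. (\<forall>a<l. c a < m) \<and> (\<Sum>p\<in>G j. ?w p * sqd d (?y p) (\<lambda>h. (\<Sum>a<l. ?y (c a) h) / real l))
      \<le> (1 + 1 / real l) * (\<Sum>p\<in>G j. ?w p * sqd d (?y p) (Z j))" for j
  proof (cases "G j = {}")
    case True
    \<comment> \<open>A cluster that received no sample costs nothing; any positions will do, and
      position 0 exists.\<close>
    show ?thesis unfolding True using m by (intro exI[of _ "\<lambda>_. 0"]) auto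
  next
    case False
    have "finite (G j)" "\<And>p. p \<in> G j \<Longrightarrow> 0 < ?w p" using wt by (auto simp: G_def)
    from few_points_mean[where w = ?w, OF this False l, where y = ?y and d = d and z = "Z j"]
    obtain c where c: "\<forall>a<l. c a \<in> G j"
      "(\<Sum>p\<in>G j. ?w p * sqd d (?y p) (\<lambda>h. (\<Sum>a<l. ?y (c a) h) / real l))
        \<le> (1 + 1 / real l) * (\<Sum>p\<in>G j. ?w p * sqd d (?y p) (Z j))" by blast
    from c(1) have "\<forall>a<l. c a < m" by (simp add: G_def)
    with c(2) show ?thesis by blast
  qed
  then obtain c where c: "\<And>j a. a < l \<Longrightarrow> c j a < m"
    and c_le: "\<And>j. (\<Sum>p\<in>G j. ?w p * sqd d (?y p) (\<lambda>h. (\<Sum>a<l. ?y (c j a) h) / real l))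
      \<le> (1 + 1 / real l) * (\<Sum>p\<in>G j. ?w p * sqd d (?y p) (Z j))"
    using choice[OF allI, of "\<lambda>j c. (\<forall>a<l. c a < m) \<and>
        (\<Sum>p\<in>G j. ?w p * sqd d (?y p) (\<lambda>h. (\<Sum>a<l. ?y (c a) h) / real l))
          \<le> (1 + 1 / real l) * (\<Sum>p\<in>G j. ?w p * sqd d (?y p) (Z j))"] by blast
  define \<tau> where "\<tau> b = c (b div l) (b mod l)" for b
  have ctr: "sample_centers x idx l \<tau> j = (\<lambda>h. (\<Sum>a<l. ?y (c j a) h) / real l)" for j
    using l by (simp add: sample_centers_def \<tau>_def fun_eq_iff)
  have group: "(\<Sum>j<k. \<Sum>p\<in>G j. H p) = (\<Sum>p<m. H p)" for H :: "nat \<Rightarrow> real"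
  proof -
    have "(\<Sum>j<k. \<Sum>p\<in>{p\<in>{..<m}. F p = j}. H p) = (\<Sum>p<m. H p)"
      using F by (intro sum.group) auto
    then show ?thesis by (simp add: G_def)
  qed
  have "sample_cost d k m x idx wt (sample_centers x idx l \<tau>) =
    (\<Sum>j<k. \<Sum>p\<in>G j. ?w p * near d k (sample_centers x idx l \<tau>) (?y p))"
    by (simp add: sample_cost_def group)
  also have "\<dots> \<le> (\<Sum>j<k. \<Sum>p\<in>G j. ?w p * sqd d (?y p) (sample_centers x idx l \<tau> j))"
    using wt F by (intro sum_mono mult_left_mono near_le) (auto simp: G_def intro: less_imp_le)
  also have "\<dots> \<le> (\<Sum>j<k. (1 + 1 / real l) * (\<Sum>p\<in>G j. ?w p * sqd d (?y p) (Z j)))"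
    unfolding ctr by (intro sum_mono c_le)
  also have "\<dots> = (1 + 1 / real l) * (\<Sum>j<k. \<Sum>p\<in>G j. ?w p * near d k Z (?y p))"
    unfolding sum_distrib_left[symmetric]
    by (intro arg_cong[where f = "\<lambda>z. (1 + 1 / real l) * z"] sum.cong refl) (auto simp: F G_def)
  also have "\<dots> = (1 + 1 / real l) * sample_cost d k m x idx wt Z"
    by (simp add: group sample_cost_def)
  finally show ?thesis using c l by (intro exI[of _ \<tau>]) (auto simp: \<tau>_def)
qed


section \<open>Success of the sampling stage\<close>

context clustering begin

text \<open>The winner on the sample is compared with \<open>Z\<close>. Up to the scaling
  \<open>m / (3 * n)\<close>, each quantity is at most the next: \<open>(1 - a)^2\<close> times the
  cost of the winner, its sampled cost, \<open>1 + a\<close> times the sampled cost of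
  \<open>Z\<close>, and \<open>(1 + a)^2 * opt\<close>.\<close>

lemma sampling_success:
  fixes \<epsilon> :: real and m l T K :: nat
  assumes opt: "\<And>Z'. opt \<le> (\<Sum>i<n. near d k Z' (x i))"
    and T: "1 \<le> T" and good: "sum (dsq n d x g T) {..<n} \<le> 36 * opt"
    and \<epsilon>: "0 < \<epsilon>" "\<epsilon> < 1" and l: "real l \<ge> 4 / \<epsilon>" and K: "K = k * l"
    and m: "real m \<ge> (5 * K * ((444 * (1 + real T))\<^sup>2 * (16 / \<epsilon>\<^sup>2)))\<^sup>2"
  defines "w \<equiv> sens n (dsq n d x g T) (dcl n d x g T)"
  defines "idx \<equiv> \<lambda>h p. rep n w (h p)"
  defines "wt \<equiv> \<lambda>i. 1 / real (rep_count n w i)"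
  defines "ctrs \<equiv> \<lambda>h e. sample_centers x (idx h) l (digit m e)"
  defines "SC \<equiv> \<lambda>h e. sample_cost d k m x (idx h) wt (ctrs h e)"
  shows "measure_pmf.prob (uniform_draws m)
     {h. \<forall>e<m^K. (\<forall>e'<m^K. SC h e \<le> SC h e') \<longrightarrow>
           (\<Sum>i<n. near d k (ctrs h e) (x i)) \<le> (1 + \<epsilon>)\<^sup>2 * opt} \<ge> 3 / 4"
proof -
  \<comment> \<open>A quarter suffices, since \<open>1 + a \<le> (1 - a) * (1 + \<epsilon>)\<close>
    for \<open>\<epsilon> < 1\<close>.\<close>
  define a where "a = \<epsilon> / 4"
  define B where "B = 444 * (1 + real T)"
  \<comment> \<open>The exponent in the tail bounds is \<open>m / y\<close>.\<close>
  define y where "y = B\<^sup>2 / a\<^sup>2"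
  define cost where "cost Z' = (\<Sum>i<n. near d k Z' (x i))" for Z'
  define v where "v Z' u = wt (rep n w u) * near d k Z' (x (rep n w u))" for Z' u
  define M where "M Z' = cost Z' / (3 * n)" for Z'
  define N where "N = 3 * n"
  have N: "N \<ge> 1" using n by (simp add: N_def)
  have a: "0 < a" "a < 1 / 4" using \<epsilon> by (auto simp: a_def)
  have B: "B \<ge> 1" by (simp add: B_def)
  have l1: "l \<ge> 1" using l \<epsilon> by (cases l) auto
  have K1: "K \<ge> 1" using k l1 by (simp add: K)
  have w0: "0 \<le> w i" if "i < n" for i
    unfolding w_def using that by (intro sens_nonneg dsq_nonneg)
  have cnt: "0 < rep_count n w i" if "i < n" for i using rep_count_pos[OF w0 that] .
  have wt: "0 < wt i" if "i < n" for i using cnt[OF that] by (simp add: wt_def)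
  have cost0: "0 \<le> cost Z'" for Z' unfolding cost_def using near_nonneg[OF k] by (auto intro: sum_nonneg)
  \<comment> \<open>The weight cancels the multiplicity of each index in the list, so that rounding
    and padding cause no bias.\<close>
  have Meq: "M Z' = (\<Sum>u<N. v Z' u) / N" for Z'
  proof -
    have "(\<Sum>u<N. v Z' u) = (\<Sum>i<n. real (rep_count n w i) * (wt i * near d k Z' (x i)))"
      unfolding N_def v_def using sum_over_rep[OF n, of "\<lambda>i. wt i * near d k Z' (x i)" w] by simp
    also have "\<dots> = cost Z'" unfolding cost_def
    proof (intro sum.cong refl)
      fix i assume "i \<in> {..<n}"
      then show "real (rep_count n w i) * (wt i * near d k Z' (x i)) = near d k Z' (x i)"
        using cnt[of i] by (simp add: wt_def)
    qed
    finally show ?thesis by (simp add: M_def N_def)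
  qed
  have dsq_eq: "dsq n d x g T i = sqd d (x i) (x (pick n d x g (dcl n d x g T i)))" for i
    using dproc_invariant[OF T] by blast
  have dcl_less: "dcl n d x g T i < T" for i using dproc_invariant[OF T] by blast
  have v: "0 \<le> v Z' u \<and> v Z' u \<le> B * M Z'" for Z' u
  proof -
    define i where "i = rep n w u"
    have i: "i < n" unfolding i_def using rep_less[OF n] .
    have W: "sum (dsq n d x g T) {..<n} \<le> 36 * cost Z'"
      using good opt[of Z'] by (simp add: cost_def)
    have "near d k Z' (x i) \<le> 148 * cost Z' * w i"
      unfolding w_def
      by (rule near_le_sens[OF k i, where y = "\<lambda>t. x (pick n d x g t)"])
        (use W dsq_eq in \<open>auto simp: cost_def\<close>)
    also have "\<dots> \<le> 148 * cost Z' * (real (rep_count n w i) * (1 + T) / n)"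
    proof -
      have "real n * w i \<le> real (rep_count n w i) * sum w {..<n}"
        using rep_count_weight[OF w0 i] .
      also have "\<dots> \<le> real (rep_count n w i) * (1 + T)"
        unfolding w_def using sum_sens_le[of n "dcl n d x g T" T "dsq n d x g T"] dcl_less
        by (intro mult_left_mono) auto
      finally have "w i \<le> real (rep_count n w i) * (1 + T) / n" using n by (simp add: field_simps)
      then show ?thesis using cost0 by (intro mult_left_mono) auto
    qed
    finally have "wt i * near d k Z' (x i) \<le> wt i * (148 * cost Z' * (real (rep_count n w i) * (1 + T) / n))"
      using wt[OF i] by (intro mult_left_mono) auto
    also have "\<dots> = B * M Z'" using cnt[OF i] n by (simp add: wt_def B_def M_def field_simps)
    finally show ?thesis using wt[OF i] near_nonneg[OF k] unfolding v_def i_def[symmetric] by simp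
  qed
  have y16: "y \<ge> 16"
  proof -
    have "a\<^sup>2 \<le> (1 / 4)\<^sup>2" using a by (intro power_mono) auto
    moreover have "B\<^sup>2 \<ge> 1" using B by simp
    ultimately show ?thesis using a by (simp add: y_def field_simps power2_eq_square)
  qed
  have ya: "y * a \<ge> 1"
  proof -
    have "1 * a \<le> B\<^sup>2 * 1" using a B by (intro mult_mono) auto
    then show ?thesis using a by (simp add: y_def power2_eq_square field_simps)
  qed
  have m': "real m \<ge> (5 * K * y)\<^sup>2"
    using m by (simp add: y_def B_def a_def power_divide field_simps)
  define s where "s = sqrt m"
  have s2: "s\<^sup>2 = real m" by (simp add: s_def)
  have s: "s \<ge> 5 * K * y" unfolding s_def using m' by (rule real_le_rsqrt)
  have Ky: "5 * real K * y \<ge> 80" using mult_mono[of 5 "5 * real K" 16 y] K1 y16 by simp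
  have s80: "s \<ge> 80" using s Ky by linarith
  have m1: "m \<ge> 1" using s2 s80 by (cases m) auto
  have Km: "real K \<le> a * m" "2 * K \<le> m"
  proof -
    have "real K * 1 \<le> (5 * K * (y * a)) * s" using ya s80 K1 by (intro mult_mono) auto
    also have "\<dots> = a * ((5 * K * y) * s)" by simp
    also have "\<dots> \<le> a * (s * s)" using a s s80 by (intro mult_left_mono mult_right_mono) auto
    finally show *: "real K \<le> a * m" using s2 by (simp add: power2_eq_square)
    also have "\<dots> \<le> 1 / 4 * real m" using a by (intro mult_right_mono) auto
    finally show "2 * K \<le> m" by simp
  qed
  \<comment> \<open>With \<open>s = sqrt m\<close>, \<open>ln m\<close> is at most
    \<open>2 * s\<close>, while \<open>m / y\<close> is at least \<open>5 * K * s\<close>. The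
    difference \<open>3 * K * s\<close> leaves room for the constant 3, and
    \<open>exp (- 3) \<le> 1 / 8\<close>.\<close>
  have tail: "real (m ^ K) * exp (- a\<^sup>2 * m / B\<^sup>2) \<le> 1 / 8"
  proof -
    have "ln s \<le> s - 1" using s80 by (intro ln_le_minus_one) simp
    moreover have "ln (real m) = 2 * ln s" using s80 by (simp add: s2[symmetric] ln_realpow)
    ultimately have lnm: "ln (real m) \<le> 2 * s" by simp
    have "real K * ln (real m) + 3 \<le> real K * (2 * s) + 3"
      using lnm by (intro add_right_mono mult_left_mono) auto
    also have "3 \<le> real K * (3 * s)" using K1 s80 mult_mono[of 1 "real K" 3 "3 * s"] by simp
    also have "real K * (2 * s) + real K * (3 * s) = (5 * K * y) * s / y" using y16 by simp
    also have "\<dots> \<le> s * s / y" using s s80 y16 by (intro divide_right_mono mult_right_mono) auto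
    also have "\<dots> = a\<^sup>2 * m / B\<^sup>2"
      using s2 a B by (simp add: y_def power2_eq_square field_simps)
    finally have "real K * ln (real m) - a\<^sup>2 * m / B\<^sup>2 \<le> - 3" by simp
    then have "exp (real K * ln (real m) - a\<^sup>2 * m / B\<^sup>2) \<le> exp (- 3)" by simp
    moreover have e1: "exp (real K * ln (real m)) = real (m ^ K)"
      using m1 by (simp add: exp_of_nat_mult)
    moreover have "exp (- 3 :: real) \<le> 1 / 8"
    proof -
      have "(2 :: real) ^ 3 \<le> exp 1 ^ 3" using exp_ge_add_one_self[of 1] by (intro power_mono) auto
      also have "\<dots> = exp 3" by (simp flip: exp_of_nat_mult)
      finally show ?thesis by (simp add: exp_minus field_simps)
    qed
    moreover have "exp (real K * ln (real m) - a\<^sup>2 * m / B\<^sup>2) = real (m ^ K) * exp (- a\<^sup>2 * m / B\<^sup>2)"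
      unfolding e1[symmetric] exp_add[symmetric] by simp
    ultimately show ?thesis by simp
  qed
  have digit_less: "digit m e b < m" for e b using m1 by (simp add: digit_def)
  define bad where "bad e = {h. (\<Sum>p<m. v (ctrs h e) (h p)) < (1 - a)\<^sup>2 * m * M (ctrs h e)}" for e
  define bad' where "bad' = {h. (\<Sum>p<m. v Z (h p)) > (1 + a) * m * M Z}"
  have draws: "uniform_draws m = draws {..<m} N" by (simp add: uniform_draws_def N_def)
  \<comment> \<open>Centers with index \<open>k\<close> or more may read positions other than the
    first \<open>K\<close> digits. Setting them to 0 makes the candidate a function of the draws at
    these digits alone, as \<open>compression_bound\<close> demands, and leaves \<open>near\<close>
    unchanged.\<close>
  define ctrs' where "ctrs' e h j = (if j < k then ctrs h e j else (\<lambda>_. 0))" for e h j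
  have near': "near d k (ctrs' e h) u = near d k (ctrs h e) u" for e h u
    by (rule near_cong) (simp add: ctrs'_def)
  have bad_eq: "bad e = {h. (\<Sum>p<m. v (ctrs' e h) (h p)) < (1 - a)\<^sup>2 * m * M (ctrs' e h)}" for e
    by (simp add: bad_def v_def M_def cost_def near')
  have p1: "measure_pmf.prob (uniform_draws m) (bad e) \<le> exp (- a\<^sup>2 * m / B\<^sup>2)" for e
    unfolding draws bad_eq
  proof (rule compression_bound[where I = "digit m e ` {..<K}" and F = "ctrs' e" and v = v and M = M])
    have card: "card (digit m e ` {..<K}) \<le> K" using card_image_le[of "{..<K}" "digit m e"] by simp
    then show "real (card (digit m e ` {..<K})) \<le> a * m" using Km(1) by linarith
    show "2 * card (digit m e ` {..<K}) \<le> m" using Km(2) card by linarith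
    show "ctrs' e h = ctrs' e h'" if eq: "\<And>p. p \<in> digit m e ` {..<K} \<Longrightarrow> h p = h' p" for h h'
    proof -
      have "sample_centers x (idx h) l (digit m e) j = sample_centers x (idx h') l (digit m e) j"
        if "j < k" for j
      proof -
        have "h (digit m e (j * l + b)) = h' (digit m e (j * l + b))" if "b < l" for b
        proof (rule eq)
          have "j * l + b < (j + 1) * l" using that by simp
          also have "\<dots> \<le> K" unfolding K using \<open>j < k\<close> by (intro mult_right_mono) auto
          finally show "digit m e (j * l + b) \<in> digit m e ` {..<K}" by simp
        qed
        then show ?thesis by (simp add: sample_centers_def idx_def fun_eq_iff)
      qed
      then show ?thesis by (simp add: ctrs'_def ctrs_def fun_eq_iff)
    qed
    show "digit m e ` {..<K} \<subseteq> {..<m}" using digit_less by auto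
  qed (use N a B Meq v in \<open>assumption | linarith | blast\<close>)+
  have p2: "measure_pmf.prob (uniform_draws m) bad' \<le> exp (- a\<^sup>2 * m / B\<^sup>2)"
  proof -
    have "measure_pmf.prob (uniform_draws m) bad' \<le> exp (- 2 * a\<^sup>2 * m / B\<^sup>2)"
      unfolding draws bad'_def
      using hoeffding_draws(2)[of "{..<m}" N a B "M Z" "v Z"] N a B Meq v by simp
    also have "\<dots> \<le> exp (- a\<^sup>2 * m / B\<^sup>2)" by (simp add: divide_right_mono)
    finally show ?thesis .
  qed
  have SC: "SC h e = (\<Sum>p<m. v (ctrs h e) (h p))" for h e
    by (simp add: SC_def sample_cost_def v_def idx_def)
  have success: "cost (ctrs h e) \<le> (1 + \<epsilon>)\<^sup>2 * opt"
    if h: "h \<notin> bad e" "h \<notin> bad'" and best: "\<And>e'. e' < m ^ K \<Longrightarrow> SC h e \<le> SC h e'" for h e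
  proof -
    obtain \<tau> where \<tau>: "\<And>b. b < k * l \<Longrightarrow> \<tau> b < m"
      "sample_cost d k m x (idx h) wt (sample_centers x (idx h) l \<tau>)
         \<le> (1 + 1 / real l) * sample_cost d k m x (idx h) wt Z"
      using exists_good_sample_centers[OF k m1 l1, of wt "idx h" d x Z] wt rep_less[OF n]
      by (auto simp: idx_def)
    \<comment> \<open>The good word of positions is among those enumerated, so the winner is no more
      expensive on the sample.\<close>
    obtain e' where e': "e' < m ^ K" "\<And>b. b < K \<Longrightarrow> digit m e' b = \<tau> b"
      using digits_surj[OF m1, of K \<tau>] \<tau>(1) K by (auto simp: digit_def)
    have "near d k (ctrs h e') u = near d k (sample_centers x (idx h) l \<tau>) u" for u
      unfolding ctrs_def using e'(2) K by (intro near_sample_centers_cong) auto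
    then have "SC h e' = sample_cost d k m x (idx h) wt (sample_centers x (idx h) l \<tau>)"
      by (simp add: SC_def sample_cost_def)
    then have "SC h e \<le> (1 + 1 / real l) * sample_cost d k m x (idx h) wt Z"
      using best[OF e'(1)] \<tau>(2) by simp
    also have "sample_cost d k m x (idx h) wt Z = (\<Sum>p<m. v Z (h p))"
      by (simp add: sample_cost_def v_def idx_def)
    also have "(1 + 1 / real l) * \<dots> \<le> (1 + a) * ((1 + a) * m * M Z)"
    proof (intro mult_mono)
      have "4 \<le> real l * \<epsilon>" using l \<epsilon> by (simp add: field_simps)
      then show "1 + 1 / real l \<le> 1 + a" using l1 by (simp add: a_def field_simps)
      show "0 \<le> (\<Sum>p<m. v Z (h p))" using v by (auto intro: sum_nonneg)
    qed (use h(2) a in \<open>auto simp: bad'_def\<close>)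
    also have "\<dots> \<le> (1 + a) * ((1 + a) * m * (opt / (3 * n)))"
    proof -
      have "cost Z \<le> opt" unfolding cost_def opt_def using f_less by (intro sum_mono near_le) auto
      then show ?thesis unfolding M_def using a by (intro mult_left_mono divide_right_mono) auto
    qed
    finally have "(1 - a)\<^sup>2 * m * M (ctrs h e) \<le> (1 + a) * ((1 + a) * m * (opt / (3 * n)))"
      using h(1) by (simp add: bad_def SC)
    then have "(m / (3 * n)) * ((1 - a)\<^sup>2 * cost (ctrs h e)) \<le> (m / (3 * n)) * ((1 + a)\<^sup>2 * opt)"
      by (simp add: M_def power2_eq_square mult_ac)
    then have "(1 - a)\<^sup>2 * cost (ctrs h e) \<le> (1 + a)\<^sup>2 * opt"
      using m1 n by (subst (asm) mult_le_cancel_left_pos) auto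
    also have "\<dots> \<le> ((1 - a) * (1 + \<epsilon>))\<^sup>2 * opt"
    proof (intro mult_right_mono power_mono)
      have "\<epsilon> * \<epsilon> \<le> \<epsilon> * 1" using \<epsilon> by (intro mult_left_mono) auto
      then show "1 + a \<le> (1 - a) * (1 + \<epsilon>)"
        using \<epsilon> by (simp add: a_def field_simps)
    qed (use a opt_nonneg in auto)
    also have "\<dots> = (1 - a)\<^sup>2 * ((1 + \<epsilon>)\<^sup>2 * opt)" by (simp add: power_mult_distrib)
    finally show ?thesis using a by (subst (asm) mult_le_cancel_left_pos) auto
  qed
  define Bad where "Bad = (\<Union>e\<in>{..<m^K}. bad e) \<union> bad'"
  have "measure_pmf.prob (uniform_draws m) Bad \<le> 
      measure_pmf.prob (uniform_draws m) (\<Union>e\<in>{..<m^K}. bad e) + measure_pmf.prob (uniform_draws m) bad'"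
    unfolding Bad_def by (intro measure_Un_le) auto
  also have "measure_pmf.prob (uniform_draws m) (\<Union>e\<in>{..<m^K}. bad e) \<le>
      (\<Sum>e<m^K. measure_pmf.prob (uniform_draws m) (bad e))"
    by (intro measure_UNION_le) auto
  also have "\<dots> \<le> (\<Sum>e<m^K. exp (- a\<^sup>2 * m / B\<^sup>2))" by (intro sum_mono p1)
  also have "\<dots> \<le> 1 / 8" using tail by simp
  also have "measure_pmf.prob (uniform_draws m) bad' \<le> 1 / 8"
  proof -
    \<comment> \<open>As \<open>m ^ K \<ge> 1\<close>, the single event for \<open>Z\<close> fits
      under the bound for the whole union.\<close>
    have "exp (- a\<^sup>2 * m / B\<^sup>2) \<le> real (m ^ K) * exp (- a\<^sup>2 * m / B\<^sup>2)"
      using m1 by simp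
    then show ?thesis using p2 tail by linarith
  qed
  finally have "measure_pmf.prob (uniform_draws m) Bad \<le> 1 / 4" by simp
  then have "3 / 4 \<le> measure_pmf.prob (uniform_draws m) (- Bad)"
    using measure_pmf.prob_compl[of Bad "uniform_draws m"] by (simp add: Compl_eq_Diff_UNIV)
  also have "\<dots> \<le> measure_pmf.prob (uniform_draws m)
     {h. \<forall>e<m^K. (\<forall>e'<m^K. SC h e \<le> SC h e') \<longrightarrow> cost (ctrs h e) \<le> (1 + \<epsilon>)\<^sup>2 * opt}"
    using success by (intro measure_pmf.finite_measure_mono) (auto simp: Bad_def)
  finally show ?thesis unfolding cost_def .
qed

end


subsection \<open>The program\<close>

lemmas wp_NStore' = wp_NStore[unfolded One_nat_def]

abbreviation FNV :: "vname \<Rightarrow> rexp" where "FNV x \<equiv> ROfNat (NV x)"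

section \<open>Program fragments: distances, sums and the sampling list\<close>

abbreviation dist_loop :: "nexp \<Rightarrow> vname \<Rightarrow> nexp \<Rightarrow> com" where
  "dist_loop e1 y e2 \<equiv>
     For ''h'' (NV ''d'')
       (RSet ''acc'' (RAdd (RV ''acc'')
         (RMul (RSub (RCell ''A'' (NAdd e1 (NV ''h''))) (RCell y (NAdd e2 (NV ''h''))))
               (RSub (RCell ''A'' (NAdd e1 (NV ''h''))) (RCell y (NAdd e2 (NV ''h'')))))))"

text \<open>Rows are passed by their offsets: a row-major index needs a product of naturals, which
  the machine cannot form, so offsets are read from tables.\<close>

definition dist_block :: "nexp \<Rightarrow> vname \<Rightarrow> nexp \<Rightarrow> com" where
  "dist_block e1 y e2 =
     Seq (RSet ''acc'' (ROfNat (NConst 0)))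
     (dist_loop e1 y e2)"

lemma written_dist_block [simp]:
  "nwritten (dist_block e1 y e2) = {''h''}" "rwritten (dist_block e1 y e2) = {''acc''}"
  by (auto simp: dist_block_def)

lemma wp_dist_block:
  assumes "nats s ''d'' 0 = d" "y \<noteq> ''acc''"
    and "\<And>s'. agree {''h''} {''acc''} s s' \<Longrightarrow> nval e1 s' = o1 \<and> nval e2 s' = o2"
    and "\<And>s'. reals s' ''acc'' 0 = sqd d (\<lambda>h. reals s ''A'' (o1 + h)) (\<lambda>h. reals s y (o2 + h)) \<Longrightarrow>
           agree {''h''} {''acc''} s s' \<Longrightarrow> Q s'"
  shows "wp (5 * d + 5) (dist_block e1 y e2) Q s"
proof -
  let ?s = "reals_upd ''acc'' 0 0 s"
  have ag: "agree {''h''} {''acc''} s s'" if "agree {''h''} {''acc''} ?s s'" for s'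
    using that by (auto simp: agree_def)
  have "wp (d * (1 + 4) + 3) (dist_loop e1 y e2) Q ?s"
  proof (rule wp_For[where I = "\<lambda>i s'. reals s' ''acc'' 0 =
      (\<Sum>h<i. (reals s ''A'' (o1 + h) - reals s y (o2 + h))\<^sup>2)"], goal_cases)
    case (2 s')
    then show ?case using assms(1) by (simp add: agree_def)
  next
    case (4 i s')
    have "agree {''h''} {''acc''} s s'" using 4 ag by simp
    then have "nval e1 s' = o1" "nval e2 s' = o2" "reals s' ''A'' = reals s ''A''" "reals s' y = reals s y"
      using assms(2,3) by (auto simp: agree_def)
    then show ?case using 4 by (intro wp_RStore) (simp add: power2_eq_square)
  next
    case (5 s')
    then show ?case using ag by (intro assms(4)) (auto simp: sqd_def)
  qed auto
  then show ?thesis unfolding dist_block_def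
    by (intro wp_time[OF wp_RStore_Seq]) auto
qed

definition sum_block :: com where
  "sum_block = Seq (RSet ''W'' (ROfNat (NConst 0)))
     (For ''i'' (NV ''n'') (RSet ''W'' (RAdd (RV ''W'') (RCell ''D2'' (NV ''i'')))))"

lemma written_sum_block [simp]: "nwritten sum_block = {''i''}" "rwritten sum_block = {''W''}"
  by (auto simp: sum_block_def)

lemma wp_sum_block:
  assumes "nats s ''n'' 0 = n"
    and "\<And>s'. reals s' ''W'' 0 = sum (reals s ''D2'') {..<n} \<Longrightarrow> agree {''i''} {''W''} s s' \<Longrightarrow> Q s'"
  shows "wp (5 * n + 5) sum_block Q s"
proof -
  let ?s = "reals_upd ''W'' 0 0 s"
  have "wp (n * (1 + 4) + 3) (For ''i'' (NV ''n'') (RSet ''W'' (RAdd (RV ''W'') (RCell ''D2'' (NV ''i''))))) Q ?s"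
  proof (rule wp_For[where I = "\<lambda>i s'. reals s' ''W'' 0 = sum (reals s ''D2'') {..<i}"], goal_cases)
    case (2 s')
    then show ?case using assms(1) by (simp add: agree_def)
  next
    case (4 i s')
    then show ?case by (intro wp_RStore) (simp add: agree_def)
  next
    case (5 s')
    then show ?case by (intro assms(2)) (auto simp: agree_def)
  qed auto
  then show ?thesis unfolding sum_block_def by (intro wp_time[OF wp_RStore_Seq]) auto
qed

lemma rep_list_append: "m \<le> n' \<Longrightarrow> \<exists>ys. rep_list n w n' = rep_list n w m @ ys"
  by (induction n' rule: dec_induct) (auto simp: rep_list_Suc)

lemma rep_at:
  assumes "i < n" "b < copies n w i"
  shows "rep n w (length (rep_list n w i) + b) = i"
proof -
  obtain ys where "rep_list n w n = rep_list n w (Suc i) @ ys"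
    using rep_list_append[of "Suc i" n n w] assms(1) by auto
  then have "rep_list n w n = rep_list n w i @ replicate (copies n w i) i @ ys"
    by (simp add: rep_list_Suc)
  then show ?thesis using assms(2) by (simp add: rep_def nth_append)
qed

lemma rep_padding: "length (rep_list n w n) \<le> u \<Longrightarrow> rep n w u = 0"
  by (simp add: rep_def)

text \<open>The left side is the test of the program after it has written copy number
  \<open>b\<close>, counted from 0. Clearing the division makes it correct also for total weight
  0.\<close>

lemma less_copies_iff:
  assumes w: "\<And>i. i < n \<Longrightarrow> 0 \<le> w i" and i: "i < n"
  shows "real b * sum w {..<n} < real n * w i \<longleftrightarrow> Suc b < copies n w i"
proof (cases "sum w {..<n} = 0")
  case True
  then have "w i = 0" using assms by (subst (asm) sum_nonneg_eq_0_iff) auto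
  then show ?thesis using True by (simp add: copies_def)
next
  case False
  moreover have "0 \<le> sum w {..<n}" using w by (auto intro: sum_nonneg)
  ultimately have "sum w {..<n} > 0" by simp
  then have "real b * sum w {..<n} < real n * w i \<longleftrightarrow> real b < real n * w i / sum w {..<n}"
    by (simp add: field_simps)
  also have "\<dots> \<longleftrightarrow> Suc b < copies n w i" unfolding copies_def by linarith
  finally show ?thesis .
qed

text \<open>Every iteration writes exactly one cell, so that the running time is linear although
  single points may be repeated \<open>n\<close> times.\<close>

abbreviation emit :: "com" where
  "emit \<equiv>
     If (NLess (NV ''i'') (NV ''n''))
         (Seq (NStore ''rep'' (NV ''pos'') (NV ''i''))
           (If (RLess (RMul (FNV ''b'') (RV ''W'')) (RMul (FNV ''n'') (RCell ''D2'' (NV ''i''))))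
             (NIncr ''b'')
             (Seq (NIncr ''i'') (NSet ''b'' (NConst 0)))))
         (NStore ''rep'' (NV ''pos'') (NConst 0))"

definition rep_block :: com where
  "rep_block = Seq sum_block (Seq (NSet ''i'' (NConst 0)) (Seq (NSet ''b'' (NConst 0))
     (For ''pos'' (NV ''n3'')
       emit)))"

lemma written_rep_block [simp]:
  "nwritten rep_block = {''i'', ''b'', ''pos'', ''rep''}" "rwritten rep_block = {''W''}"
  by (auto simp: rep_block_def)

lemma wp_rep_block:
  assumes n: "nats s ''n'' 0 = n" "nats s ''n3'' 0 = 3 * n"
    and w: "\<And>i. i < n \<Longrightarrow> reals s ''D2'' i = w i \<and> 0 \<le> w i"
    and Q: "\<And>s'. (\<forall>u<3*n. nats s' ''rep'' u = rep n w u) \<Longrightarrow>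
              agree {''i'', ''b'', ''pos'', ''rep''} {''W''} s s' \<Longrightarrow> Q s'"
  shows "wp (38 * n + 15) rep_block Q s"
proof -
  let ?X = "{''i'', ''b'', ''pos'', ''rep''}" and ?Y = "{''W''} :: vname set"
  let ?L = "\<lambda>i. length (rep_list n w i)"
  have main: "wp (3 * n * (7 + 4) + 3) (For ''pos'' (NV ''n3'') emit) Q s1"
    if s1: "agree ?X ?Y s s1" "reals s1 ''W'' 0 = sum w {..<n}" "nats s1 ''i'' 0 = 0" "nats s1 ''b'' 0 = 0" for s1
  proof -
    \<comment> \<open>Either \<open>p\<close> is the position of copy \<open>b\<close> of the
      current index, or all indices are finished and padding is being written. As \<open>b\<close>
      stays below the number of copies, there is a cell to write in every round.\<close>
    define I where "I p s' \<longleftrightarrow> (\<forall>u<p. nats s' ''rep'' u = rep n w u) \<and> reals s' ''W'' = reals s1 ''W'' \<and>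
      (nats s' ''i'' 0 < n \<and> nats s' ''b'' 0 < copies n w (nats s' ''i'' 0) \<and>
         p = ?L (nats s' ''i'' 0) + nats s' ''b'' 0 \<or>
       \<not> nats s' ''i'' 0 < n \<and> ?L n \<le> p)" for p and s' :: state
    show ?thesis
    proof (rule wp_For[where I = I], goal_cases)
      case (2 s')
      then show ?case using n s1(1) by (simp add: agree_def)
    next
      case 3
      show ?case using s1 by (cases "n = 0") (auto simp: I_def copies_def rep_list_def)
    next
      case (4 p s')
      have s': "nats s' ''n'' 0 = n" "reals s' ''D2'' = reals s ''D2''"
        using 4(2) s1(1) n by (auto simp: agree_def)
      have W: "reals s' ''W'' 0 = sum w {..<n}" using 4(4) s1(2) by (simp add: I_def)
      let ?i = "nats s' ''i'' 0" and ?b = "nats s' ''b'' 0"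
      show ?case
      proof (cases "?i < n")
        case False
        then show ?thesis using 4 s'
          by (intro wp_time[OF wp_If[OF _, where t = 1]])
            (auto intro!: wp_NStore' simp: I_def less_Suc_eq rep_padding)
      next
        case True
        then have i: "?b < copies n w ?i" "p = ?L ?i + ?b" using 4(4) by (auto simp: I_def)
        have rep_p: "rep n w p = ?i" unfolding i(2) using True i(1) by (rule rep_at)
        have iff: "real ?b * sum w {..<n} < real n * reals s ''D2'' ?i \<longleftrightarrow> Suc ?b < copies n w ?i"
          using less_copies_iff[of n w ?i ?b] w True by simp
        have "wp 4 (If (RLess (RMul (FNV ''b'') (RV ''W'')) (RMul (FNV ''n'') (RCell ''D2'' (NV ''i''))))
               (NIncr ''b'') (Seq (NIncr ''i'') (NSet ''b'' (NConst 0))))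
            (\<lambda>s'. I (Suc p) (nats_upd ''pos'' 0 (Suc p) s')) (nats_upd ''rep'' p ?i s')"
        proof (cases "Suc ?b < copies n w ?i")
          case b: True
          show ?thesis
            by (rule wp_time[OF wp_If[where t = 1]])
              (use 4 s' W iff b True i rep_p in \<open>auto intro!: wp_NStore' simp: I_def less_Suc_eq\<close>)
        next
          case b: False
          then have "Suc p = ?L (Suc ?i)" using i by (simp add: rep_list_Suc)
          moreover have "0 < copies n w (Suc ?i)" by (simp add: copies_def)
          moreover have "Suc ?i < n \<or> ?L n \<le> ?L (Suc ?i)" using True by (metis Suc_lessI order_refl)
          ultimately show ?thesis
            by (intro wp_time[OF wp_If[where t = 3]])
              (use 4 s' W iff b True i rep_p in \<open>auto intro!: wp_NStore wp_NStore' wp_time[OF wp_NStore_Seq[where t = 1]] simp: I_def less_Suc_eq\<close>)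
        qed
        then show ?thesis using True s' 4(3)
          by (intro wp_time[OF wp_If[where t = 6]]) (auto intro!: wp_time[OF wp_NStore_Seq])
      qed
    next
      case (5 s')
      then show ?case using s1(1) by (intro Q) (auto simp: I_def agree_def)
    qed auto
  qed
  have "wp (5 * n + 5 + (3 * n * (7 + 4) + 3 + 2 + 2) + 1) rep_block Q s"
    unfolding rep_block_def
  proof (intro wp_Seq wp_sum_block[OF n(1)] wp_NStore_Seq main)
    fix s' assume s': "reals s' ''W'' 0 = sum (reals s ''D2'') {..<n}" "agree {''i''} {''W''} s s'"
    then show "agree ?X ?Y s (nats_upd ''b'' (nval (NConst 0) (nats_upd ''i'' (nval (NConst 0) s') (nval (NConst 0) s') s'))
       (nval (NConst 0) (nats_upd ''i'' (nval (NConst 0) s') (nval (NConst 0) s') s')) (nats_upd ''i'' (nval (NConst 0) s') (nval (NConst 0) s') s'))"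
      by (auto simp: agree_def)
    show "reals (nats_upd ''b'' (nval (NConst 0) (nats_upd ''i'' (nval (NConst 0) s') (nval (NConst 0) s') s'))
       (nval (NConst 0) (nats_upd ''i'' (nval (NConst 0) s') (nval (NConst 0) s') s')) (nats_upd ''i'' (nval (NConst 0) s') (nval (NConst 0) s') s')) ''W'' 0 = sum w {..<n}"
      using s' w by simp
  qed auto
  then show ?thesis by (rule wp_time) simp
qed


section \<open>Program fragments: squared-distance sampling, sensitivities and the sample\<close>

abbreviation pick_loop :: "com" where
  "pick_loop \<equiv>
     For ''i'' (NV ''n'')
       (Seq (dist_block (NCell ''rd'' (NV ''i'')) ''A'' (NCell ''rd'' (NV ''q'')))
         (If (BNot (BAnd (NLess (NConst 0) (NV ''r'')) (BNot (RLess (RV ''acc'') (RCell ''D2'' (NV ''i''))))))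
           (Seq (RStore ''D2'' (NV ''i'') (RV ''acc'')) (NStore ''cl'' (NV ''i'') (NV ''r'')))
           SKIP))"

text \<open>Conditions have only negation and conjunction; the test in \<open>pick_loop\<close> says
  that \<open>r\<close> is 0 or the new distance is smaller. In round 0 it overrides the initial
  zeros, and the same pattern starts the searches for a minimum below.\<close>

definition pick_block :: com where
  "pick_block = Seq (NSet ''q'' (NCell ''rep'' (NCell ''g'' (NV ''r''))))
     pick_loop"

definition dproc_block :: com where
  "dproc_block = For ''r'' (NV ''T'') (Seq rep_block pick_block)"

abbreviation size_loop :: "com" where
  "size_loop \<equiv>
     For ''i'' (NV ''n'') (NStore ''sz'' (NCell ''cl'' (NV ''i'')) (NAdd (NCell ''sz'' (NCell ''cl'' (NV ''i''))) (NConst 1)))"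

abbreviation count_loop :: "com" where
  "count_loop \<equiv>
     For ''u'' (NV ''n3'') (NStore ''cnt'' (NCell ''rep'' (NV ''u'')) (NAdd (NCell ''cnt'' (NCell ''rep'' (NV ''u''))) (NConst 1)))"

abbreviation sens_loop :: "com" where
  "sens_loop \<equiv>
     For ''i'' (NV ''n'') (RStore ''D2'' (NV ''i'')
        (RAdd (RDiv (RCell ''D2'' (NV ''i'')) (RV ''W'')) (RDiv (ROfNat (NConst 1)) (ROfNat (NCell ''sz'' (NCell ''cl'' (NV ''i'')))))))"

text \<open>\<open>rep_block\<close> takes its weights from the array of squared distances, so the
  sensitivities overwrite it and the same fragment serves both distributions. The final tally gives
  the multiplicities by which the sample is reweighted.\<close>

definition sens_block :: com where
  "sens_block = Seq sum_block
     (Seq size_loop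
     (Seq sens_loop
     (Seq rep_block
     count_loop)))"

definition sample_block :: com where
  "sample_block = For ''p'' (NV ''m'') (NStore ''idx'' (NV ''p'') (NCell ''rep'' (NCell ''hs'' (NV ''p''))))"

lemma written_blocks [simp]:
  "nwritten pick_block = {''q'', ''i'', ''h'', ''cl''}" "rwritten pick_block = {''acc'', ''D2''}"
  "nwritten dproc_block = {''r'', ''i'', ''b'', ''pos'', ''rep'', ''q'', ''h'', ''cl''}"
  "rwritten dproc_block = {''W'', ''acc'', ''D2''}"
  "nwritten sens_block = {''i'', ''sz'', ''b'', ''pos'', ''rep'', ''u'', ''cnt''}"
  "rwritten sens_block = {''W'', ''D2''}"
  "nwritten sample_block = {''p'', ''idx''}" "rwritten sample_block = {}"
  by (auto simp: pick_block_def dproc_block_def sens_block_def sample_block_def)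

definition base_vars :: "vname set" where
  "base_vars = {''n'', ''d'', ''k'', ''T'', ''l'', ''K'', ''m'', ''N'', ''n3'', ''rd'', ''rk'', ''rl'', ''g'', ''hs''}"

locale machine =
  fixes n d k l m K T :: nat and x :: "nat \<Rightarrow> nat \<Rightarrow> real" and g h :: "nat \<Rightarrow> nat"
  assumes n: "1 \<le> n" and k: "1 \<le> k" and kn: "k \<le> n" and l: "1 \<le> l" and m: "1 \<le> m" and T: "1 \<le> T"
    and K: "K = k * l" and g: "\<And>r. r < T \<Longrightarrow> g r < 3 * n" and h: "\<And>p. p < m \<Longrightarrow> h p < 3 * n"
begin

text \<open>What setup and draws have left in memory. The later blocks only read these arrays, so
  \<open>base_agree\<close> carries the property through all of them.\<close>

definition base :: "state \<Rightarrow> bool" where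
  "base s \<longleftrightarrow> nats s ''n'' 0 = n \<and> nats s ''d'' 0 = d \<and> nats s ''k'' 0 = k \<and> nats s ''T'' 0 = T \<and>
     nats s ''l'' 0 = l \<and> nats s ''K'' 0 = K \<and> nats s ''m'' 0 = m \<and> nats s ''N'' 0 = m ^ K \<and> nats s ''n3'' 0 = 3 * n \<and>
     (\<forall>i\<le>n. nats s ''rd'' i = i * d \<and> nats s ''rk'' i = i * k) \<and> (\<forall>j\<le>k. nats s ''rl'' j = j * l) \<and>
     (\<forall>i<n. \<forall>j<d. reals s ''A'' (i * d + j) = x i j) \<and>
     (\<forall>r<T. nats s ''g'' r = g r) \<and> (\<forall>p<m. nats s ''hs'' p = h p)"

lemma base_agree:
  assumes "base s" "agree X Y s s'" "X \<inter> base_vars = {}" "''A'' \<notin> Y"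
  shows "base s'"
proof -
  have "nats s' v = nats s v" if "v \<in> base_vars" for v
    using assms(2,3) that by (auto simp: agree_def)
  moreover have "reals s' ''A'' = reals s ''A''" using assms(2,4) by (simp add: agree_def)
  ultimately show ?thesis using assms(1) by (simp add: base_def base_vars_def)
qed

lemma base_A: "base s \<Longrightarrow> i < n \<Longrightarrow> sqd d (\<lambda>j. reals s ''A'' (i * d + j)) v = sqd d (x i) v"
  "base s \<Longrightarrow> i < n \<Longrightarrow> sqd d u (\<lambda>j. reals s ''A'' (i * d + j)) = sqd d u (x i)"
  by (auto intro!: sqd_cong simp: base_def)

lemma wp_pick_block:
  assumes s: "base s" and r: "r < T" "nats s ''r'' 0 = r"
    and D: "\<And>i. i < n \<Longrightarrow> reals s ''D2'' i = dsq n d x g r i \<and> nats s ''cl'' i = dcl n d x g r i"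
    and rep: "\<And>u. u < 3 * n \<Longrightarrow> nats s ''rep'' u = rep n (dsq n d x g r) u"
    and Q: "\<And>s'. agree {''q'', ''i'', ''h'', ''cl''} {''acc'', ''D2''} s s' \<Longrightarrow>
      (\<forall>i<n. reals s' ''D2'' i = dsq n d x g (Suc r) i \<and> nats s' ''cl'' i = dcl n d x g (Suc r) i) \<Longrightarrow> Q s'"
  shows "wp (n * (5 * d + 14) + 5) pick_block Q s"
proof -
  let ?X = "{''q'', ''i'', ''h'', ''cl''}" and ?Y = "{''acc'', ''D2''}"
  define q where "q = pick n d x g r"
  have q: "q < n" unfolding q_def pick_def by (rule rep_less[OF n])
  let ?s = "nats_upd ''q'' 0 q s"
  \<comment> \<open>In the middle of a round the indices below \<open>i\<close> are already updated.
    The point \<open>q\<close> was looked up before, so updating in place is harmless.\<close>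
  define J where "J i s' \<longleftrightarrow> (\<forall>i'<n. reals s' ''D2'' i' = dsq n d x g (if i' < i then Suc r else r) i' \<and>
      nats s' ''cl'' i' = dcl n d x g (if i' < i then Suc r else r) i')" for i and s' :: state
  have "wp (n * ((5 * d + 5) + 4 + 1 + 4) + 3) pick_loop Q ?s"
  proof (rule wp_For[where I = J], goal_cases)
    case (2 s')
    then show ?case using s by (simp add: agree_def base_def)
  next
    case 3
    then show ?case using D by (simp add: J_def)
  next
    case (4 i s')
    have ag: "agree ?X ?Y s s'" using 4(2) by (auto simp: agree_def)
    then have b': "base s'" by (rule base_agree[OF s]) (auto simp: base_vars_def)
    have q': "nats s' ''q'' 0 = q" "nats s' ''r'' 0 = r" using 4(2) r(2) by (auto simp: agree_def)
    show ?case
    proof (intro wp_Seq wp_dist_block[where d = d and ?o1.0 = "i * d" and ?o2.0 = "q * d"], goal_cases)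
      case (3 s'')
      then show ?case using b' q q' 4(1,3) by (auto simp: agree_def base_def)
    next
      case (4 s'')
      have acc: "reals s'' ''acc'' 0 = sqd d (x i) (x q)"
        using 4(1) base_A[OF b'] \<open>i < n\<close> q by simp
      have *: "nats s'' ''r'' 0 = r" "nats s'' ''i'' 0 = i" "J i s''"
        using 4(2) q' \<open>J i s'\<close> \<open>nats s' ''i'' 0 = i\<close> by (auto simp: agree_def J_def)
      then have D2: "reals s'' ''D2'' i = dsq n d x g r i" using \<open>i < n\<close> by (simp add: J_def)
      have Suc: "dsq n d x g (Suc r) i = (if r = 0 \<or> sqd d (x i) (x q) < dsq n d x g r i then sqd d (x i) (x q) else dsq n d x g r i)"
        "dcl n d x g (Suc r) i = (if r = 0 \<or> sqd d (x i) (x q) < dsq n d x g r i then r else dcl n d x g r i)"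
        by (auto simp: Let_def q_def pick_def)
      show ?case
        by (rule wp_time[OF wp_If[where t = 3]])
          (use acc * D2 Suc \<open>i < n\<close> in \<open>auto simp: J_def less_Suc_eq simp del: dproc.simps
            intro!: wp_time[OF wp_RStore_Seq[where t = 1]] wp_NStore wp_NStore' wp_time[OF wp_SKIP]\<close>)
    qed (use b' in \<open>auto simp: base_def\<close>)
  next
    case (5 s')
    then show ?case by (intro Q) (auto simp: agree_def J_def)
  qed auto
  moreover have "nats s ''rep'' (nats s ''g'' r) = q"
    using s r g rep by (simp add: base_def q_def pick_def)
  ultimately show ?thesis unfolding pick_block_def
    using r by (intro wp_time[OF wp_NStore_Seq]) (auto simp: algebra_simps)
qed

lemma wp_dproc_block:
  assumes s: "base s" and zero: "\<And>i. i < n \<Longrightarrow> reals s ''D2'' i = 0 \<and> nats s ''cl'' i = 0"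
    and Q: "\<And>s'. agree {''r'', ''i'', ''b'', ''pos'', ''rep'', ''q'', ''h'', ''cl''} {''W'', ''acc'', ''D2''} s s' \<Longrightarrow>
      (\<forall>i<n. reals s' ''D2'' i = dsq n d x g T i \<and> nats s' ''cl'' i = dcl n d x g T i) \<Longrightarrow> Q s'"
  shows "wp (T * (n * (5 * d + 52) + 25) + 3) dproc_block Q s"
proof -
  let ?X = "{''r'', ''i'', ''b'', ''pos'', ''rep'', ''q'', ''h'', ''cl''}" and ?Y = "{''W'', ''acc'', ''D2''}"
  have "wp (T * ((38 * n + 15) + (n * (5 * d + 14) + 5) + 1 + 4) + 3) dproc_block Q s"
    unfolding dproc_block_def
  proof (rule wp_For[where I = "\<lambda>r s'. \<forall>i<n. reals s' ''D2'' i = dsq n d x g r i \<and> nats s' ''cl'' i = dcl n d x g r i"], goal_cases)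
    case (2 s')
    then show ?case using s by (simp add: agree_def base_def)
  next
    case 3
    then show ?case using zero by simp
  next
    case (4 r s')
    have "agree ?X ?Y s s'" using 4(2) by (auto simp: agree_def)
    then have b': "base s'" by (rule base_agree[OF s]) (auto simp: base_vars_def)
    show ?case
    proof (intro wp_Seq wp_rep_block[where w = "dsq n d x g r"], goal_cases)
      case (4 s'')
      have "base s''" using 4(2) by (rule base_agree[OF b']) (auto simp: base_vars_def)
      then show ?case
        by (rule wp_pick_block[where r = r])
          (use 4 \<open>r < T\<close> \<open>nats s' ''r'' 0 = r\<close> \<open>\<forall>i<n. _ i\<close> in \<open>auto simp: agree_def simp del: dproc.simps\<close>)
    qed (use b' 4 dsq_nonneg in \<open>auto simp: base_def\<close>)
  next
    case (5 s')
    then show ?case by (intro Q) (auto simp: agree_def)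
  qed auto
  then show ?thesis by (rule wp_time) (simp add: algebra_simps)
qed


definition weight :: "nat \<Rightarrow> real" where
  "weight = sens n (dsq n d x g T) (dcl n d x g T)"

lemma weight_nonneg: "i < n \<Longrightarrow> 0 \<le> weight i"
  unfolding weight_def by (intro sens_nonneg dsq_nonneg)

lemma wp_sens_block:
  assumes s: "base s" and D: "\<And>i. i < n \<Longrightarrow> reals s ''D2'' i = dsq n d x g T i \<and> nats s ''cl'' i = dcl n d x g T i"
    and zero: "\<And>t. nats s ''sz'' t = 0" "\<And>i. nats s ''cnt'' i = 0"
    and Q: "\<And>s'. agree {''i'', ''sz'', ''b'', ''pos'', ''rep'', ''u'', ''cnt''} {''W'', ''D2''} s s' \<Longrightarrow>
      (\<forall>u<3*n. nats s' ''rep'' u = rep n weight u) \<Longrightarrow> (\<forall>i<n. nats s' ''cnt'' i = rep_count n weight i) \<Longrightarrow> Q s'"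
  shows "wp (68 * n + 33) sens_block Q s"
proof -
  let ?D = "dsq n d x g T" and ?c = "dcl n d x g T"
  let ?ag = "agree {''i'', ''sz'', ''b'', ''pos'', ''rep'', ''u'', ''cnt''} {''W'', ''D2''} s"
  have rep_loop: "wp (3 * n * (1 + 4) + 3) count_loop Q s1"
    if s1: "?ag s1" "\<forall>u<3*n. nats s1 ''rep'' u = rep n weight u" "nats s1 ''cnt'' = nats s ''cnt''" for s1
  proof (rule wp_For[where I = "\<lambda>u s'. \<forall>i. nats s' ''cnt'' i = card {u'. u' < u \<and> rep n weight u' = i}"], goal_cases)
    case (2 s')
    then show ?case using s s1(1) by (simp add: agree_def base_def)
  next
    case 3
    then show ?case using zero s1 by simp
  next
    case (4 u s')
    have "nats s' ''rep'' u = rep n weight u" using 4(1,2) s1(2) by (simp add: agree_def)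
    moreover have "{u'. u' < Suc u \<and> rep n weight u' = i} =
      (if rep n weight u = i then insert u {u'. u' < u \<and> rep n weight u' = i} else {u'. u' < u \<and> rep n weight u' = i})" for i
      by (auto simp: less_Suc_eq)
    ultimately show ?case using 4 by (intro wp_NStore) auto
  next
    case (5 s')
    then show ?case using s1 by (intro Q) (auto simp: agree_def rep_count_def)
  qed auto
  have W_loop: "wp (n * (1 + 4) + 3) sens_loop
        (wp (38 * n + 15 + (3 * n * (1 + 4) + 3) + 1) (Seq rep_block count_loop)
           Q) s1"
    if s1: "?ag s1" "reals s1 ''W'' 0 = sum ?D {..<n}" "reals s1 ''D2'' = reals s ''D2''" "nats s1 ''cnt'' = nats s ''cnt''"
      "\<forall>t. nats s1 ''sz'' t = card {i. i < n \<and> ?c i = t}" for s1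
  proof (rule wp_For[where I = "\<lambda>i s'. \<forall>i'<n. reals s' ''D2'' i' = (if i' < i then weight i' else ?D i')"], goal_cases)
    case (2 s')
    then show ?case using s s1(1) by (simp add: agree_def base_def)
  next
    case 3
    then show ?case using D s1(3) by simp
  next
    case (4 i s')
    have "nats s' ''cl'' i = ?c i" "reals s' ''W'' 0 = sum ?D {..<n}"
      "nats s' ''sz'' (?c i) = card {i'. i' < n \<and> ?c i' = ?c i}" "reals s' ''D2'' i = ?D i"
      using 4 s1 D by (auto simp: agree_def)
    then show ?case using 4
      by (intro wp_RStore) (auto simp: less_Suc_eq weight_def sens_def)
  next
    case (5 s')
    have ag: "?ag s'" using 5(1) s1(1) by (auto simp: agree_def)
    then have b': "base s'" by (rule base_agree[OF s]) (auto simp: base_vars_def)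
    show ?case
    proof (intro wp_Seq wp_rep_block[where w = weight] rep_loop, goal_cases)
      case (4 s'')
      then show ?case using ag by (auto simp: agree_def)
    next
      case (6 s'')
      then show ?case using 5(1) s1(4) by (simp add: agree_def)
    qed (use b' 5(3) weight_nonneg in \<open>auto simp: base_def\<close>)
  qed auto
  let ?tail = "Seq sens_loop
      (Seq rep_block count_loop)"
  have sz_loop: "wp (n * (1 + 4) + 3) size_loop
     (wp (n * (1 + 4) + 3 + (38 * n + 15 + (3 * n * (1 + 4) + 3) + 1) + 1) ?tail Q) s1"
    if s1: "agree {''i''} {''W''} s s1" "reals s1 ''W'' 0 = sum (reals s ''D2'') {..<n}" for s1
  proof (rule wp_For[where I = "\<lambda>i s'. \<forall>t. nats s' ''sz'' t = card {i'. i' < i \<and> ?c i' = t}"], goal_cases)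
    case (2 s')
    then show ?case using s s1(1) by (simp add: agree_def base_def)
  next
    case 3
    then show ?case using zero(1) s1 by (simp add: agree_def)
  next
    case (4 i s')
    have "nats s' ''cl'' i = ?c i" using 4(1,2) s1 D by (simp add: agree_def)
    moreover have "{i'. i' < Suc i \<and> ?c i' = t} =
      (if ?c i = t then insert i {i'. i' < i \<and> ?c i' = t} else {i'. i' < i \<and> ?c i' = t})" for t
      by (auto simp: less_Suc_eq)
    ultimately show ?case using 4 by (intro wp_NStore) auto
  next
    case (5 s')
    have "sum (reals s ''D2'') {..<n} = sum ?D {..<n}" using D by simp
    then show ?case using 5 s1
      by (intro wp_Seq W_loop) (auto simp: agree_def)
  qed auto
  have "wp (5 * n + 5 + (n * (1 + 4) + 3 + (n * (1 + 4) + 3 + (38 * n + 15 + (3 * n * (1 + 4) + 3) + 1) + 1) + 1) + 1) sens_block Q s"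
    unfolding sens_block_def
    using s by (intro wp_Seq wp_sum_block sz_loop) (auto simp: base_def)
  then show ?thesis by (rule wp_time) simp
qed

lemma wp_sample_block:
  assumes s: "base s" and rep: "\<And>u. u < 3 * n \<Longrightarrow> nats s ''rep'' u = rep n weight u"
    and Q: "\<And>s'. agree {''p'', ''idx''} {} s s' \<Longrightarrow> (\<forall>p<m. nats s' ''idx'' p = rep n weight (h p)) \<Longrightarrow> Q s'"
  shows "wp (5 * m + 3) sample_block Q s"
proof -
  have "wp (m * (1 + 4) + 3) sample_block Q s"
    unfolding sample_block_def
  proof (rule wp_For[where I = "\<lambda>p s'. \<forall>p'<p. nats s' ''idx'' p' = rep n weight (h p')"], goal_cases)
    case (2 s')
    then show ?case using s by (simp add: agree_def base_def)
  next
    case (4 p s')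
    have "nats s' ''hs'' p = h p" "nats s' ''rep'' = nats s ''rep''"
      using 4(1,2) s by (auto simp: agree_def base_def)
    then show ?case using 4 rep[OF h[of p]] by (intro wp_NStore) (auto simp: less_Suc_eq)
  next
    case (5 s')
    then show ?case by (intro Q) (auto simp: agree_def)
  qed auto
  then show ?thesis by (rule wp_time) simp
qed

end


section \<open>Program fragments: evaluating a candidate, enumeration and output\<close>

definition digits_block :: com where
  "digits_block = Seq (NSet ''rm'' (NV ''e''))
     (For ''c'' (NV ''K'')
       (Seq (NSet ''qt'' (NConst 0))
       (Seq (While (BNot (NLess (NV ''rm'') (NV ''m'')))
              (Seq (NSet ''rm'' (NSub (NV ''rm'') (NV ''m''))) (NIncr ''qt'')))
       (Seq (NStore ''tau'' (NV ''c'') (NV ''rm'')) (NSet ''rm'' (NV ''qt''))))))"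

definition centers_block :: com where
  "centers_block = For ''j'' (NV ''k'') (For ''h'' (NV ''d'')
     (Seq (RSet ''acc'' (ROfNat (NConst 0)))
     (Seq (For ''a'' (NV ''l'') (RSet ''acc'' (RAdd (RV ''acc'')
             (RCell ''A'' (NAdd (NCell ''rd'' (NCell ''idx'' (NCell ''tau'' (NAdd (NCell ''rl'' (NV ''j'')) (NV ''a''))))) (NV ''h''))))))
       (RStore ''D'' (NAdd (NCell ''rd'' (NV ''j'')) (NV ''h'')) (RDiv (RV ''acc'') (FNV ''l''))))))"

definition near_block :: com where
  "near_block = For ''j'' (NV ''k'')
     (Seq (dist_block (NCell ''rd'' (NV ''q'')) ''D'' (NCell ''rd'' (NV ''j'')))
       (If (BNot (BAnd (NLess (NConst 0) (NV ''j'')) (BNot (RLess (RV ''acc'') (RV ''md'')))))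
         (Seq (RSet ''md'' (RV ''acc'')) (NSet ''mj'' (NV ''j'')))
         SKIP))"

definition cost_block :: com where
  "cost_block = Seq (RSet ''cost'' (ROfNat (NConst 0)))
     (For ''p'' (NV ''m'') (Seq (NSet ''q'' (NCell ''idx'' (NV ''p''))) (Seq near_block
       (RSet ''cost'' (RAdd (RV ''cost'') (RMul (RDiv (ROfNat (NConst 1)) (ROfNat (NCell ''cnt'' (NV ''q'')))) (RV ''md'')))))))"

definition enum_block :: com where
  "enum_block = For ''e'' (NV ''N'') (Seq digits_block (Seq centers_block (Seq cost_block
     (If (BNot (BAnd (NLess (NConst 0) (NV ''e'')) (BNot (RLess (RV ''cost'') (RV ''best'')))))
       (Seq (RSet ''best'' (RV ''cost'')) (NSet ''be'' (NV ''e'')))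
       SKIP))))"

abbreviation label_loop :: com where
  "label_loop \<equiv>
     For ''p'' (NV ''n'') (Seq (NSet ''q'' (NV ''p'')) (Seq near_block
       (RStore ''X'' (NAdd (NCell ''rk'' (NV ''p'')) (NV ''mj'')) (ROfNat (NConst 1)))))"

text \<open>Only the number of the best candidate survives the enumeration, so its centers are
  recomputed. The output array for the assignment is zero initially, and only its ones are
  written.\<close>

definition output_block :: com where
  "output_block = Seq (NSet ''e'' (NV ''be'')) (Seq digits_block (Seq centers_block
     label_loop))"

lemma written_blocks2 [simp]:
  "nwritten digits_block = {''rm'', ''c'', ''qt'', ''tau''}" "rwritten digits_block = {}"
  "nwritten centers_block = {''j'', ''h'', ''a''}" "rwritten centers_block = {''acc'', ''D''}"
  "nwritten near_block = {''j'', ''h'', ''mj''}" "rwritten near_block = {''acc'', ''md''}"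
  "nwritten cost_block = {''p'', ''q'', ''j'', ''h'', ''mj''}" "rwritten cost_block = {''acc'', ''md'', ''cost''}"
  "nwritten enum_block = {''e'', ''rm'', ''c'', ''qt'', ''tau'', ''j'', ''h'', ''a'', ''p'', ''q'', ''mj'', ''be''}"
  "rwritten enum_block = {''acc'', ''D'', ''md'', ''cost'', ''best''}"
  "nwritten output_block = {''e'', ''rm'', ''c'', ''qt'', ''tau'', ''j'', ''h'', ''a'', ''p'', ''q'', ''mj''}"
  "rwritten output_block = {''acc'', ''D'', ''md'', ''X''}"
  by (auto simp: digits_block_def centers_block_def near_block_def cost_block_def enum_block_def output_block_def)

lemma row_index_eq: "i < w \<Longrightarrow> i' < w \<Longrightarrow> j * w + i = j' * w + i' \<longleftrightarrow> j = j' \<and> i = i'" for i i' j j' w :: nat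
proof
  assume iw: "i < w" "i' < w" and eq: "j * w + i = j' * w + i'"
  have "(j * w + i) div w = j" "(j' * w + i') div w = j'"
    "(j * w + i) mod w = i" "(j' * w + i') mod w = i'" using iw by simp_all
  then show "j = j' \<and> i = i'" unfolding eq by simp
qed simp

context machine begin

text \<open>Division with remainder by repeated subtraction: the remainder drops by
  \<open>m \<ge> 1\<close> in each round, so \<open>E\<close> rounds suffice per digit. For
  \<open>E = m ^ K\<close> this causes the square of \<open>m ^ K\<close> in the running
  time.\<close>

lemma wp_digits_block:
  assumes s: "base s" and e: "nats s ''e'' 0 = e" "e \<le> E"
    and Q: "\<And>s'. agree {''rm'', ''c'', ''qt'', ''tau''} {} s s' \<Longrightarrow>
      (\<forall>b<K. nats s' ''tau'' b = digit m e b) \<Longrightarrow> Q s'"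
  shows "wp (K * (5 * E + 11) + 5) digits_block Q s"
proof -
  let ?ag = "agree {''rm'', ''c'', ''qt'', ''tau''} {}"
  let ?s = "nats_upd ''rm'' 0 e s"
  have "wp (K * ((E * (3 + 2) + 1 + 2 + 1 + 1 + 2) + 4) + 3) (For ''c'' (NV ''K'')
       (Seq (NSet ''qt'' (NConst 0))
       (Seq (While (BNot (NLess (NV ''rm'') (NV ''m'')))
              (Seq (NSet ''rm'' (NSub (NV ''rm'') (NV ''m''))) (NIncr ''qt'')))
       (Seq (NStore ''tau'' (NV ''c'') (NV ''rm'')) (NSet ''rm'' (NV ''qt'')))))) Q ?s"
  proof (rule wp_For[where I = "\<lambda>c s'. nats s' ''rm'' 0 = e div m ^ c \<and> (\<forall>b<c. nats s' ''tau'' b = digit m e b)"], goal_cases)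
    case (2 s')
    then show ?case using s by (simp add: agree_def base_def)
  next
    case (4 c s')
    have "?ag s s'" using 4(2) by (auto simp: agree_def)
    then have b': "base s'" by (rule base_agree[OF s]) (auto simp: base_vars_def)
    define r where "r = e div m ^ c"
    have r: "r \<le> E" unfolding r_def using e(2) div_le_dividend order_trans by blast
    let ?Q = "\<lambda>s'. nats (nats_upd ''c'' 0 (Suc c) s') ''rm'' 0 = e div m ^ Suc c \<and>
      (\<forall>b<Suc c. nats (nats_upd ''c'' 0 (Suc c) s') ''tau'' b = digit m e b)"
    have "wp (E * (3 + 2) + 1) (While (BNot (NLess (NV ''rm'') (NV ''m'')))
              (Seq (NSet ''rm'' (NSub (NV ''rm'') (NV ''m''))) (NIncr ''qt'')))
        (wp (1 + 2) (Seq (NStore ''tau'' (NV ''c'') (NV ''rm'')) (NSet ''rm'' (NV ''qt''))) ?Q) (nats_upd ''qt'' 0 0 s')"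
    proof (rule wp_While[where I = "\<lambda>s''. r = nats s'' ''qt'' 0 * m + nats s'' ''rm'' 0" and \<mu> = "\<lambda>s''. nats s'' ''rm'' 0"], goal_cases)
      case 1
      then show ?case using 4(4) by (simp add: r_def)
    next
      case (2 s'')
      have "nats s'' ''m'' 0 = m" using 2(1) b' by (auto simp: agree_def base_def)
      then have "m \<le> nats s'' ''rm'' 0" using 2(3) by simp
      then show ?case using 2(2) m \<open>nats s'' ''m'' 0 = m\<close>
        by (intro wp_time[OF wp_NStore_Seq[where t = 1]] wp_NStore) simp_all
    next
      case (3 s'')
      have c: "nats s'' ''c'' 0 = c" "nats s'' ''m'' 0 = m" "nats s'' ''tau'' = nats s' ''tau''"
        using 3(1) 4(3) b' by (auto simp: agree_def base_def)
      have "nats s'' ''rm'' 0 < m" using 3(3) c by simp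
      then have "nats s'' ''qt'' 0 = r div m" "nats s'' ''rm'' 0 = r mod m"
        unfolding 3(2) by simp_all
      moreover have "r div m = e div m ^ Suc c"
        unfolding r_def by (simp add: div_mult2_eq[symmetric] mult.commute)
      ultimately show ?case using 4(4) c
        by (intro wp_NStore_Seq wp_NStore) (auto simp: digit_def r_def less_Suc_eq)
    qed (use 4(4) r in \<open>auto simp: r_def\<close>)
    then have "wp (E * (3 + 2) + 1 + (1 + 2) + 1 + 2) (Seq (NSet ''qt'' (NConst 0))
       (Seq (While (BNot (NLess (NV ''rm'') (NV ''m'')))
              (Seq (NSet ''rm'' (NSub (NV ''rm'') (NV ''m''))) (NIncr ''qt'')))
       (Seq (NStore ''tau'' (NV ''c'') (NV ''rm'')) (NSet ''rm'' (NV ''qt''))))) ?Q s'"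
      by (intro wp_NStore_Seq wp_Seq) simp
    then show ?case by (rule wp_time) simp
  next
    case (5 s')
    then show ?case by (intro Q) (auto simp: agree_def)
  qed auto
  then show ?thesis unfolding digits_block_def
    using e by (intro wp_time[OF wp_NStore_Seq]) (auto simp: algebra_simps)
qed

definition centers where "centers = sample_centers x (\<lambda>p. rep n weight (h p)) l"

definition sampled :: "state \<Rightarrow> bool" where
  "sampled s \<longleftrightarrow> (\<forall>p<m. nats s ''idx'' p = rep n weight (h p)) \<and>
     (\<forall>i<n. nats s ''cnt'' i = rep_count n weight i)"

lemma digit_less: "digit m e b < m"
  using m by (simp add: digit_def)

lemma offset_less: "j < k \<Longrightarrow> a < l \<Longrightarrow> j * l + a < K"
proof -
  assume "j < k" "a < l"
  then have "j * l + a < (j + 1) * l" by simp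
  also have "\<dots> \<le> K" unfolding K using \<open>j < k\<close> by (intro mult_right_mono) auto
  finally show ?thesis .
qed

definition stored :: "nat \<Rightarrow> state \<Rightarrow> bool" where
  "stored e s \<longleftrightarrow> (\<forall>j<k. \<forall>i<d. reals s ''D'' (j * d + i) = centers (digit m e) j i)"

lemma wp_centers_block:
  assumes s: "base s" "sampled s" and tau: "\<And>b. b < K \<Longrightarrow> nats s ''tau'' b = digit m e b"
    and Q: "\<And>s'. agree {''j'', ''h'', ''a''} {''acc'', ''D''} s s' \<Longrightarrow> stored e s' \<Longrightarrow> Q s'"
  shows "wp (k * (d * (5 * l + 11) + 7) + 3) centers_block Q s"
proof -
  let ?ag = "agree {''j'', ''h'', ''a''} {''acc'', ''D''}"
  let ?acc = "For ''a'' (NV ''l'') (RSet ''acc'' (RAdd (RV ''acc'')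
             (RCell ''A'' (NAdd (NCell ''rd'' (NCell ''idx'' (NCell ''tau'' (NAdd (NCell ''rl'' (NV ''j'')) (NV ''a''))))) (NV ''h'')))))"
  let ?st = "RStore ''D'' (NAdd (NCell ''rd'' (NV ''j'')) (NV ''h'')) (RDiv (RV ''acc'') (FNV ''l''))"
  let ?C = "centers (digit m e)"
  have inner: "wp (l * (1 + 4) + 3 + 1 + 1 + 2) (Seq (RSet ''acc'' (ROfNat (NConst 0))) (Seq ?acc ?st)) P s1"
    if s1: "?ag s s1" "nats s1 ''j'' 0 = j" "j < k" "nats s1 ''h'' 0 = i" "i < d"
      and P: "\<And>s'. agree {''a''} {''acc'', ''D''} s1 s' \<Longrightarrow> reals s' ''D'' = (reals s1 ''D'')(j * d + i := ?C j i) \<Longrightarrow> P s'"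
    for s1 j i P
  proof -
    have loop: "wp (l * (1 + 4) + 3) ?acc (wp 1 ?st P) (reals_upd ''acc'' 0 0 s1)"
    proof (rule wp_For[where I = "\<lambda>a s'. reals s' ''acc'' 0 = (\<Sum>a'<a. x (rep n weight (h (digit m e (j * l + a')))) i)"], goal_cases)
      case (2 s')
      then show ?case using s(1) s1(1) by (simp add: agree_def base_def)
    next
      case (4 a s')
      have "?ag s s'" using 4(2) s1(1) by (auto simp: agree_def)
      then have b': "base s'" by (rule base_agree[OF s(1)]) (auto simp: base_vars_def)
      let ?p = "digit m e (j * l + a)"
      have "nats s' ''rl'' j = j * l" using b' s1(3) by (simp add: base_def)
      moreover have "nats s' ''tau'' (j * l + a) = ?p"
        using \<open>?ag s s'\<close> tau[OF offset_less[OF s1(3) 4(1)]] by (simp add: agree_def)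
      moreover have "nats s' ''idx'' ?p = rep n weight (h ?p)"
        using \<open>?ag s s'\<close> s(2) digit_less by (simp add: agree_def sampled_def)
      moreover have "nats s' ''rd'' (rep n weight (h ?p)) = rep n weight (h ?p) * d"
        "reals s' ''A'' (rep n weight (h ?p) * d + i) = x (rep n weight (h ?p)) i"
        using b' rep_less[OF n, of weight "h ?p"] s1(5) by (auto simp: base_def)
      moreover have "nats s' ''j'' 0 = j" "nats s' ''h'' 0 = i" using 4(2) s1 by (auto simp: agree_def)
      ultimately show ?case using 4 by (intro wp_RStore) simp
    next
      case (5 s')
      have "?ag s s'" using 5(1) s1(1) by (auto simp: agree_def)
      then have b': "base s'" by (rule base_agree[OF s(1)]) (auto simp: base_vars_def)
      \<comment> \<open>The table of row offsets of the input also serves the rows of the centers,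
        because \<open>k \<le> n\<close>.\<close>
      have "nats s' ''rd'' j = j * d" "nats s' ''l'' 0 = l" using b' s1(3) kn by (auto simp: base_def)
      moreover have "nats s' ''j'' 0 = j" "nats s' ''h'' 0 = i" using 5(1) s1 by (auto simp: agree_def)
      ultimately show ?case using 5
        by (intro wp_RStore P) (auto simp: agree_def centers_def sample_centers_def)
    qed auto
    then have "wp (l * (1 + 4) + 3 + 1 + 1 + 2) (Seq (RSet ''acc'' (ROfNat (NConst 0))) (Seq ?acc ?st)) P s1"
      by (intro wp_RStore_Seq wp_Seq) simp
    then show ?thesis .
  qed
  have "wp (k * (d * ((l * (1 + 4) + 3 + 1 + 1 + 2) + 4) + 3 + 4) + 3) centers_block Q s"
    unfolding centers_block_def
  proof (rule wp_For[where I = "\<lambda>j s'. \<forall>j'<j. \<forall>i<d. reals s' ''D'' (j' * d + i) = ?C j' i"], goal_cases)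
    case (2 s')
    then show ?case using s by (simp add: agree_def base_def)
  next
    case (4 j s1)
    have ag1: "?ag s s1" using 4(2) by (auto simp: agree_def)
    then have b1: "base s1" by (rule base_agree[OF s(1)]) (auto simp: base_vars_def)
    show ?case
    proof (rule wp_For[where I = "\<lambda>i s'. (\<forall>j'<j. \<forall>i<d. reals s' ''D'' (j' * d + i) = ?C j' i) \<and>
         (\<forall>i'<i. reals s' ''D'' (j * d + i') = ?C j i')"], goal_cases)
      case (2 s')
      then show ?case using b1 by (simp add: agree_def base_def)
    next
      case (3)
      then show ?case using 4 by simp
    next
      case prems: (4 i s2)
      have "?ag s s2" using prems(2) ag1 by (auto simp: agree_def)
      moreover have "nats s2 ''j'' 0 = j" using prems(2) 4 by (simp add: agree_def)
      ultimately show ?case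
      proof (rule inner[OF _ _ 4(1) prems(3,1)], goal_cases)
        case (1 s')
        have "j' * d + i' = j * d + i \<longleftrightarrow> j' = j \<and> i' = i" if "i' < d" for i' j'
          using row_index_eq that prems(1) by simp
        then show ?case using 1 prems by (auto simp: less_Suc_eq)
      qed
    next
      case (5 s')
      then show ?case by (auto simp: less_Suc_eq)
    qed auto
  next
    case (5 s')
    then show ?case by (intro Q) (auto simp: agree_def stored_def)
  qed auto
  then show ?thesis by (rule wp_time) (simp add: algebra_simps)
qed

lemma wp_near_block:
  assumes s: "base s" "stored e s" and q: "nats s ''q'' 0 = q" "q < n"
    and Q: "\<And>s' j. agree {''j'', ''h'', ''mj''} {''acc'', ''md''} s s' \<Longrightarrow> nats s' ''mj'' 0 = j \<Longrightarrow> j < k \<Longrightarrow>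
       reals s' ''md'' 0 = near d k (centers (digit m e)) (x q) \<Longrightarrow>
       near d k (centers (digit m e)) (x q) = sqd d (x q) (centers (digit m e) j) \<Longrightarrow> Q s'"
  shows "wp (k * (5 * d + 14) + 3) near_block Q s"
proof -
  let ?ag = "agree {''j'', ''h'', ''mj''} {''acc'', ''md''}"
  let ?C = "centers (digit m e)"
  have "wp (k * ((5 * d + 5) + (3 + 1) + 1 + 4) + 3) near_block Q s"
    unfolding near_block_def
  proof (rule wp_For[where I = "\<lambda>j s'. j = 0 \<or> (nats s' ''mj'' 0 < j \<and> reals s' ''md'' 0 = sqd d (x q) (?C (nats s' ''mj'' 0)) \<and>
        (\<forall>j'<j. reals s' ''md'' 0 \<le> sqd d (x q) (?C j')))"], goal_cases)
    case (2 s')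
    then show ?case using s by (simp add: agree_def base_def)
  next
    case (4 j s1)
    have ag1: "?ag s s1" using 4(2) by (auto simp: agree_def)
    then have b1: "base s1" by (rule base_agree[OF s(1)]) (auto simp: base_vars_def)
    have q1: "nats s1 ''q'' 0 = q" using ag1 q by (simp add: agree_def)
    have D1: "sqd d v (\<lambda>i. reals s1 ''D'' (j * d + i)) = sqd d v (?C j)" for v
      using ag1 s(2) 4(1) by (auto intro!: sqd_cong simp: agree_def stored_def)
    show ?case
    proof (intro wp_Seq wp_dist_block[where d = d and ?o1.0 = "q * d" and ?o2.0 = "j * d"], goal_cases)
      case (3 s')
      then show ?case using b1 q1 q(2) 4(1,3) kn by (auto simp: agree_def base_def)
    next
      case prems: (4 s')
      have acc: "reals s' ''acc'' 0 = sqd d (x q) (?C j)"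
        using prems(1) base_A(1)[OF b1 q(2)] D1 by simp
      have *: "nats s' ''j'' 0 = j" "nats s' ''mj'' = nats s1 ''mj''" "reals s' ''md'' = reals s1 ''md''"
        using prems(2) 4(3) by (auto simp: agree_def)
      show ?case
        by (rule wp_time[OF wp_If[where t = 3]])
          (use acc * 4(4) in \<open>auto simp: less_Suc_eq not_less intro!: wp_time[OF wp_RStore_Seq[where t = 1]] wp_NStore wp_NStore' wp_time[OF wp_SKIP]
             intro: order_trans less_imp_le\<close>)
    qed (use b1 in \<open>auto simp: base_def\<close>)
  next
    case (5 s')
    then have mj: "nats s' ''mj'' 0 < k" "reals s' ''md'' 0 = sqd d (x q) (?C (nats s' ''mj'' 0))"
      "\<forall>j'<k. reals s' ''md'' 0 \<le> sqd d (x q) (?C j')" using k by auto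
    have "near d k ?C (x q) = sqd d (x q) (?C (nats s' ''mj'' 0))"
      unfolding near_def using mj by (intro Min_eqI) auto
    then show ?case using mj 5(1) by (intro Q) (auto simp: agree_def)
  qed auto
  then show ?thesis by (rule wp_time) (simp add: algebra_simps)
qed

end


section \<open>Composition of the deterministic phase\<close>

definition main_block :: com where
  "main_block = Seq dproc_block (Seq sens_block (Seq sample_block (Seq enum_block output_block)))"

context machine begin

lemma stored_agree: "stored e s \<Longrightarrow> agree X Y s s' \<Longrightarrow> ''D'' \<notin> Y \<Longrightarrow> stored e s'"
  by (simp add: stored_def agree_def)

lemma sampled_agree: "sampled s \<Longrightarrow> agree X Y s s' \<Longrightarrow> ''idx'' \<notin> X \<Longrightarrow> ''cnt'' \<notin> X \<Longrightarrow> sampled s'"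
  by (simp add: sampled_def agree_def)

text \<open>The objective minimised by the machine; with \<open>weight\<close> unfolded it is the
  \<open>SC\<close> of \<open>sampling_success\<close>.\<close>

definition SC :: "nat \<Rightarrow> real" where
  "SC e = sample_cost d k m x (\<lambda>p. rep n weight (h p)) (\<lambda>i. 1 / real (rep_count n weight i)) (centers (digit m e))"

lemma wp_cost_block:
  assumes s: "base s" "sampled s" "stored e s"
    and Q: "\<And>s'. agree {''p'', ''q'', ''j'', ''h'', ''mj''} {''acc'', ''md'', ''cost''} s s' \<Longrightarrow>
       reals s' ''cost'' 0 = SC e \<Longrightarrow> Q s'"
  shows "wp (m * (k * (5 * d + 14) + 11) + 5) cost_block Q s"
proof -
  let ?ag = "agree {''p'', ''q'', ''j'', ''h'', ''mj''} {''acc'', ''md'', ''cost''}"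
  let ?C = "centers (digit m e)" and ?i = "\<lambda>p. rep n weight (h p)"
  let ?cost = "\<lambda>p. 1 / real (rep_count n weight (?i p)) * near d k ?C (x (?i p))"
  let ?s = "reals_upd ''cost'' 0 0 s"
  have "wp (m * ((k * (5 * d + 14) + 3) + 1 + 1 + 2 + 4) + 3)
     (For ''p'' (NV ''m'') (Seq (NSet ''q'' (NCell ''idx'' (NV ''p''))) (Seq near_block
       (RSet ''cost'' (RAdd (RV ''cost'') (RMul (RDiv (ROfNat (NConst 1)) (ROfNat (NCell ''cnt'' (NV ''q'')))) (RV ''md'')))))))
     Q ?s"
  proof (rule wp_For[where I = "\<lambda>p s'. reals s' ''cost'' 0 = (\<Sum>p'<p. ?cost p')"], goal_cases)
    case (2 s')
    then show ?case using s by (simp add: agree_def base_def)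
  next
    case (4 p s1)
    let ?s1 = "nats_upd ''q'' 0 (?i p) s1"
    have ag: "?ag s ?s1" "?ag s s1" using 4(2) by (auto simp: agree_def)
    have st: "base ?s1" "sampled ?s1" "stored e ?s1" "sampled s1"
      using base_agree[OF s(1) ag(1)] sampled_agree[OF s(2) ag(1)] stored_agree[OF s(3) ag(1)]
        sampled_agree[OF s(2) ag(2)] by (auto simp: base_vars_def)
    have idx: "nats s1 ''idx'' p = ?i p" using st(4) 4(1) by (simp add: sampled_def)
    have "wp (k * (5 * d + 14) + 3 + 1 + 1) (Seq near_block
       (RSet ''cost'' (RAdd (RV ''cost'') (RMul (RDiv (ROfNat (NConst 1)) (ROfNat (NCell ''cnt'' (NV ''q'')))) (RV ''md'')))))
       (\<lambda>s'. reals (nats_upd ''p'' 0 (Suc p) s') ''cost'' 0 = (\<Sum>p'<Suc p. ?cost p')) ?s1"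
    proof (intro wp_Seq wp_near_block[where e = e and q = "?i p"], goal_cases)
      case (5 s' j)
      have "nats s' ''cnt'' (?i p) = rep_count n weight (?i p)" "nats s' ''q'' 0 = ?i p"
        "reals s' ''cost'' = reals s1 ''cost''"
        using 5(1) st(2) rep_less[OF n, of weight "h p"] by (auto simp: agree_def sampled_def)
      then show ?case using 5(4) 4(4) by (intro wp_RStore) simp
    qed (use st rep_less[OF n, of weight "h p"] in auto)
    then show ?case using idx 4(3) by (intro wp_NStore_Seq) simp
  next
    case (5 s')
    then show ?case by (intro Q) (auto simp: agree_def SC_def sample_cost_def)
  qed auto
  then show ?thesis unfolding cost_block_def
    by (intro wp_time[OF wp_RStore_Seq]) (auto simp: algebra_simps)
qed

definition enum_time :: nat where
  "enum_time = (K * (5 * m ^ K + 11) + 5) + (k * (d * (5 * l + 11) + 7) + 3) + (m * (k * (5 * d + 14) + 11) + 5)"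

lemma wp_enum_block:
  assumes s: "base s" "sampled s"
    and Q: "\<And>s' e. agree {''e'', ''rm'', ''c'', ''qt'', ''tau'', ''j'', ''h'', ''a'', ''p'', ''q'', ''mj'', ''be''}
       {''acc'', ''D'', ''md'', ''cost'', ''best''} s s' \<Longrightarrow> nats s' ''be'' 0 = e \<Longrightarrow> e < m ^ K \<Longrightarrow>
       (\<forall>e'<m^K. SC e \<le> SC e') \<Longrightarrow> Q s'"
  shows "wp (m ^ K * (enum_time + 11) + 3) enum_block Q s"
proof -
  let ?ag = "agree {''e'', ''rm'', ''c'', ''qt'', ''tau'', ''j'', ''h'', ''a'', ''p'', ''q'', ''mj'', ''be''}
       {''acc'', ''D'', ''md'', ''cost'', ''best''}"
  have "wp (m ^ K * (((K * (5 * m ^ K + 11) + 5) + ((k * (d * (5 * l + 11) + 7) + 3) + ((m * (k * (5 * d + 14) + 11) + 5)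
       + (3 + 1) + 1) + 1) + 1) + 4) + 3) enum_block Q s"
    unfolding enum_block_def
  proof (rule wp_For[where I = "\<lambda>e s'. e = 0 \<or> (nats s' ''be'' 0 < e \<and> reals s' ''best'' 0 = SC (nats s' ''be'' 0) \<and>
      (\<forall>e'<e. reals s' ''best'' 0 \<le> SC e'))"], goal_cases)
    case (2 s')
    then show ?case using s by (simp add: agree_def base_def)
  next
    case (4 e s1)
    have ag1: "?ag s s1" using 4(2) by (auto simp: agree_def)
    have b1: "base s1" "sampled s1"
      using base_agree[OF s(1) ag1] sampled_agree[OF s(2) ag1] by (auto simp: base_vars_def)
    show ?case
    proof (intro wp_Seq wp_digits_block[where e = e and E = "m ^ K"] wp_centers_block[where e = e]
          wp_cost_block[where e = e], goal_cases)
      case prems: (4 s2)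
      show ?case by (rule base_agree[OF b1(1) prems(1)]) (auto simp: base_vars_def)
    next
      case prems: (5 s2)
      show ?case by (rule sampled_agree[OF b1(2) prems(1)]) auto
    next
      case prems: (7 s2 s3)
      have "base s2" by (rule base_agree[OF b1(1) prems(1)]) (auto simp: base_vars_def)
      then show ?case by (rule base_agree[OF _ prems(3)]) (auto simp: base_vars_def)
    next
      case prems: (8 s2 s3)
      have "sampled s2" by (rule sampled_agree[OF b1(2) prems(1)]) auto
      then show ?case by (rule sampled_agree[OF _ prems(3)]) auto
    next
      case prems: (10 s2 s3 s4)
      have *: "nats s4 ''e'' 0 = e" "nats s4 ''be'' = nats s1 ''be''" "reals s4 ''best'' = reals s1 ''best''"
        using prems(1,3,5) 4(3) by (auto simp: agree_def)
      show ?case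
        by (rule wp_time[OF wp_If[where t = 3]])
          (use prems(6) * 4(4) in \<open>auto simp: less_Suc_eq not_less intro!: wp_time[OF wp_RStore_Seq[where t = 1]] wp_NStore wp_NStore' wp_time[OF wp_SKIP]
             intro: order_trans less_imp_le\<close>)
    qed (use b1 4 in \<open>auto simp: base_def\<close>)
  next
    case (5 s')
    then have best: "nats s' ''be'' 0 < m ^ K" "\<forall>e'<m^K. SC (nats s' ''be'' 0) \<le> SC e'"
      using m by auto
    show ?case by (rule Q[OF _ refl best]) (use 5(1) in \<open>auto simp: agree_def\<close>)
  qed auto
  then show ?thesis by (rule wp_time) (simp add: enum_time_def algebra_simps)
qed

definition written_output :: "nat \<Rightarrow> state \<Rightarrow> bool" where
  "written_output e s \<longleftrightarrow> stored e s \<and>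
    (\<forall>i<n. \<exists>j<k. near d k (centers (digit m e)) (x i) = sqd d (x i) (centers (digit m e) j) \<and>
       (\<forall>j'<k. reals s ''X'' (i * k + j') = (if j' = j then 1 else 0)))"

lemma wp_output_block:
  assumes s: "base s" "sampled s" and e: "nats s ''be'' 0 = e" "e < m ^ K"
    and zero: "\<And>i. reals s ''X'' i = 0"
    and Q: "\<And>s'. written_output e s' \<Longrightarrow> Q s'"
  shows "wp (enum_time + n * (k * (5 * d + 14) + 11) + 8) output_block Q s"
proof -
  let ?ag = "agree {''e'', ''rm'', ''c'', ''qt'', ''tau'', ''j'', ''h'', ''a'', ''p'', ''q'', ''mj''}
       {''acc'', ''D'', ''md'', ''X''}"
  let ?C = "centers (digit m e)"
  let ?ok = "\<lambda>i s'. \<exists>j<k. near d k ?C (x i) = sqd d (x i) (?C j) \<and>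
       (\<forall>j'<k. reals s' ''X'' (i * k + j') = (if j' = j then 1 else 0))"
  let ?s = "nats_upd ''e'' 0 e s"
  have ag: "?ag s ?s" by (auto simp: agree_def)
  have st: "base ?s" "sampled ?s" using base_agree[OF s(1) ag] sampled_agree[OF s(2) ag] by (auto simp: base_vars_def)
  have loop: "wp (n * ((k * (5 * d + 14) + 3) + 1 + 1 + 2 + 4) + 3)
     label_loop Q s1"
    if s1: "?ag s s1" "stored e s1" "reals s1 ''X'' = reals s ''X''" for s1
  proof -
    have b1: "base s1" by (rule base_agree[OF s(1) s1(1)]) (auto simp: base_vars_def)
    show ?thesis
    proof (rule wp_For[where I = "\<lambda>p s'. (\<forall>i<p. ?ok i s') \<and> (\<forall>i<n. p \<le> i \<longrightarrow> (\<forall>j<k. reals s' ''X'' (i * k + j) = 0))"], goal_cases)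
      case (2 s')
      then show ?case using b1 by (simp add: agree_def base_def)
    next
      case 3
      then show ?case using s1(3) zero by simp
    next
      case (4 p s2)
      let ?s2 = "nats_upd ''q'' 0 p s2"
      have ag2: "agree {''p'', ''q'', ''j'', ''h'', ''mj''} {''acc'', ''md'', ''X''} s1 ?s2" using 4(2) by (auto simp: agree_def)
      have b2: "base ?s2" "stored e ?s2"
        using base_agree[OF b1 ag2] stored_agree[OF s1(2) ag2] by (auto simp: base_vars_def)
      have "wp (k * (5 * d + 14) + 3 + 1 + 1) (Seq near_block (RStore ''X'' (NAdd (NCell ''rk'' (NV ''p'')) (NV ''mj'')) (ROfNat (NConst 1))))
         (\<lambda>s'. (\<forall>i<Suc p. ?ok i (nats_upd ''p'' 0 (Suc p) s')) \<and>
            (\<forall>i<n. Suc p \<le> i \<longrightarrow> (\<forall>j<k. reals (nats_upd ''p'' 0 (Suc p) s') ''X'' (i * k + j) = 0))) ?s2"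
      proof (intro wp_Seq wp_near_block[where e = e and q = p], goal_cases)
        case (5 s' j)
        have *: "nats s' ''p'' 0 = p" "nats s' ''rk'' p = p * k" "reals s' ''X'' = reals s2 ''X''"
          using 5(1) 4(1,3) b2(1) by (auto simp: agree_def base_def)
        let ?X = "(reals s2 ''X'')(p * k + j := 1)"
        have cell: "?X (i * k + j') = (if i = p \<and> j' = j then 1 else reals s2 ''X'' (i * k + j'))" if "j' < k" for i j'
          using row_index_eq[OF that 5(3), of i p] by auto
        have ok: "\<exists>j<k. near d k ?C (x i) = sqd d (x i) (?C j) \<and> (\<forall>j'<k. ?X (i * k + j') = (if j' = j then 1 else 0))"
          if i: "i < Suc p" for i
        proof (cases "i = p")
          case True
          then show ?thesis using 5(3,5) 4(1,4) cell by (intro exI[of _ j]) auto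
        next
          case False
          then obtain j0 where "j0 < k" "near d k ?C (x i) = sqd d (x i) (?C j0)"
            "\<forall>j'<k. reals s2 ''X'' (i * k + j') = (if j' = j0 then 1 else 0)" using 4(4) i by (meson less_SucE)
          then show ?thesis using False cell by (intro exI[of _ j0]) auto
        qed
        have rest: "?X (i * k + j') = 0" if "i < n" "Suc p \<le> i" "j' < k" for i j'
          using cell[OF that(3), of i] that 4(4) by simp
        show ?case using * 5(2) ok rest by (intro wp_RStore) simp
      qed (use b2 4(1) in auto)
      then show ?case using 4(3) by (intro wp_NStore_Seq) simp
    next
      case (5 s')
      have "stored e s'" by (rule stored_agree[OF s1(2) 5(1)]) auto
      then show ?case using 5 by (intro Q) (auto simp: written_output_def)
    qed auto
  qed
  have "wp ((K * (5 * m ^ K + 11) + 5) + ((k * (d * (5 * l + 11) + 7) + 3) + (n * ((k * (5 * d + 14) + 3) + 1 + 1 + 2 + 4) + 3) + 1) + 1)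
     (Seq digits_block (Seq centers_block label_loop)) Q ?s"
  proof (intro wp_Seq wp_digits_block[where e = e and E = "m ^ K"] wp_centers_block[where e = e] loop, goal_cases)
    case prems: (4 s2)
    show ?case by (rule base_agree[OF st(1) prems(1)]) (auto simp: base_vars_def)
  next
    case prems: (5 s2)
    show ?case by (rule sampled_agree[OF st(2) prems(1)]) auto
  next
    case (7 s2 s3)
    then show ?case by (auto simp: agree_def)
  next
    case (9 s2 s3)
    then show ?case by (simp add: agree_def)
  qed (use st e in auto)
  then show ?thesis unfolding output_block_def
    using e by (intro wp_time[OF wp_NStore_Seq]) (auto simp: enum_time_def algebra_simps)
qed

text \<open>The bracketing mirrors that of the program, so that \<open>wp_Seq\<close> produces these
  sums literally.\<close>

definition main_time :: nat where
  "main_time = (T * (n * (5 * d + 52) + 25) + 3) + ((68 * n + 33) + ((5 * m + 3) +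
     ((m ^ K * (enum_time + 11) + 3) + (enum_time + n * (k * (5 * d + 14) + 11) + 8) + 1) + 1) + 1) + 1"

lemma wp_main_block:
  assumes s: "base s"
    and zero: "reals s ''D2'' = (\<lambda>_. 0)" "reals s ''X'' = (\<lambda>_. 0)" "nats s ''cl'' = (\<lambda>_. 0)"
      "nats s ''sz'' = (\<lambda>_. 0)" "nats s ''cnt'' = (\<lambda>_. 0)"
    and Q: "\<And>s' e. e < m ^ K \<Longrightarrow> (\<forall>e'<m^K. SC e \<le> SC e') \<Longrightarrow> written_output e s' \<Longrightarrow> Q s'"
  shows "wp main_time main_block Q s"
  unfolding main_block_def main_time_def
proof (intro wp_Seq wp_dproc_block[OF s])
  fix s1 assume ag1: "agree {''r'', ''i'', ''b'', ''pos'', ''rep'', ''q'', ''h'', ''cl''} {''W'', ''acc'', ''D2''} s s1"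
    and D: "\<forall>i<n. reals s1 ''D2'' i = dsq n d x g T i \<and> nats s1 ''cl'' i = dcl n d x g T i"
  have b1: "base s1" by (rule base_agree[OF s ag1]) (auto simp: base_vars_def)
  have z1: "reals s1 ''X'' = (\<lambda>_. 0)" "nats s1 ''sz'' = (\<lambda>_. 0)" "nats s1 ''cnt'' = (\<lambda>_. 0)"
    using ag1 zero by (auto simp: agree_def)
  show "wp (68 * n + 33) sens_block (wp (5 * m + 3 + (m ^ K * (enum_time + 11) + 3 + (enum_time + n * (k * (5 * d + 14) + 11) + 8) + 1) + 1)
     (Seq sample_block (Seq enum_block output_block)) Q) s1"
  proof (rule wp_sens_block[OF b1])
    fix s2 assume ag2: "agree {''i'', ''sz'', ''b'', ''pos'', ''rep'', ''u'', ''cnt''} {''W'', ''D2''} s1 s2"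
      and rep: "\<forall>u<3 * n. nats s2 ''rep'' u = rep n weight u" and cnt: "\<forall>i<n. nats s2 ''cnt'' i = rep_count n weight i"
    have b2: "base s2" by (rule base_agree[OF b1 ag2]) (auto simp: base_vars_def)
    have "wp (5 * m + 3) sample_block (wp (m ^ K * (enum_time + 11) + 3 + (enum_time + n * (k * (5 * d + 14) + 11) + 8) + 1)
      (Seq enum_block output_block) Q) s2"
    proof (rule wp_sample_block[OF b2])
      fix s3 assume ag3: "agree {''p'', ''idx''} {} s2 s3" and idx: "\<forall>p<m. nats s3 ''idx'' p = rep n weight (h p)"
      have b3: "base s3" by (rule base_agree[OF b2 ag3]) (auto simp: base_vars_def)
      have sm3: "sampled s3" using idx cnt ag3 by (auto simp: sampled_def agree_def)
      have z3: "reals s3 ''X'' = (\<lambda>_. 0)" using z1 ag2 ag3 by (auto simp: agree_def)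
      show "wp (m ^ K * (enum_time + 11) + 3 + (enum_time + n * (k * (5 * d + 14) + 11) + 8) + 1) (Seq enum_block output_block) Q s3"
      proof (intro wp_Seq wp_enum_block[OF b3 sm3])
        fix s4 e assume ag4: "agree {''e'', ''rm'', ''c'', ''qt'', ''tau'', ''j'', ''h'', ''a'', ''p'', ''q'', ''mj'', ''be''}
            {''acc'', ''D'', ''md'', ''cost'', ''best''} s3 s4"
          and e: "nats s4 ''be'' 0 = e" "e < m ^ K" "\<forall>e'<m ^ K. SC e \<le> SC e'"
        have "base s4" by (rule base_agree[OF b3 ag4]) (auto simp: base_vars_def)
        moreover have "sampled s4" by (rule sampled_agree[OF sm3 ag4]) auto
        moreover have "reals s4 ''X'' = (\<lambda>_. 0)" using z3 ag4 by (simp add: agree_def)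
        ultimately show "wp (enum_time + n * (k * (5 * d + 14) + 11) + 8) output_block Q s4"
          using e by (intro wp_output_block Q) auto
      qed
    qed (use rep in auto)
    then show "wp (5 * m + 3 + (m ^ K * (enum_time + 11) + 3 + (enum_time + n * (k * (5 * d + 14) + 11) + 8) + 1) + 1)
       (Seq sample_block (Seq enum_block output_block)) Q s2"
      by (rule wp_Seq)
  qed (use D z1 in auto)
qed (use zero in auto)

end


section \<open>Setup: offset tables and parameters\<close>

definition offsets :: "vname \<Rightarrow> nexp \<Rightarrow> nexp \<Rightarrow> com" where
  "offsets y c e = Seq (NStore y (NConst 0) (NConst 0))
     (For ''i'' c (NStore y (NAdd (NV ''i'') (NConst 1)) (NAdd (NCell y (NV ''i'')) e)))"

lemma written_offsets [simp]: "nwritten (offsets y c e) = {''i'', y}" "rwritten (offsets y c e) = {}"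
  by (auto simp: offsets_def)

lemma wp_offsets:
  assumes y: "y \<noteq> ''i''" and c: "\<And>s'. agree {''i'', y} {} s s' \<Longrightarrow> nval c s' = M \<and> nval e s' = S"
    and Q: "\<And>s'. agree {''i'', y} {} s s' \<Longrightarrow> (\<forall>i\<le>M. nats s' y i = i * S) \<Longrightarrow> Q s'"
  shows "wp (5 * M + 5) (offsets y c e) Q s"
proof -
  let ?s = "nats_upd y 0 0 s"
  have ag: "agree {''i'', y} {} s s'" if "agree {''i'', y} {} ?s s'" for s'
    using that by (auto simp: agree_def)
  have "wp (M * (1 + 4) + 3) (For ''i'' c (NStore y (NAdd (NV ''i'') (NConst 1)) (NAdd (NCell y (NV ''i'')) e))) Q ?s"
  proof (rule wp_For[where I = "\<lambda>i s'. \<forall>i'\<le>i. nats s' y i' = i' * S"], goal_cases)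
    case (2 s')
    then show ?case using c[OF ag] by simp
  next
    case (4 i s')
    have "nval e s' = S" using 4(2) c[OF ag] by simp
    then show ?case using 4 y by (intro wp_NStore) (auto simp: le_Suc_eq)
  next
    case (5 s')
    then show ?case by (intro Q ag) auto
  qed (use y in auto)
  then show ?thesis unfolding offsets_def by (intro wp_time[OF wp_NStore_Seq]) auto
qed

definition sample_size_exp :: rexp where
  "sample_size_exp =
     (let y = RMul (ROfNat (NConst 444)) (RAdd (ROfNat (NConst 1)) (FNV ''T''));
          z = RMul (RMul (ROfNat (NConst 5)) (FNV ''K''))
                (RMul (RMul y y) (RDiv (ROfNat (NConst 16)) (RMul (RV ''eps'') (RV ''eps''))))
      in RMul z z)"

text \<open>Products of parameters are formed among the reals and brought to the naturals by
  counting. This includes \<open>m ^ K\<close>, whose counting time is covered by the exponential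
  term.\<close>

definition setup_block :: com where
  "setup_block =
     Seq (count_to ''T'' (RMul (ROfNat (NConst 433)) (RMul (FNV ''k'') (FNV ''k''))))
     (Seq (count_to ''l'' (RDiv (ROfNat (NConst 4)) (RV ''eps'')))
     (Seq (count_to ''K'' (RMul (FNV ''k'') (FNV ''l'')))
     (Seq (count_to ''m'' sample_size_exp)
     (Seq (NSet ''n3'' (NAdd (NV ''n'') (NAdd (NV ''n'') (NV ''n''))))
     (Seq (RSet ''P'' (ROfNat (NConst 1)))
     (Seq (For ''i'' (NV ''K'') (RSet ''P'' (RMul (RV ''P'') (FNV ''m''))))
     (Seq (count_to ''N'' (RV ''P''))
     (Seq (offsets ''rd'' (NV ''n'') (NV ''d''))
     (Seq (offsets ''rk'' (NV ''n'') (NV ''k''))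
          (offsets ''rl'' (NV ''k'') (NV ''l'')))))))))))"

text \<open>The constant \<open>433 \<ge> 4 * 108 + 1\<close> makes the expected potential at most 1/4, and
  \<open>444 = 3 * 148\<close> comes from the sensitivity bound \<open>148\<close> and the list length \<open>3 n\<close>.\<close>

definition rounds :: "nat \<Rightarrow> nat" where "rounds k = 433 * k\<^sup>2"
definition mean_size :: "real \<Rightarrow> nat" where "mean_size \<epsilon> = nat \<lceil>4 / \<epsilon>\<rceil>"
definition sample_size :: "nat \<Rightarrow> real \<Rightarrow> nat" where
  "sample_size k \<epsilon> = nat \<lceil>(5 * real (k * mean_size \<epsilon>) * ((444 * (1 + real (rounds k)))\<^sup>2 * (16 / \<epsilon>\<^sup>2)))\<^sup>2\<rceil>"

definition setup_time :: "nat \<Rightarrow> nat \<Rightarrow> nat \<Rightarrow> nat \<Rightarrow> nat \<Rightarrow> nat" where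
  "setup_time n k T l m = (T * 3 + 3) + ((l * 3 + 3) + ((k * l * 3 + 3) + ((m * 3 + 3) +
     (((k * l * 5 + 3) + ((m ^ (k * l) * 3 + 3) + ((5 * n + 5) + ((5 * n + 5) + (5 * k + 5) + 1) + 1) + 1) + 1) + 2 + 2) + 1) + 1) + 1) + 1"

lemma wp_setup_block:
  assumes s: "nats s ''n'' 0 = n" "nats s ''d'' 0 = d" "nats s ''k'' 0 = k" "reals s ''eps'' 0 = \<epsilon>"
  defines "T \<equiv> rounds k" and "l \<equiv> mean_size \<epsilon>" and "m \<equiv> sample_size k \<epsilon>"
  assumes Q: "\<And>s'. agree {''T'', ''l'', ''K'', ''m'', ''n3'', ''i'', ''N'', ''rd'', ''rk'', ''rl''} {''P''} s s' \<Longrightarrow>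
      nats s' ''T'' 0 = T \<Longrightarrow> nats s' ''l'' 0 = l \<Longrightarrow> nats s' ''K'' 0 = k * l \<Longrightarrow> nats s' ''m'' 0 = m \<Longrightarrow>
      nats s' ''n3'' 0 = 3 * n \<Longrightarrow> nats s' ''N'' 0 = m ^ (k * l) \<Longrightarrow>
      (\<forall>i\<le>n. nats s' ''rd'' i = i * d) \<Longrightarrow> (\<forall>i\<le>n. nats s' ''rk'' i = i * k) \<Longrightarrow>
      (\<forall>j\<le>k. nats s' ''rl'' j = j * l) \<Longrightarrow> Q s'"
  shows "wp (setup_time n k T l m) setup_block Q s"
proof -
  let ?K = "k * l"
  let ?s1 = "nats_upd ''T'' 0 T s"
  let ?s2 = "nats_upd ''l'' 0 l ?s1"
  let ?s3 = "nats_upd ''K'' 0 ?K ?s2"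
  let ?s4 = "nats_upd ''m'' 0 m ?s3"
  let ?s6 = "reals_upd ''P'' 0 1 (nats_upd ''n3'' 0 (n + (n + n)) ?s4)"
  let ?off = "Seq (offsets ''rd'' (NV ''n'') (NV ''d'')) (Seq (offsets ''rk'' (NV ''n'') (NV ''k'')) (offsets ''rl'' (NV ''k'') (NV ''l'')))"
  have rl: "wp (5 * k + 5) (offsets ''rl'' (NV ''k'') (NV ''l'')) Q s10"
    if s10: "agree {''i'', ''N'', ''rd'', ''rk''} {''P''} ?s6 s10" "nats s10 ''N'' 0 = m ^ ?K"
      "\<forall>i\<le>n. nats s10 ''rd'' i = i * d" "\<forall>i\<le>n. nats s10 ''rk'' i = i * k" for s10
  proof (rule wp_offsets[where M = k and S = l], goal_cases)
    case (2 s')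
    then show ?case using s10(1) s by (simp add: agree_def)
  next
    case (3 s')
    then show ?case using s10 by (intro Q) (auto simp: agree_def)
  qed simp
  have rk: "wp ((5 * n + 5) + (5 * k + 5) + 1) (Seq (offsets ''rk'' (NV ''n'') (NV ''k'')) (offsets ''rl'' (NV ''k'') (NV ''l''))) Q s9"
    if s9: "agree {''i'', ''N'', ''rd''} {''P''} ?s6 s9" "nats s9 ''N'' 0 = m ^ ?K"
      "\<forall>i\<le>n. nats s9 ''rd'' i = i * d" for s9
  proof (rule wp_Seq, rule wp_offsets[where M = n and S = k], goal_cases)
    case (2 s')
    then show ?case using s9(1) s by (simp add: agree_def)
  next
    case (3 s')
    then show ?case using s9 by (intro rl) (auto simp: agree_def)
  qed simp
  have off: "wp ((5 * n + 5) + ((5 * n + 5) + (5 * k + 5) + 1) + 1) ?off Q s8"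
    if s8: "agree {''i'', ''N''} {''P''} ?s6 s8" "nats s8 ''N'' 0 = m ^ ?K" for s8
  proof (rule wp_Seq, rule wp_offsets[where M = n and S = d], goal_cases)
    case (2 s')
    then show ?case using s8(1) s by (simp add: agree_def)
  next
    case (3 s')
    then show ?case using s8 by (intro rk) (auto simp: agree_def)
  qed simp
  have N: "wp ((m ^ ?K * 3 + 3) + ((5 * n + 5) + ((5 * n + 5) + (5 * k + 5) + 1) + 1) + 1) (Seq (count_to ''N'' (RV ''P'')) ?off) Q s7"
    if s7: "agree {''i''} {''P''} ?s6 s7" "reals s7 ''P'' 0 = real m ^ ?K" for s7
  proof (rule wp_Seq, rule wp_count_to[where r = "real (m ^ ?K)"], goal_cases)
    case 3
    show ?case by (rule off) (use s7(1) in \<open>auto simp: agree_def simp del: of_nat_power\<close>)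
  qed (use s7 in \<open>auto simp: agree_def simp del: of_nat_power\<close>)
  have P: "wp (?K * (1 + 4) + 3) (For ''i'' (NV ''K'') (RSet ''P'' (RMul (RV ''P'') (FNV ''m''))))
     (wp ((m ^ ?K * 3 + 3) + ((5 * n + 5) + ((5 * n + 5) + (5 * k + 5) + 1) + 1) + 1) (Seq (count_to ''N'' (RV ''P'')) ?off) Q) ?s6"
  proof (rule wp_For[where I = "\<lambda>i s'. reals s' ''P'' 0 = real m ^ i"], goal_cases)
    case (4 i s')
    have "nats s' ''m'' 0 = m" using 4(2) by (simp add: agree_def)
    then show ?case using 4 by (intro wp_RStore) simp
  next
    case (5 s')
    then show ?case by (intro N) (auto simp: agree_def)
  qed (auto simp: agree_def)
  have T: "T = nat \<lceil>433 * (real k * real k)\<rceil>"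
  proof -
    have "433 * (real k * real k) = real (433 * (k * k))" by simp
    then show ?thesis unfolding T_def rounds_def power2_eq_square by (simp del: of_nat_mult)
  qed
  have K: "?K = nat \<lceil>real k * real l\<rceil>" by (simp flip: of_nat_mult)
  have "wp ((T * 3 + 3) + ((l * 3 + 3) + ((?K * 3 + 3) + ((m * 3 + 3) +
     (((?K * (1 + 4) + 3) + ((m ^ ?K * 3 + 3) + ((5 * n + 5) + ((5 * n + 5) + (5 * k + 5) + 1) + 1) + 1) + 1) + 2 + 2) + 1) + 1) + 1) + 1) setup_block Q s"
    unfolding setup_block_def
  proof (rule wp_Seq, rule wp_count_to[where r = "433 * (real k * real k)"], goal_cases)
    case 3
    show ?case unfolding T[symmetric]
    proof (rule wp_Seq, rule wp_count_to[where r = "4 / \<epsilon>"], goal_cases)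
      case 3
      show ?case unfolding mean_size_def[symmetric] l_def[symmetric]
      proof (rule wp_Seq, rule wp_count_to[where r = "real k * real l"], goal_cases)
        case 3
        show ?case unfolding K[symmetric]
        proof (rule wp_Seq, rule wp_count_to[where r = "(5 * real (k * mean_size \<epsilon>) * ((444 * (1 + real (rounds k)))\<^sup>2 * (16 / \<epsilon>\<^sup>2)))\<^sup>2"], goal_cases)
          case 3
          show ?case unfolding sample_size_def[symmetric] m_def[symmetric]
            using P s by (intro wp_NStore_Seq wp_RStore_Seq wp_Seq) simp
        qed (use s in \<open>auto simp: agree_def sample_size_exp_def T_def l_def m_def sample_size_def Let_def power2_eq_square\<close>)
      qed (use s in \<open>auto simp: agree_def K\<close>)
    qed (use s in \<open>auto simp: agree_def l_def mean_size_def\<close>)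
  qed (use s in \<open>auto simp: agree_def T\<close>)
  then show ?thesis by (rule wp_time) (simp add: setup_time_def)
qed

subsection \<open>Random draws\<close>

definition draw_block :: "vname \<Rightarrow> vname \<Rightarrow> com" where
  "draw_block y z = For ''i'' (NV z) (Rand y (NV ''i'') (NSub (NV ''n3'') (NConst 1)))"

text \<open>The whole array is replaced by a function, so that the state after the loop is the image
  of one sample from a product distribution.\<close>

definition drawn :: "vname \<Rightarrow> nat \<Rightarrow> state \<Rightarrow> (nat \<Rightarrow> nat) \<Rightarrow> state" where
  "drawn y i s g = s\<lparr>nats := (nats s)(y := g, ''i'' := (nats s ''i'')(0 := i))\<rparr>"

lemma exec_step: "step c s = return_pmf (c', s') \<Longrightarrow> exec t c' s' \<mu> \<Longrightarrow> exec (t + 1) c s \<mu>"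
  by (simp add: exec_def bind_return_pmf)

text \<open>\<open>Pi_pmf\<close> returns its default 0 outside the index set; this matches the
  untouched cells because the array is zero at the start. The induction runs backwards from
  \<open>R\<close> and splits off the first of the remaining draws.\<close>

lemma exec_draw_block:
  assumes y: "y \<noteq> ''i''" "y \<noteq> ''n3''" "y \<noteq> z" "z \<noteq> ''i''" and zero: "nats s y = (\<lambda>_. 0)"
    and N: "nats s ''n3'' 0 = N" "N \<ge> 1" and R: "nats s z 0 = R"
  shows "exec (5 * R + 3) (draw_block y z) s (map_pmf (drawn y R s) (draws {..<R} N))"
proof -
  let ?body = "Seq (Rand y (NV ''i'') (NSub (NV ''n3'') (NConst 1))) (NIncr ''i'')"
  let ?loop = "While (NLess (NV ''i'') (NV z)) ?body"
  let ?U = "pmf_of_set {..<N}"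
  have loop: "exec ((R - i) * 5 + 1) ?loop (drawn y i s g0)
      (map_pmf (\<lambda>g. drawn y R s (\<lambda>p. if p \<in> {i..<R} then g p else g0 p)) (draws {i..<R} N))" if "i \<le> R" for i g0
    using that
  proof (induction arbitrary: g0 rule: inc_induct)
    case base
    show ?case using y R by (auto simp: exec_def drawn_def bind_return_pmf)
  next
    case (step i)
    have UN: "{0..N - Suc 0} = {..<N}" using N by auto
    have rand: "exec 1 (Rand y (NV ''i'') (NSub (NV ''n3'') (NConst 1))) (drawn y i s g0)
        (map_pmf (\<lambda>v. drawn y i s (g0(i := v))) ?U)"
      using y N by (simp add: exec_def drawn_def nats_upd_def UN map_pmf_def bind_assoc_pmf bind_return_pmf)
        (simp add: fun_upd_twist)
    have incr: "exec 1 (NIncr ''i'') (drawn y i s g) (return_pmf (drawn y (Suc i) s g))" for g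
      using y by (simp add: exec_def drawn_def nats_upd_def bind_return_pmf)
    have body: "exec (1 + 1 + 1) ?body (drawn y i s g0) (map_pmf (\<lambda>v. drawn y (Suc i) s (g0(i := v))) ?U)"
    proof -
      have "exec (1 + 1 + 1) ?body (drawn y i s g0)
         (bind_pmf (map_pmf (\<lambda>v. drawn y i s (g0(i := v))) ?U) (\<lambda>s'. return_pmf (nats_upd ''i'' 0 (Suc i) s')))"
        using y by (intro exec_Seq rand) (auto simp: exec_def drawn_def nats_upd_def bind_return_pmf)
      moreover have "nats_upd ''i'' 0 (Suc i) (drawn y i s g) = drawn y (Suc i) s g" for g
        using y by (simp add: drawn_def nats_upd_def)
      ultimately show ?thesis by (simp add: map_pmf_def bind_assoc_pmf bind_return_pmf)
    qed
    define it where "it s' = map_pmf (\<lambda>g. drawn y R s (\<lambda>p. if p \<in> {Suc i..<R} then g p else nats s' y p)) (draws {Suc i..<R} N)" for s' :: state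
    have "exec ((1 + 1 + 1) + ((R - Suc i) * 5 + 1) + 1) (Seq ?body ?loop) (drawn y i s g0)
       (bind_pmf (map_pmf (\<lambda>v. drawn y (Suc i) s (g0(i := v))) ?U) it)"
    proof (rule exec_Seq[OF body])
      fix s' assume "s' \<in> set_pmf (map_pmf (\<lambda>v. drawn y (Suc i) s (g0(i := v))) ?U)"
      then obtain v where v: "s' = drawn y (Suc i) s (g0(i := v))" by auto
      then have *: "nats s' y = g0(i := v)" using y by (simp add: drawn_def)
      show "exec ((R - Suc i) * 5 + 1) ?loop s' (it s')"
        unfolding it_def * unfolding v by (rule step.IH)
    qed
    moreover have "bind_pmf (map_pmf (\<lambda>v. drawn y (Suc i) s (g0(i := v))) ?U) it =
      map_pmf (\<lambda>g. drawn y R s (\<lambda>p. if p \<in> {i..<R} then g p else g0 p)) (draws {i..<R} N)"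
    proof -
      have eq: "{i..<R} = insert i {Suc i..<R}" using step.hyps by auto
      have fn: "(\<lambda>p. if p \<in> {Suc i..<R} then g p else (g0(i := v)) p) =
        (\<lambda>p. if p \<in> {i..<R} then (g(i := v)) p else g0 p)" for g v
        using step.hyps by (auto simp: fun_eq_iff)
      have "nats (drawn y (Suc i) s (g0(i := v))) y = g0(i := v)" for v using y by (simp add: drawn_def)
      then have it: "it (drawn y (Suc i) s (g0(i := v))) =
        map_pmf (\<lambda>g. drawn y R s (\<lambda>p. if p \<in> {i..<R} then (g(i := v)) p else g0 p)) (draws {Suc i..<R} N)" for v
        unfolding it_def by (simp only: fn)
      have "draws {i..<R} N = bind_pmf ?U (\<lambda>v. map_pmf (\<lambda>g. g(i := v)) (draws {Suc i..<R} N))"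
        unfolding eq by (subst Pi_pmf_insert') (auto simp: map_pmf_def)
      then show ?thesis by (simp add: bind_map_pmf it map_bind_pmf pmf.map_comp o_def)
    qed
    ultimately have ex: "exec ((1 + 1 + 1) + ((R - Suc i) * 5 + 1) + 1) (Seq ?body ?loop) (drawn y i s g0)
      (map_pmf (\<lambda>g. drawn y R s (\<lambda>p. if p \<in> {i..<R} then g p else g0 p)) (draws {i..<R} N))" by simp
    have bval: "bval (NLess (NV ''i'') (NV z)) (drawn y i s g0)"
      using step.hyps y R by (auto simp: drawn_def)
    have "exec (((1 + 1 + 1) + ((R - Suc i) * 5 + 1) + 1) + 1) ?loop (drawn y i s g0)
      (map_pmf (\<lambda>g. drawn y R s (\<lambda>p. if p \<in> {i..<R} then g p else g0 p)) (draws {i..<R} N))"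
      by (rule exec_step[OF _ ex]) (simp only: step.simps bval if_True)
    then show ?case by (rule exec_mono) (use step.hyps in linarith)
  qed
  have "exec (R * 5 + 1) ?loop (drawn y 0 s (\<lambda>_. 0)) (map_pmf (drawn y R s) (draws {..<R} N))"
  proof -
    have "map_pmf (\<lambda>g. drawn y R s (\<lambda>p. if p \<in> {0..<R} then g p else 0)) (draws {0..<R} N) =
      map_pmf (drawn y R s) (draws {0..<R} N)"
    proof (rule map_pmf_cong[OF refl])
      fix g assume "g \<in> set_pmf (draws {0..<R} N)"
      then have "\<forall>p. p \<notin> {0..<R} \<longrightarrow> g p = 0" 
        using subsetD[OF set_Pi_pmf_subset[of "{0..<R}" 0 "\<lambda>_. pmf_of_set {..<N}"]] by simp
      then have "(\<lambda>p. if p \<in> {0..<R} then g p else 0) = g" by (intro ext) simp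
      then show "drawn y R s (\<lambda>p. if p \<in> {0..<R} then g p else 0) = drawn y R s g" by simp
    qed
    then show ?thesis using loop[of 0 "\<lambda>_. 0"] by (simp add: atLeast0LessThan)
  qed
  moreover have "exec 1 (NSet ''i'' (NConst 0)) s (return_pmf (drawn y 0 s (\<lambda>_. 0)))"
  proof -
    have upd: "(nats s)(y := \<lambda>_. 0, ''i'' := (nats s ''i'')(0 := 0)) = (nats s)(''i'' := (nats s ''i'')(0 := 0))"
      using zero by (auto simp: fun_eq_iff)
    have "drawn y 0 s (\<lambda>_. 0) = nats_upd ''i'' 0 0 s"
      unfolding drawn_def nats_upd_def upd by (rule refl)
    then show ?thesis by (simp add: exec_def bind_return_pmf)
  qed
  ultimately have "exec (1 + (R * 5 + 1) + 1) (draw_block y z) s (bind_pmf (return_pmf (drawn y 0 s (\<lambda>_. 0))) (\<lambda>_. map_pmf (drawn y R s) (draws {..<R} N)))"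
    unfolding draw_block_def For_def by (intro exec_Seq) auto
  then have "exec (1 + (R * 5 + 1) + 1) (draw_block y z) s (map_pmf (drawn y R s) (draws {..<R} N))"
    by (simp add: bind_return_pmf)
  then show ?thesis by (rule exec_mono) simp
qed


subsection \<open>Correctness of the algorithm\<close>

definition kmeans_alg :: com where
  "kmeans_alg = Seq setup_block (Seq (draw_block ''g'' ''T'') (Seq (draw_block ''hs'' ''m'') main_block))"

lemma prob_bind_ge:
  assumes Q: "\<And>g. g \<in> set_pmf P \<Longrightarrow> g \<in> G \<Longrightarrow> q \<le> measure_pmf.prob (Q g) X"
    and P: "p \<le> measure_pmf.prob P G" and "0 \<le> q"
  shows "p * q \<le> measure_pmf.prob (bind_pmf P Q) X"
proof -
  have "ennreal (measure_pmf.prob P G * q) = ennreal q * emeasure P G"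
    using \<open>0 \<le> q\<close> by (simp add: measure_pmf.emeasure_eq_measure ennreal_mult' mult.commute)
  also have "\<dots> = (\<integral>\<^sup>+g. ennreal q * indicator G g \<partial>P)"
    by (subst nn_integral_cmult_indicator) simp_all
  also have "\<dots> \<le> (\<integral>\<^sup>+g. emeasure (Q g) X \<partial>P)"
    using Q by (intro nn_integral_mono_AE)
      (auto simp: AE_measure_pmf_iff measure_pmf.emeasure_eq_measure indicator_def intro: ennreal_leI)
  also have "\<dots> = ennreal (measure_pmf.prob (bind_pmf P Q) X)"
    by (simp flip: measure_pmf.emeasure_eq_measure)
  finally have "measure_pmf.prob P G * q \<le> measure_pmf.prob (bind_pmf P Q) X" by simp
  moreover have "p * q \<le> measure_pmf.prob P G * q" using P \<open>0 \<le> q\<close> by (rule mult_right_mono)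
  ultimately show ?thesis by linarith
qed

context machine begin

lemma written_output_matrix:
  assumes A: "A \<in> carrier_mat n d" "x = row_fun A" and s: "written_output e s"
  shows "read_matrix ''X'' n k s \<in> assignment_matrices n k"
    and "frobenius_norm (read_matrix ''X'' n k s * read_matrix ''D'' k d s - A) =
           sqrt (\<Sum>i<n. near d k (centers (digit m e)) (x i))"
proof -
  let ?C = "centers (digit m e)"
  let ?X = "read_matrix ''X'' n k s" and ?D = "read_matrix ''D'' k d s"
  have "\<forall>i. \<exists>j. i < n \<longrightarrow> j < k \<and> near d k ?C (x i) = sqd d (x i) (?C j) \<and>
       (\<forall>j'<k. reals s ''X'' (i * k + j') = (if j' = j then 1 else 0))"
    using s by (auto simp: written_output_def)
  then obtain f' where f': "\<And>i. i < n \<Longrightarrow> f' i < k" "\<And>i. i < n \<Longrightarrow> near d k ?C (x i) = sqd d (x i) (?C (f' i))"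
    "\<And>i j'. i < n \<Longrightarrow> j' < k \<Longrightarrow> reals s ''X'' (i * k + j') = (if j' = f' i then 1 else 0)"
    by metis
  have row: "Matrix.row ?X i = unit_vec k (f' i)" if "i < n" for i
    using f' that by (intro eq_vecI) (auto simp: read_matrix_def unit_vec_def)
  have X: "?X \<in> carrier_mat n k" and D: "?D \<in> carrier_mat k d" by (auto simp: read_matrix_def)
  show "?X \<in> assignment_matrices n k" using X row f'(1) by (auto simp: assignment_matrices_def)
  have "sqd d (row_fun A i) (row_fun ?D (f' i)) = near d k ?C (x i)" if "i < n" for i
  proof -
    have "sqd d (row_fun A i) (row_fun ?D (f' i)) = sqd d (x i) (?C (f' i))"
    proof (rule sqd_cong)
      show "row_fun A i hh = x i hh" for hh by (simp add: A(2))
      show "row_fun ?D (f' i) hh = ?C (f' i) hh" if "hh < d" for hh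
        using s f'(1)[OF \<open>i < n\<close>] that
        by (simp add: row_fun_def read_matrix_def written_output_def stored_def)
    qed
    then show ?thesis using f'(2)[OF that] by simp
  qed
  then show "frobenius_norm (?X * ?D - A) = sqrt (\<Sum>i<n. near d k ?C (x i))"
    using frobenius_norm_assignment[OF X _ D A(1), of f'] row f'(1) by simp
qed

end

lemma mean_size_pos: "0 < \<epsilon> \<Longrightarrow> 1 \<le> mean_size \<epsilon>"
  by (simp add: mean_size_def Suc_le_eq)

lemma sample_size_pos:
  assumes "0 < \<epsilon>" "1 \<le> k"
  shows "1 \<le> sample_size k \<epsilon>"
proof -
  let ?v = "5 * real (k * mean_size \<epsilon>) * ((444 * (1 + real (rounds k)))\<^sup>2 * (16 / \<epsilon>\<^sup>2))"
  have "0 < real (k * mean_size \<epsilon>)" using assms mean_size_pos[of \<epsilon>] by simp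
  then have "0 < ?v"
    using assms by (intro mult_pos_pos zero_less_power divide_pos_pos) auto
  then have "0 < ?v\<^sup>2" by (rule zero_less_power)
  then show ?thesis unfolding sample_size_def by linarith
qed

definition total_time :: "nat \<Rightarrow> nat \<Rightarrow> nat \<Rightarrow> nat \<Rightarrow> nat \<Rightarrow> nat \<Rightarrow> nat" where
  "total_time n d k T l m = setup_time n k T l m + ((5 * T + 3) + ((5 * m + 3) + machine.main_time n d k l m (k * l) T + 1) + 1) + 1"

lemma exec_unique: "exec t c s \<mu> \<Longrightarrow> exec t c s \<nu> \<Longrightarrow> \<mu> = \<nu>"
  by (metis exec_final_state)

text \<open>The two batches of draws are independent. The first is good for
  \<open>bicriteria\<close> with probability 3/4, and for every good first batch the second succeeds
  with probability 3/4 by \<open>sampling_success\<close>.\<close>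

lemma kmeans_alg_correct:
  fixes A :: "real mat" and \<epsilon> :: real
  assumes A: "A \<in> carrier_mat n d" and \<epsilon>: "0 < \<epsilon>" "\<epsilon> < 1" and k: "1 \<le> k" "k \<le> n"
  defines "T \<equiv> rounds k" and "l \<equiv> mean_size \<epsilon>" and "m \<equiv> sample_size k \<epsilon>"
  shows "\<exists>\<mu>. exec (total_time n d k T l m) kmeans_alg (input_state A k \<epsilon>) \<mu> \<and>
    (\<forall>s\<in>set_pmf \<mu>. read_matrix ''X'' n k s \<in> assignment_matrices n k) \<and>
    measure_pmf.prob \<mu> {s. frobenius_norm (read_matrix ''X'' n k s * read_matrix ''D'' k d s - A)
                  \<le> (1 + \<epsilon>) * kmeans_opt A k} \<ge> 9 / 16"
proof -
  define x where "x = row_fun A"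
  define K where "K = k * l"
  define s0 where "s0 = input_state A k \<epsilon>"
  have n: "n \<ge> 1" using k by simp
  have T: "T \<ge> 1" using k by (simp add: T_def rounds_def)
  have l4: "real l \<ge> 4 / \<epsilon>" unfolding l_def mean_size_def by linarith
  have l1: "l \<ge> 1" and m1: "m \<ge> 1"
    unfolding l_def m_def using \<epsilon> k by (auto intro!: mean_size_pos sample_size_pos simp del: One_nat_def)
  have m_ge: "real m \<ge> (5 * K * ((444 * (1 + real T))\<^sup>2 * (16 / \<epsilon>\<^sup>2)))\<^sup>2"
    using real_nat_ceiling_ge[of "(5 * real (k * mean_size \<epsilon>) * ((444 * (1 + real (rounds k)))\<^sup>2 * (16 / \<epsilon>\<^sup>2)))\<^sup>2"]
    unfolding m_def sample_size_def K_def l_def T_def by simp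
  have mach: "machine n k l m K T g h" if "g \<in> set_pmf (draws {..<T} (3*n))" "h \<in> set_pmf (draws {..<m} (3*n))" for g h
    using that set_draws[of "{..<T}" "3*n"] set_draws[of "{..<m}" "3*n"] n k l1 m1 T
    by unfold_locales (auto simp: K_def)
  let ?R = "\<lambda>s'. agree {''T'', ''l'', ''K'', ''m'', ''n3'', ''i'', ''N'', ''rd'', ''rk'', ''rl''} {''P''} s0 s' \<and>
      nats s' ''T'' 0 = T \<and> nats s' ''l'' 0 = l \<and> nats s' ''K'' 0 = k * l \<and> nats s' ''m'' 0 = m \<and>
      nats s' ''n3'' 0 = 3 * n \<and> nats s' ''N'' 0 = m ^ (k * l) \<and>
      (\<forall>i\<le>n. nats s' ''rd'' i = i * d) \<and> (\<forall>i\<le>n. nats s' ''rk'' i = i * k) \<and>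
      (\<forall>j\<le>k. nats s' ''rl'' j = j * l)"
  have "wp (setup_time n k T l m) setup_block ?R s0"
    unfolding T_def l_def m_def
  proof (rule wp_setup_block[where d = d], goal_cases)
    case (5 s')
    then show ?case by (intro conjI)
  qed (use A in \<open>simp_all add: s0_def input_state_def\<close>)
  then obtain s1 where ex1: "exec (setup_time n k T l m) setup_block s0 (return_pmf s1)" and s1: "?R s1"
    unfolding wp_def by (elim exE conjE) (rule that, assumption, intro conjI)
  have ag1: "agree {''T'', ''l'', ''K'', ''m'', ''n3'', ''i'', ''N'', ''rd'', ''rk'', ''rl''} {''P''} s0 s1"
    using s1 by (rule conjunct1)
  have zero1: "nats s1 v = (\<lambda>_. 0)" if "v \<in> {''g'', ''hs'', ''cl'', ''sz'', ''cnt''}" for v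
  proof -
    have "nats s1 v = nats s0 v"
      using that by (intro ag1[unfolded agree_def, THEN conjunct1, rule_format]) (elim insertE emptyE; simp)
    also have "\<dots> = (\<lambda>_. 0)"
      using that unfolding s0_def input_state_def by (elim insertE emptyE; simp)
    finally show ?thesis .
  qed
  have zero2: "reals s1 v = (\<lambda>_. 0)" if "v \<in> {''D2'', ''X''}" for v
  proof -
    have "reals s1 v = reals s0 v"
      using that by (intro ag1[unfolded agree_def, THEN conjunct2, rule_format]) (elim insertE emptyE; simp)
    also have "\<dots> = (\<lambda>_. 0)"
      using that unfolding s0_def input_state_def by (elim insertE emptyE; simp)
    finally show ?thesis .
  qed
  have in1: "nats s1 ''n'' 0 = n" "nats s1 ''d'' 0 = d" "nats s1 ''k'' 0 = k"
    using ag1 A by (auto simp: agree_def s0_def input_state_def)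
  have A1: "reals s1 ''A'' (i * d + j) = x i j" if "i < n" "j < d" for i j
  proof -
    have "i * d + j < (i + 1) * d" using that by simp
    also have "\<dots> \<le> n * d" using that by (intro mult_right_mono) auto
    finally show ?thesis using ag1 A that by (simp add: agree_def s0_def input_state_def x_def row_fun_def)
  qed
  define s2 where "s2 g = drawn ''g'' T s1 g" for g
  define s3 where "s3 g h = drawn ''hs'' m (s2 g) h" for g h
  have ex2: "exec (5 * T + 3) (draw_block ''g'' ''T'') s1 (map_pmf s2 (draws {..<T} (3*n)))"
    unfolding s2_def using s1 n by (intro exec_draw_block zero1) auto
  have ex3: "exec (5 * m + 3) (draw_block ''hs'' ''m'') (s2 g) (map_pmf (s3 g) (draws {..<m} (3*n)))" for g
    unfolding s3_def using s1 n zero1[of "''hs''"] by (intro exec_draw_block) (auto simp: s2_def drawn_def)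
  let ?good = "\<lambda>g h e s'. e < m ^ K \<and> (\<forall>e'<m^K. machine.SC n d k l m T x g h e \<le> machine.SC n d k l m T x g h e') \<and>
      machine.written_output n d k l m T x g h e s'"
  have ex4: "\<exists>s'. exec (machine.main_time n d k l m K T) main_block (s3 g h) (return_pmf s') \<and> (\<exists>e. ?good g h e s')"
    if gh: "g \<in> set_pmf (draws {..<T} (3*n))" "h \<in> set_pmf (draws {..<m} (3*n))" for g h
  proof -
    interpret machine n d k l m K T x g h by (rule mach[OF gh])
    have "wp main_time main_block (\<lambda>s'. \<exists>e. ?good g h e s') (s3 g h)"
    proof (rule wp_main_block)
      show "base (s3 g h)" unfolding base_def using s1 in1 A1 by (simp add: s3_def s2_def drawn_def K_def)
    qed (use zero1 zero2 in \<open>auto simp: s3_def s2_def drawn_def\<close>)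
    then show ?thesis by (simp add: wp_def)
  qed
  \<comment> \<open>For each pair of draws only the existence of a final state is known; a choice
    makes it a function of the state, as needed for the image of a distribution.\<close>
  define F where "F s = (SOME s'. exec (machine.main_time n d k l m K T) main_block s (return_pmf s'))" for s
  have F: "exec (machine.main_time n d k l m K T) main_block (s3 g h) (return_pmf (F (s3 g h))) \<and> (\<exists>e. ?good g h e (F (s3 g h)))"
    if gh: "g \<in> set_pmf (draws {..<T} (3*n))" "h \<in> set_pmf (draws {..<m} (3*n))" for g h
  proof -
    obtain s' where s': "exec (machine.main_time n d k l m K T) main_block (s3 g h) (return_pmf s')" "\<exists>e. ?good g h e s'"
      using ex4[OF gh] by blast
    have "exec (machine.main_time n d k l m K T) main_block (s3 g h) (return_pmf (F (s3 g h)))"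
      unfolding F_def by (rule someI) (rule s'(1))
    then show ?thesis using s' exec_unique by (metis return_pmf_inj)
  qed
  define \<mu> where "\<mu> = bind_pmf (draws {..<T} (3*n)) (\<lambda>g. map_pmf (\<lambda>h. F (s3 g h)) (draws {..<m} (3*n)))"
  have "exec ((5 * m + 3) + machine.main_time n d k l m K T + 1) (Seq (draw_block ''hs'' ''m'') main_block) (s2 g)
      (bind_pmf (map_pmf (s3 g) (draws {..<m} (3*n))) (\<lambda>s. return_pmf (F s)))"
    if g: "g \<in> set_pmf (draws {..<T} (3*n))" for g
    by (rule exec_Seq[OF ex3]) (use F[OF g] in auto)
  \<comment> \<open>The kernel required by \<open>exec_Seq\<close> is a function of the state, so
    the first batch of draws is read back from memory.\<close>
  moreover define \<nu> where "\<nu> s = bind_pmf (map_pmf (s3 (nats s ''g'')) (draws {..<m} (3*n))) (\<lambda>s. return_pmf (F s))" for s :: state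
  moreover have g_s2: "nats (s2 g) ''g'' = g" for g by (simp add: s2_def drawn_def)
  ultimately have "exec ((5 * T + 3) + ((5 * m + 3) + machine.main_time n d k l m K T + 1) + 1)
      (Seq (draw_block ''g'' ''T'') (Seq (draw_block ''hs'' ''m'') main_block)) s1 (bind_pmf (map_pmf s2 (draws {..<T} (3*n))) \<nu>)"
    by (intro exec_Seq[OF ex2]) auto
  then have "exec (total_time n d k T l m) kmeans_alg s0 (bind_pmf (return_pmf s1) (\<lambda>_. bind_pmf (map_pmf s2 (draws {..<T} (3*n))) \<nu>))"
    unfolding total_time_def kmeans_alg_def K_def by (intro exec_Seq[OF ex1]) auto
  also have "bind_pmf (return_pmf s1) (\<lambda>_. bind_pmf (map_pmf s2 (draws {..<T} (3*n))) \<nu>) = \<mu>"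
    by (simp add: bind_return_pmf bind_map_pmf \<nu>_def g_s2 \<mu>_def map_pmf_def bind_assoc_pmf)
  finally have exec: "exec (total_time n d k T l m) kmeans_alg (input_state A k \<epsilon>) \<mu>" unfolding s0_def .
  have assign: "read_matrix ''X'' n k s \<in> assignment_matrices n k" if s: "s \<in> set_pmf \<mu>" for s
  proof -
    obtain g h where gh: "g \<in> set_pmf (draws {..<T} (3*n))" "h \<in> set_pmf (draws {..<m} (3*n))" "s = F (s3 g h)"
      using s by (auto simp: \<mu>_def)
    interpret machine n d k l m K T x g h by (rule mach[OF gh(1,2)])
    show ?thesis using F[OF gh(1,2)] written_output_matrix(1)[OF A x_def] gh(3) by blast
  qed
  obtain f Z where f: "\<And>i. i < n \<Longrightarrow> f i < k" and opt: "kmeans_opt A k = sqrt (\<Sum>i<n. sqd d (x i) (Z (f i)))"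
    and opt_le: "\<And>Z'. (\<Sum>i<n. sqd d (x i) (Z (f i))) \<le> (\<Sum>i<n. near d k Z' (x i))"
    using kmeans_opt_attained[OF A k(1)] unfolding x_def by metis
  interpret clustering n d k x f Z using n k f by unfold_locales auto
  let ?S = "{s. frobenius_norm (read_matrix ''X'' n k s * read_matrix ''D'' k d s - A) \<le> (1 + \<epsilon>) * kmeans_opt A k}"
  let ?G = "{g. sum (dsq n d x g T) {..<n} \<le> 36 * opt}"
  have "3 / 4 \<le> measure_pmf.prob (map_pmf (\<lambda>h. F (s3 g h)) (draws {..<m} (3*n))) ?S"
    if g1: "g \<in> set_pmf (draws {..<T} (3*n))" and g2: "g \<in> ?G" for g
  proof -
    let ?H = "{h. \<forall>e<m^K. (\<forall>e'<m^K. machine.SC n d k l m T x g h e \<le> machine.SC n d k l m T x g h e') \<longrightarrow>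
       (\<Sum>i<n. near d k (machine.centers n d l T x g h (digit m e)) (x i)) \<le> (1 + \<epsilon>)\<^sup>2 * opt}"
    \<comment> \<open>The guard restricts attention to draws in range, for which
      \<open>machine\<close> can be interpreted.\<close>
    have "3 / 4 \<le> measure_pmf.prob (draws {..<m} (3*n)) {h. h \<in> set_pmf (draws {..<m} (3*n)) \<longrightarrow> h \<in> ?H}"
    proof -
      let ?w = "sens n (dsq n d x g T) (dcl n d x g T)"
      let ?C = "\<lambda>h e. sample_centers x (\<lambda>p. rep n ?w (h p)) l (digit m e)"
      let ?c = "\<lambda>h e. sample_cost d k m x (\<lambda>p. rep n ?w (h p)) (\<lambda>i. 1 / real (rep_count n ?w i)) (?C h e)"
      have "3 / 4 \<le> measure_pmf.prob (uniform_draws m) {h. \<forall>e<m^K. (\<forall>e'<m^K. ?c h e \<le> ?c h e') \<longrightarrow>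
         (\<Sum>i<n. near d k (?C h e) (x i)) \<le> (1 + \<epsilon>)\<^sup>2 * opt}"
        using g2 opt_le by (intro sampling_success \<epsilon> l4 m_ge K_def T) (auto simp: opt_def)
      also have "\<dots> \<le> measure_pmf.prob (uniform_draws m) {h. h \<in> set_pmf (draws {..<m} (3*n)) \<longrightarrow> h \<in> ?H}"
      proof (intro measure_pmf.finite_measure_mono subsetI CollectI impI, goal_cases)
        case (1 h)
        interpret machine n d k l m K T x g h by (rule mach[OF g1 1(2)])
        show ?case using 1(1) unfolding SC_def centers_def weight_def by simp
      qed simp
      finally show ?thesis by (simp add: uniform_draws_def)
    qed
    also have "\<dots> \<le> measure_pmf.prob (draws {..<m} (3*n)) ((\<lambda>h. F (s3 g h)) -` ?S)"
    proof (rule measure_pmf.finite_measure_mono_AE)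
      have "F (s3 g h) \<in> ?S" if h1: "h \<in> set_pmf (draws {..<m} (3*n))" and h2: "h \<in> ?H" for h
      proof -
        interpret machine n d k l m K T x g h by (rule mach[OF g1 h1])
        obtain e where e: "?good g h e (F (s3 g h))" using F[OF g1 h1] by blast
        have "frobenius_norm (read_matrix ''X'' n k (F (s3 g h)) * read_matrix ''D'' k d (F (s3 g h)) - A) =
           sqrt (\<Sum>i<n. near d k (centers (digit m e)) (x i))"
          using written_output_matrix(2)[OF A x_def] e by blast
        also have "\<dots> \<le> sqrt ((1 + \<epsilon>)\<^sup>2 * opt)"
          using h2 e by (intro real_sqrt_le_mono) blast
        also have "\<dots> = (1 + \<epsilon>) * kmeans_opt A k"
          using \<epsilon> opt by (simp add: real_sqrt_mult opt_def)
        finally show ?thesis by simp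
      qed
      then show "AE h in draws {..<m} (3*n). h \<in> {h. h \<in> set_pmf (draws {..<m} (3*n)) \<longrightarrow> h \<in> ?H} \<longrightarrow> h \<in> (\<lambda>h. F (s3 g h)) -` ?S"
        by (simp add: AE_measure_pmf_iff)
    qed simp
    finally show ?thesis by simp
  qed
  moreover have "3 / 4 \<le> measure_pmf.prob (draws {..<T} (3*n)) ?G"
    using bicriteria[of T] by (simp add: uniform_draws_def T_def rounds_def)
  ultimately have "3 / 4 * (3 / 4) \<le> measure_pmf.prob \<mu> ?S"
    unfolding \<mu>_def by (intro prob_bind_ge[where G = ?G]) auto
  then show ?thesis using exec assign by (intro exI[of _ \<mu>]) simp
qed


subsection \<open>Running time\<close>

context machine begin

text \<open>Everything polynomial in \<open>k / \<epsilon>\<close> is replaced by the common bound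
  \<open>Z\<close>; only \<open>n\<close> and \<open>m ^ K\<close> stay apart. Besides these, no
  product in the running time has more than three factors, such as \<open>k * d * l\<close> or
  \<open>m * k * d\<close>.\<close>

lemma total_time_le:
  assumes Z: "1 \<le> Z" "T \<le> Z" "l \<le> Z" "K \<le> Z" "m \<le> Z" "k \<le> Z" "d \<le> Z"
  shows "total_time n d k T l m \<le> 400 * (n * Z ^ 3) + 200 * ((m ^ K)\<^sup>2 * Z ^ 3)"
proof -
  define N where "N = m ^ K"
  define W where "W = Z ^ 3"
  have W3: "Z * (Z * Z) = W" by (simp add: W_def power3_eq_cube)
  have N1: "1 \<le> N" using m by (simp add: N_def)
  have ZZ: "Z \<le> Z * Z" using Z(1) by simp
  also have "Z * Z \<le> Z * (Z * Z)" using Z(1) by simp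
  finally have ZW: "Z \<le> W" "1 \<le> W" using W3 Z(1) by auto
  have ZZW: "Z * Z \<le> W" using W3 Z(1) by (metis mult_le_mono2 nat_mult_1_right)
  have nW: "W \<le> n * W" "n \<le> n * W" "n * (Z * Z) \<le> n * W" using n ZW ZZW by auto
  have NW: "W \<le> N * W" "N \<le> N * W" "N * Z \<le> N * W" "N * W \<le> N * (N * W)" "1 \<le> N * W"
    using N1 ZW by auto
  have e1: "K * (5 * N + 11) + 5 \<le> 21 * (N * W)"
  proof -
    have "K * (5 * N + 11) \<le> Z * (16 * N)" using Z N1 by (intro mult_le_mono) auto
    also have "\<dots> = 16 * (N * Z)" by simp
    finally show ?thesis using NW by linarith
  qed
  have e2: "k * (d * (5 * l + 11) + 7) + 3 \<le> 26 * W"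
  proof -
    have "k * (d * (5 * l + 11) + 7) \<le> Z * (Z * (16 * Z) + 7)"
      using Z by (intro mult_le_mono add_le_mono) auto
    also have "\<dots> = 16 * W + 7 * Z" by (simp add: W3[symmetric] algebra_simps)
    finally show ?thesis using ZW by linarith
  qed
  have kd: "k * (5 * d + 14) + 11 \<le> 19 * (Z * Z) + 11"
  proof -
    have "k * (5 * d + 14) \<le> Z * (19 * Z)" using Z by (intro mult_le_mono) auto
    then show ?thesis by simp
  qed
  have e3: "m * (k * (5 * d + 14) + 11) + 5 \<le> 35 * W"
  proof -
    have "m * (k * (5 * d + 14) + 11) \<le> Z * (19 * (Z * Z) + 11)" using Z kd by (intro mult_le_mono) auto
    also have "\<dots> = 19 * W + 11 * Z" by (simp add: W3[symmetric] algebra_simps)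
    finally show ?thesis using ZW by linarith
  qed
  have enum: "enum_time \<le> 82 * (N * W)"
    unfolding enum_time_def N_def[symmetric] using e1 e2 e3 NW by linarith
  have m1: "T * (n * (5 * d + 52) + 25) + 3 \<le> 85 * (n * W)"
  proof -
    have "T * (n * (5 * d + 52) + 25) \<le> Z * (n * (57 * Z) + 25)"
      using Z by (intro mult_le_mono add_le_mono) auto
    also have "\<dots> = 57 * (n * (Z * Z)) + 25 * Z" by (simp add: algebra_simps)
    finally show ?thesis using nW ZW by linarith
  qed
  have m4: "N * (enum_time + 11) + 3 \<le> 96 * (N * (N * W))"
  proof -
    have "N * (enum_time + 11) \<le> N * (93 * (N * W))" using enum NW by (intro mult_le_mono) linarith+
    also have "\<dots> = 93 * (N * (N * W))" by simp
    finally show ?thesis using NW by linarith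
  qed
  have m5: "n * (k * (5 * d + 14) + 11) \<le> 30 * (n * W)"
  proof -
    have "n * (k * (5 * d + 14) + 11) \<le> n * (19 * (Z * Z) + 11)" using kd by (rule mult_le_mono2)
    also have "\<dots> = 19 * (n * (Z * Z)) + 11 * n" by (simp add: algebra_simps)
    finally show ?thesis using nW by linarith
  qed
  have main: "main_time \<le> 240 * (n * W) + 178 * (N * (N * W))"
    unfolding main_time_def N_def[symmetric] using m1 m4 m5 enum Z ZW nW NW n by linarith
  have prep: "setup_time n k T l m \<le> 100 * (n * W) + 6 * (N * (N * W))"
    unfolding setup_time_def K[symmetric] N_def[symmetric] using Z ZW nW NW n by linarith
  have "total_time n d k T l m \<le> 400 * (n * W) + 200 * (N * (N * W))"
    unfolding total_time_def K[symmetric] using main prep Z ZW nW by linarith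
  then show ?thesis by (simp add: N_def W_def power2_eq_square mult.assoc)
qed

end

lemma poly_le_monomial:
  fixes p :: "real poly"
  obtains C :: real and r :: nat where "0 \<le> C" "\<And>y. 1 \<le> y \<Longrightarrow> poly p y \<le> C * y ^ r"
proof
  show "0 \<le> (\<Sum>i\<le>degree p. \<bar>coeff p i\<bar>)" by (simp add: sum_nonneg)
  fix y :: real assume y: "1 \<le> y"
  have "poly p y = (\<Sum>i\<le>degree p. coeff p i * y ^ i)" by (rule poly_altdef)
  also have "\<dots> \<le> (\<Sum>i\<le>degree p. \<bar>coeff p i\<bar> * y ^ degree p)"
    using y by (intro sum_mono mult_mono power_increasing) auto
  finally show "poly p y \<le> (\<Sum>i\<le>degree p. \<bar>coeff p i\<bar>) * y ^ degree p" by (simp add: sum_distrib_right)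
qed

text \<open>\<open>K\<close> is bounded linearly and not by the product of the bounds for
  \<open>k\<close> and \<open>l\<close>, because it enters the exponent. In the sample size
  \<open>192696 = 444 * 434\<close> and \<open>400 = 5 * 5 * 16\<close>; the degree is
  \<open>14 = 2 * (1 + 4 + 2)\<close>, from \<open>K\<close>, the squared number of rounds and the
  inverse square of \<epsilon>, and the added 1 is for rounding up.\<close>

lemma parameters_le:
  fixes \<epsilon> :: real
  assumes \<epsilon>: "0 < \<epsilon>" "\<epsilon> < 1" and k: "1 \<le> k"
  defines "y \<equiv> real k / \<epsilon>"
  shows "1 \<le> y" "real k \<le> y" "real (rounds k) \<le> 433 * y ^ 2" "real (mean_size \<epsilon>) \<le> 5 * y"
    "real (k * mean_size \<epsilon>) \<le> 5 * y" "real (sample_size k \<epsilon>) \<le> ((400 * 192696\<^sup>2)\<^sup>2 + 1) * y ^ 14"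
proof -
  have ky: "real k \<le> y" unfolding y_def using \<epsilon> k by (simp add: field_simps)
  have ey: "1 / \<epsilon> \<le> y" unfolding y_def using \<epsilon> k by (simp add: field_simps)
  have y1: "1 \<le> y" using ky k by linarith
  show "1 \<le> y" "real k \<le> y" by fact+
  have ky2: "real k ^ 2 \<le> y ^ 2" using ky by (intro power_mono) auto
  show T: "real (rounds k) \<le> 433 * y ^ 2" using ky2 by (simp add: rounds_def)
  have "0 < 4 / \<epsilon>" using \<epsilon> by simp
  then have ms: "real (mean_size \<epsilon>) \<le> 4 / \<epsilon> + 1" unfolding mean_size_def by linarith
  then show "real (mean_size \<epsilon>) \<le> 5 * y" using ey y1 by simp
  have "real (k * mean_size \<epsilon>) \<le> real k * (4 / \<epsilon> + 1)" using ms by (simp add: mult_left_mono)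
  also have "\<dots> = 4 * y + real k" by (simp add: y_def algebra_simps)
  finally show K: "real (k * mean_size \<epsilon>) \<le> 5 * y" using ky by simp
  let ?v = "5 * real (k * mean_size \<epsilon>) * ((444 * (1 + real (rounds k)))\<^sup>2 * (16 / \<epsilon>\<^sup>2))"
  have y2: "1 \<le> y ^ 2" using y1 by simp
  have "1 + real (rounds k) \<le> 434 * y ^ 2" using T y2 by simp
  then have "(444 * (1 + real (rounds k)))\<^sup>2 \<le> (192696 * y ^ 2)\<^sup>2"
    by (intro power_mono) auto
  moreover have "16 / \<epsilon>\<^sup>2 \<le> 16 * y ^ 2"
    using power_mono[OF ey, of 2] \<epsilon> by (simp add: power_divide)
  ultimately have "?v \<le> 5 * (5 * y) * ((192696 * y ^ 2)\<^sup>2 * (16 * y ^ 2))"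
    using K y1 by (intro mult_mono mult_nonneg_nonneg) auto
  also have "\<dots> = (400 * 192696\<^sup>2) * y ^ 7"
    by (simp add: power_mult_distrib power2_eq_square eval_nat_numeral algebra_simps)
  finally have "?v\<^sup>2 \<le> ((400 * 192696\<^sup>2) * y ^ 7)\<^sup>2" by (intro power_mono) auto
  also have "\<dots> = (400 * 192696\<^sup>2)\<^sup>2 * y ^ 14" by (simp add: power_mult_distrib flip: power_mult)
  finally have v: "?v\<^sup>2 \<le> (400 * 192696\<^sup>2)\<^sup>2 * y ^ 14" .
  have "real (sample_size k \<epsilon>) \<le> ?v\<^sup>2 + 1"
    unfolding sample_size_def using zero_le_power2[of ?v] by linarith
  also have "\<dots> \<le> (400 * 192696\<^sup>2)\<^sup>2 * y ^ 14 + 1 * y ^ 14"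
    using v y1 by (intro add_mono) auto
  also have "\<dots> = ((400 * 192696\<^sup>2)\<^sup>2 + 1) * y ^ 14" by (simp only: distrib_right)
  finally show "real (sample_size k \<epsilon>) \<le> ((400 * 192696\<^sup>2)\<^sup>2 + 1) * y ^ 14" .
qed

text \<open>\<open>(m ^ K)^2\<close> is \<open>exp (2 * K * ln m)\<close> with
  \<open>K \<le> 5 * y\<close> and \<open>ln m \<le> ln C0 + 14 * ln y\<close>. The polynomial
  factor beside it is written as an exponential too; as \<open>y \<ge> 1\<close>, its nonnegative
  exponent may be multiplied by \<open>y\<close>. So a linear \<open>Q\<close> suffices.\<close>

lemma total_time_bound:
  fixes R :: "real poly"
  obtains P Q :: "real poly" where
    "\<And>n d k \<epsilon>. 0 < \<epsilon> \<Longrightarrow> \<epsilon> < 1 \<Longrightarrow> 1 \<le> k \<Longrightarrow> k \<le> n \<Longrightarrow> real d \<le> poly R (real k / \<epsilon>) \<Longrightarrow>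
       real (total_time n d k (rounds k) (mean_size \<epsilon>) (sample_size k \<epsilon>))
         \<le> real n * poly P (real k / \<epsilon>) + exp (real k / \<epsilon> * poly Q (ln (real k / \<epsilon>)))"
proof -
  obtain C r where C: "0 \<le> C" "\<And>y. 1 \<le> y \<Longrightarrow> poly R y \<le> C * y ^ r"
    using poly_le_monomial[of R] by blast
  define C0 :: real where "C0 = (400 * 192696\<^sup>2)\<^sup>2 + 1"
  define q where "q = r + 14"
  \<comment> \<open>Here \<open>445 = 1 + 433 + 5 + 5 + 1\<close> collects the constants of the
    other parameters, and \<open>q\<close> dominates both degrees \<open>r\<close> and 14.\<close>
  define D where "D = C + C0 + 445"
  have C0: "C0 \<ge> 1" by (simp add: C0_def)
  have D: "D \<ge> 1" using C(1) C0 by (simp add: D_def)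
  have "real (total_time n d k (rounds k) (mean_size \<epsilon>) (sample_size k \<epsilon>))
         \<le> real n * poly (monom (400 * D ^ 3) (3 * q)) (real k / \<epsilon>) +
            exp (real k / \<epsilon> * poly [:10 * ln C0 + ln (200 * D ^ 3), real (140 + 3 * q):] (ln (real k / \<epsilon>)))"
    if \<epsilon>: "0 < \<epsilon>" "\<epsilon> < 1" and k: "1 \<le> k" "k \<le> n" and d: "real d \<le> poly R (real k / \<epsilon>)" for n d k and \<epsilon> :: real
  proof -
    define y where "y = real k / \<epsilon>"
    define T l m where "T = rounds k" and "l = mean_size \<epsilon>" and "m = sample_size k \<epsilon>"
    note bounds = parameters_le[OF \<epsilon> k(1), folded y_def T_def l_def m_def C0_def]
    have y: "1 \<le> y" by (rule bounds)
    define K where "K = k * l"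
    define Z where "Z = 1 + T + l + K + m + k + d"
    have T1: "T \<ge> 1" using k by (simp add: T_def rounds_def)
    have l1: "l \<ge> 1" and m1: "m \<ge> 1"
      unfolding l_def m_def using \<epsilon> k by (auto intro!: mean_size_pos sample_size_pos simp del: One_nat_def)
    have "machine n k l m K T (\<lambda>_. 0) (\<lambda>_. 0)"
      using k l1 m1 T1 by unfold_locales (auto simp: K_def)
    then have time: "total_time n d k T l m \<le> 400 * (n * Z ^ 3) + 200 * ((m ^ K)\<^sup>2 * Z ^ 3)"
      by (rule machine.total_time_le) (auto simp: Z_def)
    have pw: "y ^ i \<le> y ^ q" if "i \<le> q" for i using y that by (intro power_increasing) auto
    have "real Z \<le> D * y ^ q"
    proof -
      have "real Z = 1 + real T + real l + real K + real m + real k + real d" by (simp add: Z_def)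
      also have "\<dots> \<le> 1 * y ^ q + 433 * y ^ q + 5 * y ^ q + 5 * y ^ q + C0 * y ^ q + 1 * y ^ q + C * y ^ q"
      proof (intro add_mono)
        show "1 \<le> 1 * y ^ q" using y by simp
        show "real T \<le> 433 * y ^ q" using bounds(3) pw[of 2] by (simp add: q_def)
        show "real l \<le> 5 * y ^ q" using bounds(4) pw[of 1] by (simp add: q_def)
        show "real K \<le> 5 * y ^ q" using bounds(5) pw[of 1] by (simp add: q_def K_def)
        have "C0 * y ^ 14 \<le> C0 * y ^ q" using pw[of 14] C0 by (intro mult_left_mono) (auto simp: q_def)
        then show "real m \<le> C0 * y ^ q" using bounds(6) by linarith
        show "real k \<le> 1 * y ^ q" using bounds(2) pw[of 1] by (simp add: q_def)
        have "C * y ^ r \<le> C * y ^ q" using pw[of r] C(1) by (intro mult_left_mono) (auto simp: q_def)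
        then show "real d \<le> C * y ^ q" using d C(2)[OF y] unfolding y_def[symmetric] by linarith
      qed
      also have "\<dots> = D * y ^ q" by (simp add: D_def algebra_simps)
      finally show ?thesis .
    qed
    then have "real Z ^ 3 \<le> (D * y ^ q) ^ 3" by (intro power_mono) auto
    also have "\<dots> = D ^ 3 * y ^ (3 * q)" by (simp add: power_mult_distrib mult.commute flip: power_mult)
    finally have Z3: "real Z ^ 3 \<le> D ^ 3 * y ^ (3 * q)" .
    have "ln (real m) \<le> ln (C0 * y ^ 14)" using bounds(6) m1 by (intro ln_mono) auto
    also have "\<dots> = ln C0 + 14 * ln y" using C0 y by (simp add: ln_mult ln_realpow)
    finally have lnm: "ln (real m) \<le> ln C0 + 14 * ln y" .
    have "real K * ln (real m) \<le> 5 * y * (ln C0 + 14 * ln y)"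
      using bounds(5) lnm m1 y by (intro mult_mono) (auto simp: K_def)
    then have "exp (real K * ln (real m)) \<le> exp (5 * y * (ln C0 + 14 * ln y))" by simp
    moreover have "exp (real K * ln (real m)) = real m ^ K"
      using m1 by (simp add: exp_of_nat_mult)
    ultimately have mK: "real m ^ K \<le> exp (5 * y * (ln C0 + 14 * ln y))" by simp
    have sq: "(real m ^ K)\<^sup>2 \<le> exp (10 * y * (ln C0 + 14 * ln y))"
    proof -
      have "(real m ^ K)\<^sup>2 \<le> (exp (5 * y * (ln C0 + 14 * ln y)))\<^sup>2" using mK by (intro power_mono) auto
      also have "\<dots> = exp (10 * y * (ln C0 + 14 * ln y))"
        by (simp add: power2_eq_square flip: exp_add)
      finally show ?thesis .
    qed
    have D3: "1 \<le> D ^ 3" using D by simp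
    have "200 * (D ^ 3 * y ^ (3 * q)) = exp (ln (200 * D ^ 3) + real (3 * q) * ln y)"
    proof -
      have "exp (real (3 * q) * ln y) = y ^ (3 * q)" using y by (simp only: exp_of_nat_mult) simp
      moreover have "exp (ln (200 * D ^ 3)) = 200 * D ^ 3" using D by simp
      ultimately show ?thesis by (simp only: exp_add mult.assoc)
    qed
    also have "\<dots> \<le> exp (y * (ln (200 * D ^ 3) + real (3 * q) * ln y))"
    proof -
      have "0 \<le> ln (200 * D ^ 3) + real (3 * q) * ln y" using D3 y by (intro add_nonneg_nonneg mult_nonneg_nonneg ln_ge_zero) auto
      then show ?thesis using y mult_right_mono[of 1 y "ln (200 * D ^ 3) + real (3 * q) * ln y"] by simp
    qed
    finally have poly_part: "200 * (D ^ 3 * y ^ (3 * q)) \<le> exp (y * (ln (200 * D ^ 3) + real (3 * q) * ln y))" .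
    have "real (total_time n d k T l m) \<le> real (400 * (n * Z ^ 3) + 200 * ((m ^ K)\<^sup>2 * Z ^ 3))"
      using time by (simp only: of_nat_le_iff)
    also have "\<dots> = real n * (400 * real Z ^ 3) + (real m ^ K)\<^sup>2 * (200 * real Z ^ 3)" by simp
    also have "\<dots> \<le> real n * (400 * (D ^ 3 * y ^ (3 * q))) +
        exp (10 * y * (ln C0 + 14 * ln y)) * exp (y * (ln (200 * D ^ 3) + real (3 * q) * ln y))"
      using Z3 sq poly_part by (intro add_mono mult_mono mult_left_mono) auto
    also have "\<dots> = real n * poly (monom (400 * D ^ 3) (3 * q)) y +
       exp (y * poly [:10 * ln C0 + ln (200 * D ^ 3), real (140 + 3 * q):] (ln y))"
      by (simp add: poly_monom algebra_simps flip: exp_add)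
    finally show ?thesis unfolding T_def l_def m_def y_def .
  qed
  then show ?thesis by (rule that)
qed

theorem mainTheorem11:
  "\<exists>p > (0 :: real). \<forall>R :: real poly. \<exists>(alg :: com) (P :: real poly) (Q :: real poly).
     \<forall>(n :: nat) (d :: nat) (k :: nat) (\<epsilon> :: real) (A :: real mat).
       A \<in> carrier_mat n d \<longrightarrow> 0 < \<epsilon> \<longrightarrow> \<epsilon> < 1 \<longrightarrow> 1 \<le> k \<longrightarrow> k \<le> n \<longrightarrow>
       real d \<le> poly R (real k / \<epsilon>) \<longrightarrow>
       (\<exists>t :: nat.
          real t \<le> real n * poly P (real k / \<epsilon>)
                   + exp (real k / \<epsilon> * poly Q (ln (real k / \<epsilon>))) \<and>
          halts_within t alg (input_state A k \<epsilon>) \<and>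
          (\<forall>s \<in> set_pmf (final_state t alg (input_state A k \<epsilon>)).
             read_matrix ''X'' n k s \<in> assignment_matrices n k) \<and>
          measure_pmf.prob (final_state t alg (input_state A k \<epsilon>))
            {s. frobenius_norm (read_matrix ''X'' n k s * read_matrix ''D'' k d s - A)
                  \<le> (1 + \<epsilon>) * kmeans_opt A k} \<ge> p)"
proof (rule exI[of _ "9 / 16 :: real"], intro conjI allI)
  fix R :: "real poly"
  obtain P Q where PQ: "\<And>n d k \<epsilon>. 0 < \<epsilon> \<Longrightarrow> \<epsilon> < 1 \<Longrightarrow> 1 \<le> k \<Longrightarrow> k \<le> n \<Longrightarrow> real d \<le> poly R (real k / \<epsilon>) \<Longrightarrow>
       real (total_time n d k (rounds k) (mean_size \<epsilon>) (sample_size k \<epsilon>))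
         \<le> real n * poly P (real k / \<epsilon>) + exp (real k / \<epsilon> * poly Q (ln (real k / \<epsilon>)))"
    using total_time_bound[of R] by blast
  have main: "\<exists>t :: nat.
          real t \<le> real n * poly P (real k / \<epsilon>)
                   + exp (real k / \<epsilon> * poly Q (ln (real k / \<epsilon>))) \<and>
          halts_within t kmeans_alg (input_state A k \<epsilon>) \<and>
          (\<forall>s \<in> set_pmf (final_state t kmeans_alg (input_state A k \<epsilon>)).
             read_matrix ''X'' n k s \<in> assignment_matrices n k) \<and>
          measure_pmf.prob (final_state t kmeans_alg (input_state A k \<epsilon>))
            {s. frobenius_norm (read_matrix ''X'' n k s * read_matrix ''D'' k d s - A)
                  \<le> (1 + \<epsilon>) * kmeans_opt A k} \<ge> 9 / 16"
    if A: "A \<in> carrier_mat n d" and \<epsilon>: "0 < \<epsilon>" "\<epsilon> < 1" and k: "1 \<le> k" "k \<le> n"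
      and d: "real d \<le> poly R (real k / \<epsilon>)" for n d k \<epsilon> A
  proof -
    let ?t = "total_time n d k (rounds k) (mean_size \<epsilon>) (sample_size k \<epsilon>)"
    obtain \<mu> where \<mu>: "exec ?t kmeans_alg (input_state A k \<epsilon>) \<mu>"
      "\<forall>s\<in>set_pmf \<mu>. read_matrix ''X'' n k s \<in> assignment_matrices n k"
      "measure_pmf.prob \<mu> {s. frobenius_norm (read_matrix ''X'' n k s * read_matrix ''D'' k d s - A)
                  \<le> (1 + \<epsilon>) * kmeans_opt A k} \<ge> 9 / 16"
      using kmeans_alg_correct[OF A \<epsilon> k] by blast
    have "final_state ?t kmeans_alg (input_state A k \<epsilon>) = \<mu>" by (rule exec_final_state[OF \<mu>(1)])
    then show ?thesis using PQ[OF \<epsilon> k d] exec_halts[OF \<mu>(1)] \<mu>(2,3) by (intro exI[of _ ?t]) simp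
  qed
  show "\<exists>(alg :: com) (P :: real poly) (Q :: real poly).
     \<forall>(n :: nat) (d :: nat) (k :: nat) (\<epsilon> :: real) (A :: real mat).
       A \<in> carrier_mat n d \<longrightarrow> 0 < \<epsilon> \<longrightarrow> \<epsilon> < 1 \<longrightarrow> 1 \<le> k \<longrightarrow> k \<le> n \<longrightarrow>
       real d \<le> poly R (real k / \<epsilon>) \<longrightarrow>
       (\<exists>t :: nat.
          real t \<le> real n * poly P (real k / \<epsilon>)
                   + exp (real k / \<epsilon> * poly Q (ln (real k / \<epsilon>))) \<and>
          halts_within t alg (input_state A k \<epsilon>) \<and>
          (\<forall>s \<in> set_pmf (final_state t alg (input_state A k \<epsilon>)).
             read_matrix ''X'' n k s \<in> assignment_matrices n k) \<and>
          measure_pmf.prob (final_state t alg (input_state A k \<epsilon>))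
            {s. frobenius_norm (read_matrix ''X'' n k s * read_matrix ''D'' k d s - A)
                  \<le> (1 + \<epsilon>) * kmeans_opt A k} \<ge> 9 / 16)"
    \<comment> \<open>The program is the same for every \<open>R\<close>; the bound on the dimension
      only influences \<open>P\<close> and \<open>Q\<close>.\<close>
    by (rule exI[of _ kmeans_alg], rule exI[of _ P], rule exI[of _ Q], intro allI impI, rule main)
qed simp

end
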